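(* Let $P$ be a tree poset of height $k$. For every $\varepsilon>0$ there exists $n_0$ such that for all $n\geq n_0$, the number of families $\mathcal{F}\subseteq\mathcal{B}_n$ that contain no induced copy of $P$ is at most $2^{(k-1+\varepsilon)\binom{n}{\lfloor n/2\rfloor}}$. (Equivalently, the number of induced $P$-free families in $\mathcal{B}_n$ is at most $2^{(k-1+o(1))\binom{n}{\lfloor n/2\rfloor}}$.)
   Context: $\mathcal{B}_n$ is the family of all subsets of $[n]$ ordered by inclusion. A tree poset is a finite poset whose Hasse diagram (as an undirected graph) is a tree; its height is the largest number of elements in a chain. An induced copy of $P$ in $\mathcal{F}$ is the image of an injective map $f:P\to\mathcal{F}$ with $f(x)\subsetneq f(y)$ if and only if $x<_P y$; $\mathcal{F}$ is induced $P$-free if it contains no induced copy of $P$. *)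

theory Defs
  imports Complex_Main
begin

definition finite_poset :: "'a set \<Rightarrow> ('a \<Rightarrow> 'a \<Rightarrow> bool) \<Rightarrow> bool" where
  "finite_poset A le \<longleftrightarrow> finite A \<and>
     (\<forall>x\<in>A. le x x) \<and>
     (\<forall>x\<in>A. \<forall>y\<in>A. le x y \<and> le y x \<longrightarrow> x = y) \<and>
     (\<forall>x\<in>A. \<forall>y\<in>A. \<forall>z\<in>A. le x y \<and> le y z \<longrightarrow> le x z)"

definition pless :: "('a \<Rightarrow> 'a \<Rightarrow> bool) \<Rightarrow> 'a \<Rightarrow> 'a \<Rightarrow> bool" where
  "pless le x y \<longleftrightarrow> le x y \<and> x \<noteq> y"

definition covers :: "'a set \<Rightarrow> ('a \<Rightarrow> 'a \<Rightarrow> bool) \<Rightarrow> 'a \<Rightarrow> 'a \<Rightarrow> bool" where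
  "covers A le x y \<longleftrightarrow> x \<in> A \<and> y \<in> A \<and> pless le x y \<and>
     \<not> (\<exists>z\<in>A. pless le x z \<and> pless le z y)"

definition hasse_edges :: "'a set \<Rightarrow> ('a \<Rightarrow> 'a \<Rightarrow> bool) \<Rightarrow> 'a set set" where
  "hasse_edges A le = {{x, y} | x y. covers A le x y}"

definition hasse_connected :: "'a set \<Rightarrow> ('a \<Rightarrow> 'a \<Rightarrow> bool) \<Rightarrow> bool" where
  "hasse_connected A le \<longleftrightarrow>
     (\<forall>x\<in>A. \<forall>y\<in>A. (\<lambda>u v. covers A le u v \<or> covers A le v u)\<^sup>*\<^sup>* x y)"

definition tree_poset :: "'a set \<Rightarrow> ('a \<Rightarrow> 'a \<Rightarrow> bool) \<Rightarrow> bool" where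
  "tree_poset A le \<longleftrightarrow> finite_poset A le \<and> A \<noteq> {} \<and>
     hasse_connected A le \<and> card (hasse_edges A le) = card A - 1"

definition is_chain :: "'a set \<Rightarrow> ('a \<Rightarrow> 'a \<Rightarrow> bool) \<Rightarrow> 'a set \<Rightarrow> bool" where
  "is_chain A le C \<longleftrightarrow> C \<subseteq> A \<and> (\<forall>x\<in>C. \<forall>y\<in>C. le x y \<or> le y x)"

definition poset_height :: "'a set \<Rightarrow> ('a \<Rightarrow> 'a \<Rightarrow> bool) \<Rightarrow> nat" where
  "poset_height A le = Max (card ` {C. is_chain A le C})"

definition has_induced_copy :: "'a set \<Rightarrow> ('a \<Rightarrow> 'a \<Rightarrow> bool) \<Rightarrow> 'b set set \<Rightarrow> bool" where
  "has_induced_copy A le F \<longleftrightarrow>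
     (\<exists>f. inj_on f A \<and> f ` A \<subseteq> F \<and>
          (\<forall>x\<in>A. \<forall>y\<in>A. f x \<subset> f y \<longleftrightarrow> pless le x y))"

definition induced_free :: "'a set \<Rightarrow> ('a \<Rightarrow> 'a \<Rightarrow> bool) \<Rightarrow> 'b set set \<Rightarrow> bool" where
  "induced_free A le F \<longleftrightarrow> \<not> has_induced_copy A le F"

end

theory Submission
  imports Defs "HOL-Probability.Probability" "HOL-Real_Asymp.Real_Asymp"
begin

text \<open>
  Take k copies of the family F, one for each level of P, and repeatedly delete a vertex of this layered
  comparability graph whose remaining neighbours in one direction are not spread out. If something
  survives, P can be placed at random, branch by branch, and two incomparable elements of P are
  unlikely to become comparable; so F contains P. If everything is deleted, each x in F has a level i
  deleted upwards while level i + 1 is deleted downwards, and all comparabilities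
  between sets with the same i have been charged to one of their ends. Hence an
  induced P-free family is, up to sets far from the middle layers, a union of k - 1 families that
  span few comparabilities, and by the graph container method (with supersaturation
  from random maximal chains) there are at most \<open>2 powr ((1 + o(1)) * (n choose (n div 2)))\<close> such families.
\<close>

section \<open>Random maximal chains\<close>

text \<open>The layers kept must form a window wider than the square root of n, or the sets outside
  it would not be negligible; \<open>L\<close> is therefore about n powr 0.6, and the number of
  possible distances grows with n. Densities are measured distance by distance, relative to all sets
  at that distance. At distance d, sets with half of their difference to x inside a fixed set of
  O(L) elements have density about (L/n) powr (d/2), so any larger density forces spreading. One
  half is the right share: when the root of a branch moves from z back to x, their difference must
  not be covered jointly by a prescribed set and by the elements the branch already occupies, and
  each of the two covers less than half. For short distances the available density, n powr -0.4, is
  too large to be summed over all distances, or to be paid for every layer. Hence thresholds on two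
  scales, and a container algorithm that uses only long distances until a bounded multiple of the
  central binomial coefficient is left. Each move of a root costs one \<sigma>; the number of moves
  depends on P alone, so \<sigma> is a constant.\<close>

text \<open>The direction b is up for \<open>True\<close> and down for \<open>False\<close>; every notion below comes in both directions.\<close>

definition dif :: "bool \<Rightarrow> 'b set \<Rightarrow> 'b set \<Rightarrow> 'b set" where
  "dif b x y = (if b then y - x else x - y)"

definition beyond :: "bool \<Rightarrow> 'b set \<Rightarrow> 'b set \<Rightarrow> bool" where
  "beyond b x y \<longleftrightarrow> (if b then x \<subset> y else y \<subset> x)"

definition pool :: "nat \<Rightarrow> bool \<Rightarrow> nat set \<Rightarrow> nat set" where
  "pool n b x = (if b then {..<n} - x else x)"

abbreviation (input) sphere_size :: "nat \<Rightarrow> bool \<Rightarrow> nat set \<Rightarrow> nat \<Rightarrow> real" where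
  "sphere_size n b x d \<equiv> real (card (pool n b x) choose d)"

abbreviation (input) at_dist :: "bool \<Rightarrow> 'b set \<Rightarrow> nat \<Rightarrow> 'b set set \<Rightarrow> 'b set set" where
  "at_dist b x d Y \<equiv> {y \<in> Y. card (dif b x y) = d}"

abbreviation (input) nbrs_at :: "bool \<Rightarrow> 'b set \<Rightarrow> nat \<Rightarrow> 'b set set \<Rightarrow> 'b set set" where
  "nbrs_at b x d Y \<equiv> {y \<in> Y. beyond b x y \<and> card (dif b x y) = d}"

abbreviation (input) central :: "nat \<Rightarrow> real" where
  "central n \<equiv> real (n choose (n div 2))"

abbreviation (input) half_in :: "'b set \<Rightarrow> 'b set \<Rightarrow> bool" where
  "half_in D Q \<equiv> card D \<le> 2 * card (D \<inter> Q)"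

text \<open>A permutation \<open>p\<close> stands for the maximal chain formed by the sets of its
  prefixes.\<close>

definition on_chain :: "nat list \<Rightarrow> nat set \<Rightarrow> bool" where
  "on_chain p x \<longleftrightarrow> set (take (card x) p) = x"

text \<open>Such a permutation is an ordering of \<open>x\<close>, followed by one of
  \<open>y - x\<close> and one of the rest. The case \<open>x = y\<close> counts the chains through
  a single set.\<close>

lemma card_on_chain2:
  assumes "x \<subseteq> y" "y \<subseteq> {..<n}"
  shows "card {p \<in> permutations_of_set {..<n}. on_chain p x \<and> on_chain p y}
    = fact (card x) * fact (card y - card x) * fact (n - card y)"
proof -
  have fy: "finite y" and fx: "finite x" using assms by (auto intro: finite_subset)
  have cxy: "card x \<le> card y" using assms fy by (simp add: card_mono)
  have cyn: "card y \<le> n" using assms by (metis card_lessThan card_mono finite_lessThan)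
  let ?S = "permutations_of_set x \<times> permutations_of_set (y - x) \<times> permutations_of_set ({..<n} - y)"
  let ?f = "\<lambda>(a, b, c). a @ b @ c :: nat list"
  have len: "length a = card z" if "a \<in> permutations_of_set z" for a and z :: "nat set"
    using that by (rule length_finite_permutations_of_set)
  have inj: "inj_on ?f ?S"
    by (auto simp: inj_on_def dest!: len)
  have img: "?f ` ?S = {p \<in> permutations_of_set {..<n}. on_chain p x \<and> on_chain p y}" (is "_ = ?R")
  proof (intro equalityI subsetI)
    fix p assume "p \<in> ?f ` ?S"
    then obtain a b c where p: "p = a @ b @ c" and a: "a \<in> permutations_of_set x"
      and b: "b \<in> permutations_of_set (y - x)" and c: "c \<in> permutations_of_set ({..<n} - y)"
      by auto
    have sx: "set a = x" "distinct a" "set b = y - x" "distinct b" "set c = {..<n} - y" "distinct c"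
      using a b c by (auto dest: permutations_of_setD)
    have la: "length a = card x" "length b = card (y - x)" using len a b by auto
    have lb: "length a + length b = card y"
      using la assms fx fy cxy by (simp add: card_Diff_subset)
    have "on_chain p x" using la sx by (simp add: on_chain_def p)
    moreover have "on_chain p y"
    proof -
      have "take (card y) p = a @ b" using lb by (simp add: p)
      then show ?thesis using sx assms by (auto simp: on_chain_def)
    qed
    moreover have "p \<in> permutations_of_set {..<n}"
      using sx assms by (intro permutations_of_setI) (auto simp: p)
    ultimately show "p \<in> ?R" by simp
  next
    fix p assume p: "p \<in> ?R"
    define a b c where "a = take (card x) p" and "b = drop (card x) (take (card y) p)" and "c = drop (card y) p"
    have sp: "set p = {..<n}" "distinct p" using p by (auto dest: permutations_of_setD)
    have ab: "a @ b = take (card y) p"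
      unfolding a_def b_def using cxy by (metis append_take_drop_id min.absorb1 take_take)
    have abc: "p = a @ b @ c" using ab by (simp add: c_def flip: append_assoc)
    have "set a = x" "set (a @ b) = y" using p unfolding ab by (auto simp: on_chain_def a_def)
    moreover have "distinct (a @ b @ c)" using sp abc by simp
    ultimately have "set b = y - x" "set c = {..<n} - y" "distinct a" "distinct b" "distinct c"
      using sp(1) unfolding abc by auto
    with \<open>set a = x\<close> have "(a, b, c) \<in> ?S" by (auto intro: permutations_of_setI)
    then show "p \<in> ?f ` ?S" unfolding abc by (rule rev_image_eqI) simp
  qed
  have "card ?R = card ?S" using card_image[OF inj] img by simp
  also have "\<dots> = fact (card x) * (fact (card y - card x) * fact (n - card y))"
    using assms fx fy by (simp add: card_cartesian_product card_Diff_subset)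
  finally show ?thesis by (simp add: mult.assoc)
qed

lemma on_chain_comparable:
  assumes "on_chain p x" "on_chain p y" "card x \<le> card y"
  shows "x \<subseteq> y"
  using assms set_take_subset_set_take unfolding on_chain_def by metis

text \<open>The Lubell weight: the probability that a uniformly random maximal chain passes through
  \<open>x\<close>.\<close>

definition wt :: "nat \<Rightarrow> nat set \<Rightarrow> real" where
  "wt n x = 1 / real (n choose card x)"

text \<open>The conditional probability that a random maximal chain through \<open>x\<close> also
  passes through one given set at distance \<open>d\<close> in direction \<open>b\<close>.\<close>

definition cwt :: "nat \<Rightarrow> bool \<Rightarrow> nat set \<Rightarrow> nat \<Rightarrow> real" where
  "cwt n b x d = 1 / sphere_size n b x d"

lemma dif_beyond:
  assumes "beyond b x y" "x \<subseteq> {..<n}" "y \<subseteq> {..<n}"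
  shows "beyond (\<not> b) y x" "dif b x y \<subseteq> pool n b x" "card (dif b x y) > 0"
    "dif (\<not> b) y x = dif b x y"
proof -
  have "finite x" "finite y" using assms by (auto intro: finite_subset)
  then show "beyond (\<not> b) y x" "dif b x y \<subseteq> pool n b x" "card (dif b x y) > 0"
    "dif (\<not> b) y x = dif b x y"
    using assms by (auto simp: beyond_def dif_def pool_def card_gt_0_iff split: if_splits)
qed

lemma wt_cwt:
  assumes "beyond b x y" "x \<subseteq> {..<n}" "y \<subseteq> {..<n}"
  shows "wt n x * cwt n b x (card (dif b x y)) =
    real (card {p \<in> permutations_of_set {..<n}. on_chain p x \<and> on_chain p y}) / fact n"
proof -
  have *: "wt n u * cwt n True u (card v - card u) = wt n v * cwt n False v (card v - card u)
    \<and> wt n u * cwt n True u (card v - card u) =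
      real (card {p \<in> permutations_of_set {..<n}. on_chain p u \<and> on_chain p v}) / fact n"
    if uv: "u \<subseteq> v" "v \<subseteq> {..<n}" for u v
  proof -
    have fv: "finite v" and fu: "finite u" using uv by (auto intro: finite_subset)
    have cuv: "card u \<le> card v" using uv fv by (simp add: card_mono)
    have cvn: "card v \<le> n" using uv by (metis card_lessThan card_mono finite_lessThan)
    have c: "card ({..<n} - u) = n - card u" using uv fu by (subst card_Diff_subset) auto
    show ?thesis
      unfolding wt_def cwt_def pool_def card_on_chain2[OF uv] using cuv cvn c
      by (simp add: binomial_fact field_simps)
  qed
  have c: "card (v - u) = card v - card u" if "u \<subset> v" "v \<subseteq> {..<n}" for u v
    using that by (metis card_Diff_subset finite_lessThan finite_subset psubset_imp_subset)
  show ?thesis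
  proof (cases b)
    case True
    then show ?thesis using assms *[of x y] c[of x y] by (auto simp: beyond_def dif_def)
  next
    case False
    moreover have "(\<lambda>p. on_chain p y \<and> on_chain p x) = (\<lambda>p. on_chain p x \<and> on_chain p y)" by auto
    ultimately show ?thesis using assms *[of y x] c[of y x] 
      by (auto simp: beyond_def dif_def conj_commute)
  qed
qed

lemma wt_card:
  assumes "x \<subseteq> {..<n}"
  shows "wt n x = real (card {p \<in> permutations_of_set {..<n}. on_chain p x}) / fact n"
proof -
  have "card x \<le> n" using assms by (metis card_lessThan card_mono finite_lessThan)
  then show ?thesis
    using card_on_chain2[of x x n] assms by (simp add: wt_def binomial_fact field_simps)
qed

text \<open>Both sides are the probability that the chain contains \<open>x\<close> and
  \<open>y\<close>, computed from either end. This is what transfers degree bounds from one end of a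
  comparability to the other.\<close>

lemma wt_cwt_sym:
  assumes "beyond b x y" "x \<subseteq> {..<n}" "y \<subseteq> {..<n}"
  shows "wt n x * cwt n b x (card (dif b x y)) = wt n y * cwt n (\<not> b) y (card (dif b x y))"
  using wt_cwt[OF assms] wt_cwt[of "\<not> b" y x n] dif_beyond[OF assms] assms
  by (simp add: conj_commute)

text \<open>The left-hand side is the expected number of points of A on a random maximal chain; a point
  with a partner on the chain is paid for by the weight of its partners.\<close>

lemma chain_partner_bound:
  fixes A :: "nat set set" and Z :: "bool \<Rightarrow> nat set \<Rightarrow> nat set set"
  assumes A: "A \<subseteq> Pow {..<n}"
    and Z: "\<And>b x y. x \<in> A \<Longrightarrow> y \<in> Z b x \<Longrightarrow> y \<in> A \<and> beyond b x y"
    and deg: "\<And>x. x \<in> A \<Longrightarrow> (\<Sum>b\<in>UNIV. \<Sum>y\<in>Z b x. cwt n b x (card (dif b x y))) \<le> e"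
    and lonely: "\<And>C. C \<subseteq> A \<Longrightarrow> (\<And>x y. x \<in> C \<Longrightarrow> y \<in> C \<Longrightarrow> x \<subseteq> y \<or> y \<subseteq> x) \<Longrightarrow>
      card {x \<in> C. \<forall>b. Z b x \<inter> C = {}} \<le> s"
  shows "(1 - e) * (\<Sum>x\<in>A. wt n x) \<le> real s"
proof -
  let ?P = "permutations_of_set {..<n}"
  have finA: "finite A" using A by (rule finite_subset) auto
  have finZ: "finite (Z b x)" if "x \<in> A" for b x
    using Z[OF that] finA by (meson finite_subset subsetI)
  have fin: "finite ?P" by simp
  \<comment> \<open>Pointwise form for one chain: at most \<open>s\<close> points are lonely, and
    each other point is counted by some pair it forms with a partner on the chain. Averaging over
    \<open>p\<close> yields the claim.\<close>
  have pt: "real (card {x \<in> A. on_chain p x}) \<le>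
      real s + (\<Sum>x\<in>A. \<Sum>b\<in>UNIV. \<Sum>y\<in>Z b x. of_bool (on_chain p x \<and> on_chain p y))" for p
  proof -
    let ?C = "{x \<in> A. on_chain p x}"
    let ?lo = "{x \<in> ?C. \<forall>b. Z b x \<inter> ?C = {}}"
    have "card ?lo \<le> s"
    proof (rule lonely)
      show "x \<subseteq> y \<or> y \<subseteq> x" if "x \<in> ?C" "y \<in> ?C" for x y
        using that on_chain_comparable[of p x y] on_chain_comparable[of p y x] by force
    qed auto
    moreover have "card ?C \<le> card ?lo + card (?C - ?lo)"
    proof -
      have "?C = ?lo \<union> (?C - ?lo)" by blast
      then show ?thesis using card_Un_le[of ?lo "?C - ?lo"] by argo
    qed
    moreover have "real (card (?C - ?lo)) \<le>
        (\<Sum>x\<in>A. \<Sum>b\<in>UNIV. \<Sum>y\<in>Z b x. of_bool (on_chain p x \<and> on_chain p y))"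
    proof -
      have "real (card (?C - ?lo)) = (\<Sum>x\<in>?C - ?lo. 1)" by simp
      also have "\<dots> \<le> (\<Sum>x\<in>?C - ?lo. \<Sum>b\<in>UNIV. \<Sum>y\<in>Z b x. of_bool (on_chain p x \<and> on_chain p y))"
      proof (rule sum_mono)
        fix x assume x: "x \<in> ?C - ?lo"
        then obtain b y where y: "y \<in> Z b x" "y \<in> ?C" by auto
        have "(1::real) = of_bool (on_chain p x \<and> on_chain p y)" using x y by auto
        also have "\<dots> \<le> (\<Sum>y\<in>Z b x. of_bool (on_chain p x \<and> on_chain p y))"
          using y finZ x by (intro member_le_sum) auto
        also have "\<dots> \<le> (\<Sum>b\<in>UNIV. \<Sum>y\<in>Z b x. of_bool (on_chain p x \<and> on_chain p y))"
          by (intro member_le_sum[of b UNIV "\<lambda>b. \<Sum>y\<in>Z b x. of_bool (on_chain p x \<and> on_chain p y)"])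
            (auto intro: sum_nonneg)
        finally show "1 \<le> (\<Sum>b\<in>UNIV. \<Sum>y\<in>Z b x. of_bool (on_chain p x \<and> on_chain p y) :: real)" .
      qed
      also have "\<dots> \<le> (\<Sum>x\<in>A. \<Sum>b\<in>UNIV. \<Sum>y\<in>Z b x. of_bool (on_chain p x \<and> on_chain p y))"
        using finA by (intro sum_mono2) (auto intro!: sum_nonneg)
      finally show ?thesis .
    qed
    ultimately show ?thesis by linarith
  qed
  have E1: "(\<Sum>p\<in>?P. real (card {x \<in> A. on_chain p x})) = fact n * (\<Sum>x\<in>A. wt n x)"
  proof -
    have "(\<Sum>p\<in>?P. real (card {x \<in> A. on_chain p x})) = (\<Sum>p\<in>?P. \<Sum>x\<in>A. of_bool (on_chain p x))"
      using finA by (simp add: Int_def)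
    also have "\<dots> = (\<Sum>x\<in>A. \<Sum>p\<in>?P. of_bool (on_chain p x))" by (rule sum.swap)
    also have "\<dots> = (\<Sum>x\<in>A. fact n * wt n x)"
      using A by (intro sum.cong) (auto simp: wt_card Int_def)
    finally show ?thesis by (simp add: sum_distrib_left)
  qed
  have E2: "(\<Sum>p\<in>?P. \<Sum>x\<in>A. \<Sum>b\<in>UNIV. \<Sum>y\<in>Z b x. of_bool (on_chain p x \<and> on_chain p y)) \<le>
      fact n * (\<Sum>x\<in>A. wt n x * e)"
  proof -
    have "(\<Sum>p\<in>?P. \<Sum>x\<in>A. \<Sum>b\<in>UNIV. \<Sum>y\<in>Z b x. of_bool (on_chain p x \<and> on_chain p y)) =
        (\<Sum>x\<in>A. \<Sum>p\<in>?P. \<Sum>b\<in>UNIV. \<Sum>y\<in>Z b x. of_bool (on_chain p x \<and> on_chain p y) :: real)"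
      by (rule sum.swap)
    also have "\<dots> = (\<Sum>x\<in>A. \<Sum>b\<in>UNIV. \<Sum>p\<in>?P. \<Sum>y\<in>Z b x. of_bool (on_chain p x \<and> on_chain p y) :: real)"
      by (intro sum.cong refl sum.swap)
    also have "\<dots> = (\<Sum>x\<in>A. \<Sum>b\<in>UNIV. \<Sum>y\<in>Z b x. \<Sum>p\<in>?P. of_bool (on_chain p x \<and> on_chain p y) :: real)"
      by (intro sum.cong refl sum.swap)
    also have "\<dots> = (\<Sum>x\<in>A. \<Sum>b\<in>UNIV. \<Sum>y\<in>Z b x. fact n * (wt n x * cwt n b x (card (dif b x y))))"
    proof (intro sum.cong refl)
      fix x b y assume "x \<in> A" "y \<in> Z b x"
      with Z have "x \<in> A" "y \<in> A" "beyond b x y" by auto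
      with A have "beyond b x y" "x \<subseteq> {..<n}" "y \<subseteq> {..<n}" by auto
      from wt_cwt[OF this]
      show "(\<Sum>p\<in>?P. of_bool (on_chain p x \<and> on_chain p y)) = fact n * (wt n x * cwt n b x (card (dif b x y)))"
        by (simp add: Int_def)
    qed
    also have "\<dots> = fact n * (\<Sum>x\<in>A. wt n x * (\<Sum>b\<in>UNIV. \<Sum>y\<in>Z b x. cwt n b x (card (dif b x y))))"
      by (simp only: sum_distrib_left)
    also have "\<dots> \<le> fact n * (\<Sum>x\<in>A. wt n x * e)"
      using deg by (intro mult_left_mono sum_mono) (auto simp: wt_def)
    finally show ?thesis .
  qed
  have "fact n * (\<Sum>x\<in>A. wt n x) \<le> (\<Sum>p\<in>?P. real s + (\<Sum>x\<in>A. \<Sum>b\<in>UNIV. \<Sum>y\<in>Z b x. of_bool (on_chain p x \<and> on_chain p y)))"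
    unfolding E1[symmetric] by (intro sum_mono pt)
  also have "\<dots> \<le> fact n * real s + fact n * (\<Sum>x\<in>A. wt n x * e)"
    using E2 by (simp add: sum.distrib)
  also have "\<dots> = fact n * (real s + e * (\<Sum>x\<in>A. wt n x))"
    by (simp add: sum_distrib_left algebra_simps)
  finally have "(\<Sum>x\<in>A. wt n x) \<le> real s + e * (\<Sum>x\<in>A. wt n x)"
    by (simp only: mult_le_cancel_left_pos fact_gt_zero)
  then show ?thesis by (simp add: algebra_simps)
qed

text \<open>Applied with i the least integer at least \<open>d/2\<close>; the factor 4 absorbs \<open>d choose i\<close>.\<close>

lemma card_heavy_subsets:
  fixes X :: "'b set"
  assumes X: "finite X" and Q: "finite Q" "card Q \<le> K" and K: "4 * K \<le> card X" and i: "d \<le> 2 * i" "i \<le> d" 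
    and imp: "\<And>D. D \<in> \<D> \<Longrightarrow> D \<subseteq> X \<and> card D = d \<and> i \<le> card (D \<inter> Q)"
  shows "real (card \<D>) \<le> (4 * K / card X) ^ i * real (card X choose d)"
proof (cases "card X < d \<or> card X = 0")
  case True
  have "\<D> = {}" if "card X < d"
    using imp X that by (metis card_mono equals0I leD)
  moreover have "\<D> \<subseteq> {{}}" "i = 0" if "card X = 0" "d \<le> card X" using that X i imp by auto
  moreover have "card \<D> \<le> 1" if "\<D> \<subseteq> {{}}" using that by (metis card.empty card_mono finite.emptyI finite_insert card_insert_disjoint empty_iff One_nat_def)
  ultimately show ?thesis using True by (cases "card X < d") auto
next
  case False
  define m where "m = card X"
  have d: "d \<le> m" "m > 0" using False by (auto simp: m_def)
  let ?I = "{I. I \<subseteq> Q \<inter> X \<and> card I = i}"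
  let ?J = "\<lambda>I. {J. J \<subseteq> X - I \<and> card J = d - i}"
  have finI: "finite ?I" using Q by auto
  \<comment> \<open>Fix \<open>i\<close> elements of \<open>D\<close> inside \<open>Q\<close> and
    leave the rest of \<open>D\<close> free; a set counted several times does no harm.\<close>
  have "\<D> \<subseteq> (\<Union>I\<in>?I. (\<lambda>J. I \<union> J) ` ?J I)"
  proof
    fix D assume "D \<in> \<D>"
    then have D: "D \<subseteq> X" "card D = d" "i \<le> card (D \<inter> Q)" using imp by auto
    have fD: "finite D" using D X by (auto intro: finite_subset)
    obtain I where I: "I \<subseteq> D \<inter> Q" "card I = i" using D(3) by (meson obtain_subset_with_card_n)
    have "I \<in> ?I" using I D by auto
    moreover have "D - I \<in> ?J I" using I D fD by (auto simp: card_Diff_subset finite_subset)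
    moreover have "D = I \<union> (D - I)" using I by auto
    ultimately show "D \<in> (\<Union>I\<in>?I. (\<lambda>J. I \<union> J) ` ?J I)" by blast
  qed
  then have "card \<D> \<le> card (\<Union>I\<in>?I. (\<lambda>J. I \<union> J) ` ?J I)"
    using finI X by (intro card_mono finite_UN_I finite_imageI) auto
  also have "\<dots> \<le> (\<Sum>I\<in>?I. card ((\<lambda>J. I \<union> J) ` ?J I))" by (rule card_UN_le[OF finI])
  also have "\<dots> \<le> (\<Sum>I\<in>?I. (m - i) choose (d - i))"
  proof (rule sum_mono)
    fix I assume I: "I \<in> ?I"
    have "card ((\<lambda>J. I \<union> J) ` ?J I) \<le> card (?J I)"
      using X by (intro card_image_le) auto
    also have "\<dots> = (m - i) choose (d - i)"
      using X I by (subst n_subsets) (auto simp: m_def card_Diff_subset finite_subset[of _ X])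
    finally show "card ((\<lambda>J. I \<union> J) ` ?J I) \<le> (m - i) choose (d - i)" .
  qed
  also have "\<dots> = (card (Q \<inter> X) choose i) * ((m - i) choose (d - i))"
    using Q n_subsets[of "Q \<inter> X" i] by simp
  also have "\<dots> \<le> (K choose i) * ((m - i) choose (d - i))"
    using Q by (intro mult_right_mono binomial_right_mono) (auto intro: order_trans[OF card_mono])
  finally have *: "card \<D> \<le> (K choose i) * ((m - i) choose (d - i))" .
  have Ki: "real (K choose i) \<le> (K / m) ^ i * real (m choose i)"
  proof -
    have Km: "K \<le> m" using K m_def by simp
    have "(\<Prod>j = 0..<i. real K - real j) * real m ^ i \<le> (\<Prod>j = 0..<i. real m - real j) * real K ^ i" if "i \<le> K"
    proof -
      have "(\<Prod>j = 0..<i. (real K - real j) * real m) \<le> (\<Prod>j = 0..<i. (real m - real j) * real K)"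
      proof (rule prod_mono)
        fix j assume "j \<in> {0..<i}"
        then have "j < K" using that by auto
        have "real j * real K \<le> real j * real m" using Km by (intro mult_left_mono) auto
        then show "0 \<le> (real K - real j) * real m \<and> (real K - real j) * real m \<le> (real m - real j) * real K"
          using \<open>j < K\<close> by (auto simp: algebra_simps intro!: mult_right_mono)
      qed
      then show ?thesis by (simp add: prod.distrib)
    qed
    then have "i \<le> K \<Longrightarrow> real (K choose i) * real m ^ i \<le> real (m choose i) * real K ^ i"
      by (simp add: binomial_gbinomial gbinomial_prod_rev divide_right_mono)
    then show ?thesis
      using d by (cases "i \<le> K") (auto simp: field_simps binomial_eq_0)
  qed
  have "real (card \<D>) \<le> real (K choose i) * real ((m - i) choose (d - i))"
    using * by (metis of_nat_mono of_nat_mult)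
  also have "\<dots> \<le> (K / m) ^ i * real (m choose i) * real ((m - i) choose (d - i))"
    using Ki by (intro mult_right_mono) auto
  also have "\<dots> = (K / m) ^ i * (real (m choose d) * real (d choose i))"
    using choose_mult[OF i(2) d(1)] by (metis mult.assoc of_nat_mult)
  also have "\<dots> \<le> (K / m) ^ i * (real (m choose d) * 4 ^ i)"
  proof -
    have "d choose i \<le> 2 ^ d" using binomial_le_pow2 by blast
    also have "\<dots> \<le> 2 ^ (2 * i)" using i by (intro power_increasing) auto
    finally have "real (d choose i) \<le> 4 ^ i"
      by (metis (mono_tags) numeral_Bit0 numeral_power_eq_of_nat_cancel_iff of_nat_mono power_mult power2_eq_square mult_2 numeral_times_numeral semiring_norm(11) semiring_norm(13))
    then show ?thesis by (intro mult_left_mono) auto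
  qed
  finally show ?thesis by (simp add: m_def power_mult_distrib power_divide field_simps)
qed

section \<open>Tree posets\<close>

definition adj :: "'a set set \<Rightarrow> 'a rel" where
  "adj E = {(u, v). {u, v} \<in> E}"

definition gconn :: "'a set \<Rightarrow> 'a set set \<Rightarrow> bool" where
  "gconn S E \<longleftrightarrow> (\<forall>x\<in>S. \<forall>y\<in>S. (x, y) \<in> (adj E)\<^sup>*)"

text \<open>A tree without reference to an order, so that the two components left by cutting an edge
  are objects of the same kind.\<close>

definition subtree :: "'a set \<Rightarrow> 'a set set \<Rightarrow> bool" where
  "subtree S E \<longleftrightarrow> finite S \<and> S \<noteq> {} \<and> (\<forall>e\<in>E. \<exists>u\<in>S. \<exists>v\<in>S. u \<noteq> v \<and> e = {u, v}) \<and>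
     gconn S E \<and> card E = card S - 1"

lemma sym_adj: "sym ((adj E)\<^sup>*)"
  by (intro sym_rtrancl) (auto simp: sym_def adj_def insert_commute)

text \<open>Send each vertex other than a root to an edge towards a neighbour closer to the root;
  this map is injective.\<close>

lemma gconn_card:
  assumes fin: "finite E" and S: "finite S" "S \<noteq> {}" and conn: "gconn S E"
  shows "card S \<le> card E + 1"
proof -
  obtain r where r: "r \<in> S" using S by auto
  define dst where "dst s = (LEAST n. (r, s) \<in> adj E ^^ n)" for s
  have "\<exists>u. (u, s) \<in> adj E \<and> dst u < dst s" if s: "s \<in> S - {r}" for s
  proof -
    have "(r, s) \<in> (adj E)\<^sup>*" using conn r s by (auto simp: gconn_def)
    then have "\<exists>n. (r, s) \<in> adj E ^^ n" by (simp add: rtrancl_power)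
    then have d: "(r, s) \<in> adj E ^^ dst s" unfolding dst_def by (rule LeastI_ex)
    have "dst s \<noteq> 0" using d s by (metis DiffD2 insertI1 relpow_0_E)
    then obtain m where m: "dst s = Suc m" using not0_implies_Suc by blast
    then obtain u where u: "(r, u) \<in> adj E ^^ m" "(u, s) \<in> adj E" using d by auto
    have "dst u \<le> m" unfolding dst_def using u(1) by (rule Least_le)
    then show ?thesis using u m by auto
  qed
  then obtain par where par: "\<And>s. s \<in> S - {r} \<Longrightarrow> (par s, s) \<in> adj E \<and> dst (par s) < dst s"
    by metis
  have "inj_on (\<lambda>s. {par s, s}) (S - {r})"
    by (rule inj_onI) (metis doubleton_eq_iff order_less_asym par)
  moreover have "(\<lambda>s. {par s, s}) ` (S - {r}) \<subseteq> E"
    using par by (auto simp: adj_def)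
  ultimately have "card (S - {r}) \<le> card E" using fin by (metis card_inj_on_le)
  then show ?thesis using r S by simp
qed

text \<open>The parts are the components of \<open>p\<close> and \<open>q\<close> after deleting the
  edge. If they met, the remaining edges would connect \<open>S\<close>, against
  \<open>gconn_card\<close>. The same lemma bounds the edges of each part from below, and the total
  leaves no slack, so both parts are trees.\<close>

lemma subtree_split:
  assumes T: "subtree S E" and pq: "{p, q} \<in> E"
  obtains S1 S2 E1 E2 where "S = S1 \<union> S2" "S1 \<inter> S2 = {}" "E = insert {p, q} (E1 \<union> E2)"
    "p \<in> S1" "q \<in> S2" "subtree S1 E1" "subtree S2 E2"
proof -
  have S: "finite S" "S \<noteq> {}" and E: "\<And>e. e \<in> E \<Longrightarrow> \<exists>u\<in>S. \<exists>v\<in>S. u \<noteq> v \<and> e = {u, v}"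
    and conn: "gconn S E" and cE: "card E = card S - 1"
    using T by (auto simp: subtree_def)
  have finE: "finite E"
    by (rule finite_subset[of _ "Pow S"]) (use E S in \<open>fastforce+\<close>)
  have pqS: "p \<in> S" "q \<in> S" "p \<noteq> q" using E[OF pq] by (auto simp: doubleton_eq_iff)
  define E' where "E' = E - {{p, q}}"
  have finE': "finite E'" and cE': "card E' + 2 = card S"
  proof -
    have "card S > 0" "card E > 0" using S pq finE by (auto simp: card_gt_0_iff)
    then show "finite E'" "card E' + 2 = card S" using cE pq finE by (auto simp: E'_def)
  qed
  define C where "C x = (adj E')\<^sup>* `` {x}" for x
  have step: "v \<in> C x" if "u \<in> C x" "{u, v} \<in> E'" for u v x
    using that by (auto simp: C_def adj_def intro: rtrancl_into_rtrancl)
  have adjS: "v \<in> S" if "(u, v) \<in> adj E'" for u v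
    using that E[of "{u, v}"] by (auto simp: adj_def E'_def doubleton_eq_iff)
  have CS: "C x \<subseteq> S" if "x \<in> S" for x
  proof
    fix y assume "y \<in> C x"
    then have "(x, y) \<in> (adj E')\<^sup>*" by (simp add: C_def)
    then show "y \<in> S" by (induction) (use that adjS in auto)
  qed
  have cover: "S = C p \<union> C q"
  proof (intro equalityI subsetI)
    fix s assume "s \<in> S"
    then have "(p, s) \<in> (adj E)\<^sup>*" using conn pqS by (auto simp: gconn_def)
    then show "s \<in> C p \<union> C q"
    proof induction
      case base show ?case by (simp add: C_def)
    next
      case (step u v)
      show ?case
      proof (cases "{u, v} = {p, q}")
        case True
        then show ?thesis by (auto simp: C_def doubleton_eq_iff)
      next
        case False
        then have "{u, v} \<in> E'" using step by (auto simp: E'_def adj_def)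
        then show ?thesis using step \<open>\<And>x v u. \<lbrakk>u \<in> C x; {u, v} \<in> E'\<rbrakk> \<Longrightarrow> v \<in> C x\<close> by blast
      qed
    qed
  qed (use CS pqS in auto)
  have disj: "C p \<inter> C q = {}"
  proof (rule ccontr)
    assume "C p \<inter> C q \<noteq> {}"
    then obtain z where "(p, z) \<in> (adj E')\<^sup>*" "(q, z) \<in> (adj E')\<^sup>*" by (auto simp: C_def)
    then have "(p, q) \<in> (adj E')\<^sup>*" by (metis rtrancl_trans symD sym_adj)
    then have *: "(p, s) \<in> (adj E')\<^sup>*" if "s \<in> S" for s
      using that cover by (auto simp: C_def)
    have "gconn S E'" unfolding gconn_def by (metis * rtrancl_trans symD sym_adj)
    from gconn_card[OF finE' S this] cE' show False by simp
  qed
  define F where "F x = {e \<in> E'. e \<subseteq> C x}" for x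
  have FE: "E' = F p \<union> F q"
  proof -
    have "e \<in> F p \<union> F q" if e: "e \<in> E'" for e
    proof -
      obtain u v where uv: "u \<in> S" "e = {u, v}" using e E[of e] by (auto simp: E'_def)
      then have "{u, v} \<subseteq> C p \<or> {u, v} \<subseteq> C q" using step[of u _ v] e cover by auto
      then show ?thesis using e uv by (auto simp: F_def)
    qed
    then show ?thesis by (auto simp: F_def)
  qed
  have FF: "F p \<inter> F q = {}"
    using disj E by (fastforce simp: F_def E'_def)
  have gc: "gconn (C x) (F x)" for x
  proof -
    have "(x, s) \<in> (adj (F x))\<^sup>*" if "s \<in> C x" for s
    proof -
      have "(x, s) \<in> (adj E')\<^sup>*" using that by (simp add: C_def)
      then show ?thesis
      proof induction
        case (step u v)
        have "u \<in> C x" "v \<in> C x" using step by (auto simp: C_def)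
        then have "(u, v) \<in> adj (F x)" using step by (auto simp: F_def adj_def)
        then show ?case using step by auto
      qed simp
    qed
    then show ?thesis unfolding gconn_def by (metis rtrancl_trans symD sym_adj)
  qed
  have finF: "finite (F x)" for x using finE' by (auto simp: F_def)
  have finC: "finite (C p)" "finite (C q)" using finite_subset[OF CS] pqS S by blast+
  have ne: "x \<in> C x" for x by (simp add: C_def)
  have c1: "card (C p) \<le> card (F p) + 1" by (rule gconn_card[OF finF finC(1) _ gc]) (use ne in auto)
  have c2: "card (C q) \<le> card (F q) + 1" by (rule gconn_card[OF finF finC(2) _ gc]) (use ne in auto)
  have "card S = card (C p) + card (C q)" using cover disj finC by (simp add: card_Un_disjoint)
  moreover have "card E' = card (F p) + card (F q)" using FE FF finF by (metis card_Un_disjoint)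
  ultimately have c: "card (F p) = card (C p) - 1" "card (F q) = card (C q) - 1" using c1 c2 cE' by linarith+
  have edges: "\<exists>u\<in>C x. \<exists>v\<in>C x. u \<noteq> v \<and> e = {u, v}" if "e \<in> F x" for e x
    using that E[of e] by (auto simp: F_def E'_def)
  show ?thesis
  proof
    show "E = insert {p, q} (F p \<union> F q)" using FE pq by (auto simp: E'_def)
    show "subtree (C p) (F p)" "subtree (C q) (F q)"
      unfolding subtree_def using finC ne[of p] ne[of q] edges gc c by auto
  qed (use cover disj ne in auto)
qed

definition dle :: "('a \<Rightarrow> 'a \<Rightarrow> bool) \<Rightarrow> bool \<Rightarrow> 'a \<Rightarrow> 'a \<Rightarrow> bool" where
  "dle le b x y = (if b then le x y else le y x)"

definition cov_in :: "'a set \<Rightarrow> ('a \<Rightarrow> 'a \<Rightarrow> bool) \<Rightarrow> 'a set set \<Rightarrow> 'a rel" where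
  "cov_in A le E = {(u, v). covers A le u v \<and> {u, v} \<in> E}"

text \<open>The order of A restricted to S must be generated by the covering edges in E, so that
  cutting an edge determines the order relation between the two sides.\<close>

definition ptree :: "'a set \<Rightarrow> ('a \<Rightarrow> 'a \<Rightarrow> bool) \<Rightarrow> 'a set \<Rightarrow> 'a set set \<Rightarrow> bool" where
  "ptree A le S E \<longleftrightarrow> S \<subseteq> A \<and> E \<subseteq> hasse_edges A le \<and> subtree S E \<and>
     (\<forall>x\<in>S. \<forall>y\<in>S. le x y \<longrightarrow> (x, y) \<in> (cov_in A le E)\<^sup>*)"

context
  fixes A :: "'a set" and le
  assumes po: "finite_poset A le"
begin

lemma le_refl: "x \<in> A \<Longrightarrow> le x x"
  and le_antisym: "x \<in> A \<Longrightarrow> y \<in> A \<Longrightarrow> le x y \<Longrightarrow> le y x \<Longrightarrow> x = y"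
  and le_trans: "x \<in> A \<Longrightarrow> y \<in> A \<Longrightarrow> z \<in> A \<Longrightarrow> le x y \<Longrightarrow> le y z \<Longrightarrow> le x z"
  and finite_poset_finite: "finite A"
  using po unfolding finite_poset_def by blast+

lemma covers_antisym: "covers A le x y \<Longrightarrow> \<not> covers A le y x"
  using le_antisym unfolding covers_def pless_def by blast

lemma cov_in_le:
  assumes "(x, y) \<in> (cov_in A le E)\<^sup>*" "x \<in> A"
  shows "y \<in> A \<and> le x y"
  using assms
proof induction
  case (step y z)
  then have "y \<in> A" "z \<in> A" "le x y" "le y z" by (auto simp: cov_in_def covers_def pless_def)
  then show ?case using step le_trans by blast
qed (simp add: le_refl)

text \<open>Induction on the size of the interval from \<open>x\<close> to \<open>y\<close>: an
  intermediate point splits it into two smaller intervals.\<close>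

lemma le_cov_in:
  assumes "x \<in> A" "y \<in> A" "le x y"
  shows "(x, y) \<in> (cov_in A le (hasse_edges A le))\<^sup>*"
  using assms
proof (induction "card {z \<in> A. le x z \<and> le z y}" arbitrary: x y rule: less_induct)
  case less
  show ?case
  proof (cases "x = y \<or> covers A le x y")
    case True
    then show ?thesis by (auto simp: cov_in_def hasse_edges_def)
  next
    case False
    then obtain z where z: "z \<in> A" "pless le x z" "pless le z y"
      using less.prems unfolding covers_def pless_def by blast
    then have xz: "le x z" "x \<noteq> z" "le z y" "z \<noteq> y" by (auto simp: pless_def)
    have "\<not> le y z" "\<not> le z x" using xz z less.prems le_antisym by blast+
    moreover have "{w \<in> A. le x w \<and> le w z} \<subseteq> {w \<in> A. le x w \<and> le w y}"
      "{w \<in> A. le z w \<and> le w y} \<subseteq> {w \<in> A. le x w \<and> le w y}"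
      using xz z less.prems by (auto intro: le_trans)
    moreover have "y \<in> {w \<in> A. le x w \<and> le w y}" "x \<in> {w \<in> A. le x w \<and> le w y}"
      using less.prems le_refl by auto
    ultimately have "{w \<in> A. le x w \<and> le w z} \<subset> {w \<in> A. le x w \<and> le w y}"
      "{w \<in> A. le z w \<and> le w y} \<subset> {w \<in> A. le x w \<and> le w y}" by blast+
    then have "card {w \<in> A. le x w \<and> le w z} < card {w \<in> A. le x w \<and> le w y}"
      "card {w \<in> A. le z w \<and> le w y} < card {w \<in> A. le x w \<and> le w y}"
      using finite_poset_finite by (simp_all add: psubset_card_mono)
    then have "(x, z) \<in> (cov_in A le (hasse_edges A le))\<^sup>*" "(z, y) \<in> (cov_in A le (hasse_edges A le))\<^sup>*"
      using less.hyps less.prems xz z by blast+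
    then show ?thesis by (rule rtrancl_trans)
  qed
qed

lemma ptree_whole:
  assumes T: "tree_poset A le"
  shows "ptree A le A (hasse_edges A le)"
proof -
  have ne: "A \<noteq> {}" and hc: "hasse_connected A le" and c: "card (hasse_edges A le) = card A - 1"
    using T by (auto simp: tree_poset_def)
  have "(x, y) \<in> (adj (hasse_edges A le))\<^sup>*" if "x \<in> A" "y \<in> A" for x y
  proof -
    have "(\<lambda>u v. covers A le u v \<or> covers A le v u)\<^sup>*\<^sup>* x y"
      using hc that by (simp add: hasse_connected_def)
    then show ?thesis
    proof induction
      case (step u v)
      then have "(u, v) \<in> adj (hasse_edges A le)"
        by (auto simp: adj_def hasse_edges_def doubleton_eq_iff)
      then show ?case using step by auto
    qed simp
  qed
  then have "gconn A (hasse_edges A le)" by (simp add: gconn_def)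
  moreover have "\<exists>u\<in>A. \<exists>v\<in>A. u \<noteq> v \<and> e = {u, v}" if "e \<in> hasse_edges A le" for e
    using that by (auto simp: hasse_edges_def covers_def pless_def)
  ultimately show ?thesis
    using ne c finite_poset_finite le_cov_in by (auto simp: ptree_def subtree_def)
qed

text \<open>Every edge except \<open>{p, q}\<close> stays on its side, and that one can be traversed
  upwards in only one direction. An ascending path therefore crosses the cut at most once, from
  \<open>p\<close> to \<open>q\<close>.\<close>

lemma cov_in_cross:
  assumes S: "S1 \<inter> S2 = {}" "p \<in> S1" "q \<in> S2"
    and E: "E = insert {p, q} (E1 \<union> E2)" and E1: "\<Union>E1 \<subseteq> S1" and E2: "\<Union>E2 \<subseteq> S2"
    and path: "(x, y) \<in> (cov_in A le E)\<^sup>*" and x: "x \<in> S1"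
  shows "y \<in> S1 \<and> (x, y) \<in> (cov_in A le E1)\<^sup>* \<or>
    covers A le p q \<and> y \<in> S2 \<and> (x, p) \<in> (cov_in A le E1)\<^sup>* \<and> (q, y) \<in> (cov_in A le E2)\<^sup>*"
  using path
proof induction
  case base
  then show ?case using x by simp
next
  case (step y z)
  have yz: "covers A le y z" "{y, z} \<in> E" using step by (auto simp: cov_in_def)
  consider "{y, z} = {p, q}" | "{y, z} \<in> E1" "y \<in> S1" "z \<in> S1" | "{y, z} \<in> E2" "y \<in> S2" "z \<in> S2"
    using yz E E1 E2 by auto
  then show ?case
  proof cases
    case 1
    then consider "y = p" "z = q" | "y = q" "z = p" by (auto simp: doubleton_eq_iff)
    then show ?thesis
    proof cases
      case 1
      then show ?thesis using step yz S by auto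
    next
      case 2
      then show ?thesis using step yz S covers_antisym[of p q] by auto
    qed
  next
    case 2
    then have "(y, z) \<in> cov_in A le E1" using yz by (simp add: cov_in_def)
    then show ?thesis using step S 2 by (auto intro: rtrancl_into_rtrancl)
  next
    case 3
    then have "(y, z) \<in> cov_in A le E2" using yz by (simp add: cov_in_def)
    then show ?thesis using step S 3 by (auto intro: rtrancl_into_rtrancl)
  qed
qed

text \<open>\<open>b\<close> records whether \<open>q\<close> lies above or below \<open>p\<close>.
  Since relations across the cut pass through the edge, they are determined by how each part relates
  to its own root, which is the only order information a placement keeps.\<close>

lemma ptree_split:
  assumes T: "ptree A le S E" and p: "p \<in> S" and ne: "S \<noteq> {p}"
  obtains b q S1 S2 E1 E2 where "S = S1 \<union> S2" "S1 \<inter> S2 = {}" "p \<in> S1" "q \<in> S2"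
    "ptree A le S1 E1" "ptree A le S2 E2" "dle le b p q" "p \<noteq> q"
    "\<And>x y. x \<in> S1 \<Longrightarrow> y \<in> S2 \<Longrightarrow> dle le b x y \<longleftrightarrow> dle le b x p \<and> dle le b q y"
    "\<And>x y. x \<in> S1 \<Longrightarrow> y \<in> S2 \<Longrightarrow> \<not> dle le b y x"
proof -
  have SA: "S \<subseteq> A" and EH: "E \<subseteq> hasse_edges A le" and st: "subtree S E"
    and path: "\<And>x y. x \<in> S \<Longrightarrow> y \<in> S \<Longrightarrow> le x y \<Longrightarrow> (x, y) \<in> (cov_in A le E)\<^sup>*"
    using T by (auto simp: ptree_def)
  obtain s where s: "s \<in> S" "s \<noteq> p" using p ne by auto
  have "(p, s) \<in> (adj E)\<^sup>*" using st p s by (auto simp: subtree_def gconn_def)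
  then obtain q where "(p, q) \<in> adj E" using s by (metis converse_rtranclE)
  then have pq: "{p, q} \<in> E" by (simp add: adj_def)
  obtain S1 S2 E1 E2 where D: "S = S1 \<union> S2" "S1 \<inter> S2 = {}" "E = insert {p, q} (E1 \<union> E2)"
    "p \<in> S1" "q \<in> S2" "subtree S1 E1" "subtree S2 E2"
    using subtree_split[OF st pq] by blast
  have "{p, q} \<in> hasse_edges A le" using pq EH by auto
  then have cpq: "covers A le p q \<or> covers A le q p"
    by (auto simp: hasse_edges_def doubleton_eq_iff)
  have U: "\<Union>E1 \<subseteq> S1" "\<Union>E2 \<subseteq> S2" using D(6,7) by (auto simp: subtree_def; blast)+
  note c1 = cov_in_cross[OF D(2,4,5,3) U]
  have D': "S2 \<inter> S1 = {}" "E = insert {q, p} (E2 \<union> E1)" using D by auto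
  note c2 = cov_in_cross[OF D'(1) D(5,4) D'(2) U(2,1)]
  have A12: "S1 \<subseteq> A" "S2 \<subseteq> A" using SA D by auto
  have t1: "ptree A le S1 E1"
  proof -
    have "(x, y) \<in> (cov_in A le E1)\<^sup>*" if "x \<in> S1" "y \<in> S1" "le x y" for x y
      using c1[of x y] path[of x y] that D(1,2) by blast
    then show ?thesis unfolding ptree_def using A12(1) EH D(3,6) by blast
  qed
  have t2: "ptree A le S2 E2"
  proof -
    have "(x, y) \<in> (cov_in A le E2)\<^sup>*" if "x \<in> S2" "y \<in> S2" "le x y" for x y
      using c2[of x y] path[of x y] that D(1,2) by blast
    then show ?thesis unfolding ptree_def using A12(2) EH D(3,7) by blast
  qed
  have x12: "covers A le p q \<and> le x p \<and> le q y" if "x \<in> S1" "y \<in> S2" "le x y" for x y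
    using c1[OF path] that D(1,2,5) A12 cov_in_le by blast
  have x21: "covers A le q p \<and> le y q \<and> le p x" if "x \<in> S1" "y \<in> S2" "le y x" for x y
    using c2[OF path] that D(1,2,4) A12 cov_in_le by blast
  have tr: "le x y" if "x \<in> S" "y \<in> S" "u \<in> S" "v \<in> S" "le x u" "covers A le u v" "le v y" for x y u v
    using that SA le_trans[of x u v] le_trans[of x v y] unfolding covers_def pless_def by blast
  show ?thesis
  proof (rule that[where b = "covers A le p q"])
    show "dle le (covers A le p q) p q" "p \<noteq> q"
      using cpq by (auto simp: dle_def covers_def pless_def)
    show "dle le (covers A le p q) x y \<longleftrightarrow> dle le (covers A le p q) x p \<and> dle le (covers A le p q) q y"
      if "x \<in> S1" "y \<in> S2" for x y
      using that x12 x21 tr D(1,4,5) cpq covers_antisym[of p q] unfolding dle_def by (smt (verit, best) UnCI)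
    show "\<not> dle le (covers A le p q) y x" if "x \<in> S1" "y \<in> S2" for x y
      using that x12 x21 covers_antisym[of p q] unfolding dle_def by (auto split: if_splits)
  qed (use D t1 t2 in auto)
qed

text \<open>The longest chain with all members below \<open>x\<close>, which is the layer in which
  \<open>x\<close> will be placed. It increases strictly along the order and takes values between 1
  and the height of the poset.\<close>

definition ht :: "'a \<Rightarrow> nat" where
  "ht x = Max (card ` {C. is_chain A le C \<and> (\<forall>c\<in>C. le c x)})"

lemma finite_chains: "finite {C. is_chain A le C \<and> P C}"
  using finite_poset_finite by (rule_tac finite_subset[of _ "Pow A"]) (auto simp: is_chain_def)

lemma ht_bounds:
  assumes "x \<in> A"
  shows "1 \<le> ht x" "ht x \<le> poset_height A le"
proof -
  have "{x} \<in> {C. is_chain A le C \<and> (\<forall>c\<in>C. le c x)}"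
    using assms le_refl by (auto simp: is_chain_def)
  then have "card {x} \<le> ht x" unfolding ht_def
    by (intro Max_ge finite_imageI finite_chains) blast
  then show "1 \<le> ht x" by simp
  show "ht x \<le> poset_height A le" unfolding ht_def poset_height_def
    using finite_chains[of "\<lambda>_. True"] \<open>{x} \<in> _\<close> by (intro Max_mono) auto
qed

lemma ht_less:
  assumes "x \<in> A" "y \<in> A" "le x y" "x \<noteq> y"
  shows "ht x < ht y"
proof -
  have "{x} \<in> {C. is_chain A le C \<and> (\<forall>c\<in>C. le c x)}"
    using assms le_refl by (auto simp: is_chain_def)
  then have "ht x \<in> card ` {C. is_chain A le C \<and> (\<forall>c\<in>C. le c x)}"
    unfolding ht_def by (intro Max_in finite_imageI finite_chains) blast
  then obtain C where C: "is_chain A le C" "\<forall>c\<in>C. le c x" "ht x = card C" by auto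
  have CA: "C \<subseteq> A" using C by (simp add: is_chain_def)
  have "finite C" using CA finite_poset_finite by (rule finite_subset)
  have cy: "le c y" if "c \<in> C" for c using le_trans[of c x y] that C CA assms by blast
  have "y \<notin> C" using C assms le_antisym by blast
  have "insert y C \<in> {C. is_chain A le C \<and> (\<forall>c\<in>C. le c y)}"
    using C cy assms le_refl by (auto simp: is_chain_def)
  then have "card (insert y C) \<le> ht y" unfolding ht_def
    by (intro Max_ge finite_imageI finite_chains) blast
  then show ?thesis using C \<open>y \<notin> C\<close> \<open>finite C\<close> by simp
qed

end

section \<open>Pruning the layered comparability graph\<close>

text \<open>The factor \<open>c * \<theta> d\<close> is a density among all sets at distance
  \<open>d\<close> from \<open>x\<close> on side \<open>b\<close>; \<open>c\<close> counts how many
  such bounds have been added up.\<close>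

definition slim :: "nat \<Rightarrow> (nat \<Rightarrow> real) \<Rightarrow> nat \<Rightarrow> real \<Rightarrow> bool \<Rightarrow> nat set \<Rightarrow> nat set set \<Rightarrow> bool" where
  "slim n \<theta> L c b x Y \<longleftrightarrow> (\<forall>d\<in>{1..L}.
     real (card (at_dist b x d Y)) \<le> c * \<theta> d * sphere_size n b x d)"

text \<open>The set \<open>U b x\<close> holds the marks of \<open>x\<close> in direction
  \<open>b\<close>. Every comparable pair is marked at one of its ends at least, and each set holds
  few marks, but nothing limits how often a set is marked by others.\<close>

definition marked :: "nat \<Rightarrow> (nat \<Rightarrow> real) \<Rightarrow> nat \<Rightarrow> real \<Rightarrow> nat set set \<Rightarrow> bool" where
  "marked n \<theta> L c G \<longleftrightarrow> (\<exists>U. (\<forall>x\<in>G. \<forall>b. U b x \<subseteq> {y \<in> G. beyond b x y} \<and> slim n \<theta> L c b x (U b x)) \<and>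
     (\<forall>x\<in>G. \<forall>y\<in>G. x \<subset> y \<longrightarrow> y \<in> U True x \<or> x \<in> U False y))"

lemma slim_Un:
  assumes "slim n \<theta> L c b x Y" "slim n \<theta> L c' b x Y'"
  shows "slim n \<theta> L (c + c') b x (Y \<union> Y')"
  unfolding slim_def
proof
  fix d assume d: "d \<in> {1..L}"
  let ?f = "\<lambda>Z. (at_dist b x d Z)"
  have eq: "?f (Y \<union> Y') = ?f Y \<union> ?f Y'" by auto
  have "card (?f (Y \<union> Y')) \<le> card (?f Y) + card (?f Y')"
    unfolding eq by (rule card_Un_le)
  then have "real (card (?f (Y \<union> Y'))) \<le> real (card (?f Y)) + real (card (?f Y'))"
    by linarith
  also have "\<dots> \<le> c * \<theta> d * sphere_size n b x d + c' * \<theta> d * sphere_size n b x d"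
    using assms d unfolding slim_def by (intro add_mono) auto
  finally show "real (card (?f (Y \<union> Y'))) \<le> (c + c') * \<theta> d * sphere_size n b x d"
    by (simp add: algebra_simps)
qed

lemma slim_mono:
  assumes "slim n \<theta> L c b x Y" "Y' \<subseteq> Y" "finite Y" "c \<le> c'" "\<And>d. \<theta> d \<ge> 0"
  shows "slim n \<theta> L c' b x Y'"
  unfolding slim_def
proof
  fix d assume d: "d \<in> {1..L}"
  have "real (card (at_dist b x d Y')) \<le> real (card (at_dist b x d Y))"
    using assms by (intro of_nat_mono card_mono) auto
  also have "\<dots> \<le> c * \<theta> d * sphere_size n b x d"
    using assms d by (auto simp: slim_def)
  also have "\<dots> \<le> c' * \<theta> d * sphere_size n b x d"
    using assms by (intro mult_right_mono) auto
  finally show "real (card (at_dist b x d Y')) \<le> c' * \<theta> d * sphere_size n b x d" .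
qed

text \<open>\<open>K\<close> bounds the sets that a placement has to avoid, and
  \<open>\<sigma>\<close> is the admissible error. The assumption \<open>hit\<close> fixes the role
  of \<open>\<theta>\<close>: neighbours concentrated on one such set make up at most a
  \<open>\<sigma>\<close> share of density \<open>\<theta> d\<close>.\<close>

locale layers =
  fixes n :: nat and F :: "nat set set" and k :: nat and \<theta> :: "nat \<Rightarrow> real"
    and \<sigma> :: real and K :: nat and L :: nat
  assumes F: "F \<subseteq> Pow {..<n}"
    and dist: "x \<in> F \<Longrightarrow> y \<in> F \<Longrightarrow> x \<subset> y \<Longrightarrow> card (y - x) \<le> L"
    and \<theta>: "\<theta> d \<ge> 0" and \<sigma>: "\<sigma> > 0"
    and hit: "x \<in> F \<Longrightarrow> d \<in> {1..L} \<Longrightarrow> finite Q \<Longrightarrow> card Q \<le> K \<Longrightarrow>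
      (\<And>D. D \<in> \<D> \<Longrightarrow> D \<subseteq> pool n b x \<and> card D = d \<and> d \<le> 2 * card (D \<inter> Q)) \<Longrightarrow>
      real (card \<D>) \<le> \<sigma> * (\<theta> d * sphere_size n b x d)"
begin

definition V0 :: "(nat \<times> nat set) set" where
  "V0 = {1..k} \<times> F"

definition E0 :: "(nat \<times> nat set) rel" where
  "E0 = {(v, u). v \<in> V0 \<and> u \<in> V0 \<and> fst u = Suc (fst v) \<and> snd v \<subset> snd u}"

definition nbr :: "(nat \<times> nat set) rel \<Rightarrow> bool \<Rightarrow> nat \<times> nat set \<Rightarrow> (nat \<times> nat set) set" where
  "nbr E b v = {u. if b then (v, u) \<in> E else (u, v) \<in> E}"

definition inner_level :: "bool \<Rightarrow> nat \<times> nat set \<Rightarrow> bool" where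
  "inner_level b v \<longleftrightarrow> (if b then fst v < k else 1 < fst v)"

text \<open>A uniformly random member of \<open>Y\<close> has, up to error \<open>\<sigma>\<close>,
  more than half of its difference to \<open>x\<close> outside any prescribed set of at most
  \<open>K\<close> elements.\<close>

definition spread :: "bool \<Rightarrow> nat set \<Rightarrow> nat set set \<Rightarrow> bool" where
  "spread b x Y \<longleftrightarrow> finite Y \<and> Y \<noteq> {} \<and> (\<forall>Q. finite Q \<longrightarrow> card Q \<le> K \<longrightarrow>
     real (card {y \<in> Y. half_in (dif b x y) Q}) \<le> \<sigma> * real (card Y))"

definition pruned :: "(nat \<times> nat set) set \<Rightarrow> (nat \<times> nat set) rel \<Rightarrow> bool" where
  "pruned W E \<longleftrightarrow> (\<forall>v\<in>W. \<forall>b. inner_level b v \<longrightarrow> (\<exists>Y \<subseteq> snd ` nbr E b v. spread b (snd v) Y))"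

text \<open>\<open>W\<close> and \<open>E\<close> are what is left of the layered comparability graph. A vertex v is deleted for the
  reason \<open>r v\<close>, the direction in which it has only few neighbours left; every missing edge is charged to
  an endpoint or has lost an endpoint for a reason that points away from the edge.\<close>

definition charging :: "(nat \<times> nat set) set \<Rightarrow> (nat \<times> nat set) rel \<Rightarrow> real \<Rightarrow>
    (bool \<Rightarrow> nat \<times> nat set \<Rightarrow> nat set set) \<Rightarrow> (nat \<times> nat set \<Rightarrow> bool) \<Rightarrow> bool" where
  "charging W E c ch r \<longleftrightarrow> W \<subseteq> V0 \<and> E \<subseteq> E0 \<inter> W \<times> W \<and>
     (\<forall>v\<in>V0. \<forall>b. ch b v \<subseteq> snd ` nbr E0 b v \<and> slim n \<theta> L (c + of_bool (v \<notin> W)) b (snd v) (ch b v)) \<and>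
     (\<forall>v\<in>V0 - W. inner_level (r v) v) \<and>
     (\<forall>v u. (v, u) \<in> E0 - E \<longrightarrow> snd u \<in> ch True v \<or> snd v \<in> ch False u \<or>
        v \<notin> W \<and> \<not> r v \<or> u \<notin> W \<and> r u)"

definition inv :: "(nat \<times> nat set) set \<Rightarrow> (nat \<times> nat set) rel \<Rightarrow> real \<Rightarrow> bool" where
  "inv W E c \<longleftrightarrow> (\<exists>ch r. charging W E c ch r)"

lemma finF: "finite F"
  using F by (rule finite_subset) auto

lemma finV0: "finite V0"
  using finF by (simp add: V0_def)

lemma E0_V0: "E0 \<subseteq> V0 \<times> V0"
  by (auto simp: E0_def)

lemma nbr_mono: "E \<subseteq> E' \<Longrightarrow> nbr E b v \<subseteq> nbr E' b v"
  by (auto simp: nbr_def split: if_splits)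

lemma nbr_sym: "u \<in> nbr E b v \<longleftrightarrow> v \<in> nbr E (\<not> b) u"
  by (simp add: nbr_def)

lemma nbr_E0:
  "u \<in> nbr E0 b v \<longleftrightarrow> v \<in> V0 \<and> u \<in> V0 \<and> beyond b (snd v) (snd u) \<and>
     (if b then fst u = Suc (fst v) else fst v = Suc (fst u))"
  by (auto simp: nbr_def E0_def beyond_def)

lemma V0D: "v \<in> V0 \<Longrightarrow> snd v \<in> F" "v \<in> V0 \<Longrightarrow> snd v \<subseteq> {..<n}"
proof -
  show "snd v \<in> F" if "v \<in> V0" using that by (auto simp: V0_def)
  then show "snd v \<subseteq> {..<n}" if "v \<in> V0" using that F by blast
qed

lemma nbr_E0D: "y \<in> snd ` nbr E0 b v \<Longrightarrow> y \<in> F \<and> beyond b (snd v) y"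
  using V0D by (auto simp: nbr_E0 simp del: split_paired_All)

lemma beyond_dif:
  assumes "x \<in> F" "y \<in> F" "beyond b x y"
  shows "dif b x y \<subseteq> pool n b x" "card (dif b x y) \<in> {1..L}" "dif (\<not> b) x y = {}" "finite (dif b x y)"
proof -
  have "x \<subseteq> {..<n}" "y \<subseteq> {..<n}" using assms F by auto
  from dif_beyond[OF assms(3) this] show "dif b x y \<subseteq> pool n b x" by simp
  have "card (dif b x y) \<le> L" using dist assms by (auto simp: beyond_def dif_def split: if_splits)
  then show "card (dif b x y) \<in> {1..L}" using dif_beyond[OF assms(3) \<open>x \<subseteq> _\<close> \<open>y \<subseteq> _\<close>] by simp
  show "dif (\<not> b) x y = {}" using assms by (auto simp: beyond_def dif_def split: if_splits)
  show "finite (dif b x y)" using \<open>card (dif b x y) \<in> {1..L}\<close> by (simp add: card_ge_0_finite)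
qed

lemma dif_inj: "beyond b x y \<Longrightarrow> beyond b x y' \<Longrightarrow> dif b x y = dif b x y' \<Longrightarrow> y = y'"
  by (auto simp: beyond_def dif_def split: if_splits)

lemma hit_nbrs:
  assumes x: "x \<in> F" and d: "d \<in> {1..L}" and Q: "finite Q" "card Q \<le> K"
    and Y: "\<And>y. y \<in> Y \<Longrightarrow> y \<in> F \<and> beyond b x y \<and> card (dif b x y) = d \<and> d \<le> 2 * card (dif b x y \<inter> Q)"
  shows "real (card Y) \<le> \<sigma> * (\<theta> d * sphere_size n b x d)"
proof -
  have "inj_on (dif b x) Y" using Y dif_inj by (intro inj_onI) blast
  then have "card Y = card (dif b x ` Y)" by (simp add: card_image)
  then show ?thesis using hit[OF x d Q, of "dif b x ` Y" b] Y beyond_dif(1)[OF x] by auto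
qed

lemma chargingD:
  assumes "charging W E c ch r"
  shows "W \<subseteq> V0" "E \<subseteq> E0 \<inter> W \<times> W"
    "\<And>v b. v \<in> V0 \<Longrightarrow> ch b v \<subseteq> snd ` nbr E0 b v"
    "\<And>v b. v \<in> V0 \<Longrightarrow> slim n \<theta> L (c + of_bool (v \<notin> W)) b (snd v) (ch b v)"
    "\<And>v. v \<in> V0 \<Longrightarrow> v \<notin> W \<Longrightarrow> inner_level (r v) v"
    "\<And>v u. (v, u) \<in> E0 \<Longrightarrow> (v, u) \<notin> E \<Longrightarrow> snd u \<in> ch True v \<or> snd v \<in> ch False u \<or>
       v \<notin> W \<and> \<not> r v \<or> u \<notin> W \<and> r u"
  using assms unfolding charging_def by (simp_all del: split_paired_All)

lemma charging_finite:
  assumes "charging W E c ch r" "v \<in> V0"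
  shows "finite (ch b v)"
proof -
  have "ch b v \<subseteq> F" using chargingD(3)[OF assms, of b] nbr_E0D by blast
  then show ?thesis using finF by (rule finite_subset)
qed

lemma invD: "inv W E c \<Longrightarrow> W \<subseteq> V0" "inv W E c \<Longrightarrow> E \<subseteq> E0 \<inter> W \<times> W"
  unfolding inv_def using chargingD(1,2) by blast+

text \<open>If the density exceeds \<open>\<theta> d\<close> at a single distance \<open>d\<close>,
  the members of \<open>Y\<close> at that distance already form a spread set, by
  \<open>hit\<close>.\<close>

lemma spread_or_slim:
  assumes v: "v \<in> V0" and Y: "Y \<subseteq> snd ` nbr E0 b v" and ns: "\<not> (\<exists>Y'\<subseteq>Y. spread b (snd v) Y')"
  shows "slim n \<theta> L 1 b (snd v) Y"
  unfolding slim_def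
proof (rule ballI, rule ccontr)
  fix d assume d: "d \<in> {1..L}"
  let ?x = "snd v" and ?Y = "{y \<in> Y. card (dif b (snd v) y) = d}"
  assume "\<not> real (card ?Y) \<le> 1 * \<theta> d * sphere_size n b ?x d"
  then have big: "\<theta> d * sphere_size n b ?x d < real (card ?Y)" by simp
  have YF: "y \<in> F \<and> beyond b ?x y" if "y \<in> Y" for y
    using that Y nbr_E0D by blast
  have sp: "spread b ?x ?Y"
    unfolding spread_def
  proof (intro conjI allI impI)
    have "Y \<subseteq> F" using YF by auto
    then show "finite ?Y" using finF finite_subset[of Y F] by simp
    have "0 \<le> \<theta> d * sphere_size n b ?x d" using \<theta> by simp
    with big show "?Y \<noteq> {}" by fastforce
    fix Q :: "nat set" assume "finite Q" "card Q \<le> K"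
    then have "real (card {y \<in> ?Y. card (dif b ?x y) \<le> 2 * card (dif b ?x y \<inter> Q)})
        \<le> \<sigma> * (\<theta> d * sphere_size n b ?x d)"
      using YF by (intro hit_nbrs[OF V0D(1)[OF v] d]) auto
    also have "\<dots> \<le> \<sigma> * real (card ?Y)" using big \<sigma> by (intro mult_left_mono) auto
    finally show "real (card {y \<in> ?Y. card (dif b ?x y) \<le> 2 * card (dif b ?x y \<inter> Q)}) \<le> \<sigma> * real (card ?Y)" .
  qed
  have "\<exists>Y'\<subseteq>Y. spread b ?x Y'"
    using sp by (intro exI[of _ ?Y] conjI) auto
  with ns show False by contradiction
qed

lemma inv_init: "inv V0 E0 0"
proof -
  have "slim n \<theta> L 0 b x {}" for b x by (simp add: slim_def)
  then show ?thesis unfolding inv_def charging_def using E0_V0 by (auto intro!: exI[of _ "\<lambda>_ _. {}"])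
qed

text \<open>A vertex violating \<open>pruned\<close> in direction \<open>b\<close> is removed. Its
  remaining edges in that direction are slim and are charged to it; those in the other direction are
  excused by the reason \<open>b\<close>. As a vertex is removed only once, the additional unit of
  charge is covered by \<open>of_bool (v \<notin> W)\<close> and \<open>c\<close> does not
  grow.\<close>

lemma prune:
  assumes "inv W E c"
  shows "\<exists>W'\<subseteq>W. \<exists>E'\<subseteq>E. inv W' E' c \<and> pruned W' E'"
  using assms
proof (induction "card W" arbitrary: W E rule: less_induct)
  case less
  show ?case
  proof (cases "pruned W E")
    case False
    then obtain v b where v: "v \<in> W" "inner_level b v" "\<not> (\<exists>Y \<subseteq> snd ` nbr E b v. spread b (snd v) Y)"
      unfolding pruned_def by blast
    from less.prems obtain ch r where cg: "charging W E c ch r" unfolding inv_def by blast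
    note W = chargingD(1)[OF cg] and E = chargingD(2)[OF cg]
    define W' where "W' = W - {v}"
    define E' where "E' = E \<inter> W' \<times> W'"
    define ch' where "ch' b' u = (if b' = b \<and> u = v then ch b v \<union> snd ` nbr E b v else ch b' u)" for b' u
    have vV: "v \<in> V0" using v W by auto
    have sub: "snd ` nbr E b v \<subseteq> snd ` nbr E0 b v" using E by (intro image_mono nbr_mono) auto
    have "slim n \<theta> L 1 b (snd v) (snd ` nbr E b v)" using spread_or_slim[OF vV sub] v by blast
    moreover have "slim n \<theta> L c b (snd v) (ch b v)" using chargingD(4)[OF cg vV, of b] v by simp
    ultimately have sv: "slim n \<theta> L (c + 1) b (snd v) (ch b v \<union> snd ` nbr E b v)"
      by (rule slim_Un[rotated])
    have "charging W' E' c ch' (r(v := b))"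
      unfolding charging_def
    proof (intro conjI ballI allI impI)
      fix u b' assume u: "u \<in> V0"
      show "ch' b' u \<subseteq> snd ` nbr E0 b' u" using chargingD(3)[OF cg u] sub by (auto simp: ch'_def)
      show "slim n \<theta> L (c + of_bool (u \<notin> W')) b' (snd u) (ch' b' u)"
      proof (cases "u = v")
        case True
        then show ?thesis
          using sv v chargingD(4)[OF cg vV, of b'] charging_finite[OF cg vV, of b'] \<theta> slim_mono[of n \<theta> L c b' "snd v" "ch b' v" "ch b' v" "c + 1"]
          by (auto simp: ch'_def W'_def)
      next
        case False
        then show ?thesis using chargingD(4)[OF cg u, of b'] by (auto simp: ch'_def W'_def)
      qed
    next
      fix u assume "u \<in> V0 - W'"
      then show "inner_level ((r(v := b)) u) u" using chargingD(5)[OF cg, of u] v by (cases "u = v") (auto simp: W'_def)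
    next
      fix u w assume uw: "(u, w) \<in> E0 - E'"
      then have "u \<noteq> w" by (auto simp: E0_def)
      show "snd w \<in> ch' True u \<or> snd u \<in> ch' False w \<or> u \<notin> W' \<and> \<not> (r(v := b)) u \<or> w \<notin> W' \<and> (r(v := b)) w"
      proof (cases "(u, w) \<in> E")
        case True
        then have "u = v \<or> w = v" using uw E by (auto simp: E'_def W'_def)
        moreover have "snd w \<in> ch' True v" if "u = v" b
        proof -
          have "w \<in> nbr E b v" using that True by (simp add: nbr_def)
          then show ?thesis using that by (simp add: ch'_def)
        qed
        moreover have "snd u \<in> ch' False v" if "w = v" "\<not> b"
        proof -
          have "u \<in> nbr E b v" using that True by (simp add: nbr_def)
          then show ?thesis using that by (simp add: ch'_def)
        qed
        ultimately show ?thesis by (cases b) (auto simp: W'_def)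
      next
        case False
        then have "snd w \<in> ch True u \<or> snd u \<in> ch False w \<or> u \<notin> W \<and> \<not> r u \<or> w \<notin> W \<and> r w"
          using chargingD(6)[OF cg] uw by blast
        then show ?thesis using v by (auto simp: ch'_def W'_def)
      qed
    qed (use W E in \<open>auto simp: W'_def E'_def\<close>)
    then have "inv W' E' c" unfolding inv_def by blast
    moreover have "card W' < card W"
      using v W finV0 unfolding W'_def by (intro card_Diff1_less) (auto intro: finite_subset)
    ultimately have "\<exists>W''\<subseteq>W'. \<exists>E''\<subseteq>E'. inv W'' E'' c \<and> pruned W'' E''"
      by (intro less.hyps)
    moreover have "W' \<subseteq> W" "E' \<subseteq> E" by (auto simp: W'_def E'_def)
    ultimately show ?thesis by (meson subset_trans)
  qed (use less.prems in blast)
qed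

text \<open>\<open>inner_level\<close> excludes the downward reason in layer 1 and the upward reason
  in layer \<open>k\<close>, so the reasons of the copies of \<open>x\<close> switch somewhere. For
  \<open>x \<subset> y\<close> with the same switching layer \<open>i\<close>, the edge from
  \<open>(i, x)\<close> to \<open>(Suc i, y)\<close> is excused at neither end and must have been
  charged.\<close>

lemma inv_empty:
  assumes "inv {} E c" and k: "1 \<le> k"
  shows "\<exists>Fi. F = (\<Union>i\<in>{1..<k}. Fi i) \<and> (\<forall>i\<in>{1..<k}. marked n \<theta> L (c + 1) (Fi i))"
proof -
  from assms(1) obtain ch r where cg: "charging {} E c ch r" unfolding inv_def by blast
  have ch: "ch b v \<subseteq> snd ` nbr E0 b v \<and> slim n \<theta> L (c + 1) b (snd v) (ch b v)" if "v \<in> V0" for v b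
    using chargingD(3,4)[OF cg that] by simp
  have r: "inner_level (r v) v" if "v \<in> V0" for v using chargingD(5)[OF cg that] by simp
  have charge: "snd u \<in> ch True v \<or> snd v \<in> ch False u \<or> \<not> r v \<or> r u" if "(v, u) \<in> E0" for v u
    using chargingD(6)[OF cg that] chargingD(2)[OF cg] by auto
  define Fi where "Fi i = {x \<in> F. r (i, x) \<and> \<not> r (Suc i, x)}" for i
  have "\<exists>i\<in>{1..<k}. x \<in> Fi i" if x: "x \<in> F" for x
  proof (rule ccontr)
    assume no: "\<not> ?thesis"
    have "r (Suc i, x)" if "i < k" for i
      using that
    proof (induction i)
      case 0
      have "(1, x) \<in> V0" using x k by (simp add: V0_def)
      from r[OF this] show ?case by (auto simp: inner_level_def split: if_splits)
    next
      case (Suc i)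
      then show ?case using no x by (auto simp: Fi_def)
    qed
    from this[of "k - 1"] have "r (k, x)" using k by simp
    moreover have "(k, x) \<in> V0" using x k by (simp add: V0_def)
    ultimately show False using r[of "(k, x)"] by (simp add: inner_level_def)
  qed
  then have "F = (\<Union>i\<in>{1..<k}. Fi i)" by (auto simp: Fi_def)
  moreover have "marked n \<theta> L (c + 1) (Fi i)" if i: "i \<in> {1..<k}" for i
  proof -
    \<comment> \<open>Upward marks are read at the copy in layer \<open>i\<close>, downward ones at
      the copy in layer \<open>Suc i\<close>: these are the two ends of the edges used to compare
      members of \<open>Fi i\<close>.\<close>
    define U where "U b x = {y \<in> Fi i. y \<in> ch b (if b then i else Suc i, x)}" for b x
    have V: "(if b then i else Suc i, x) \<in> V0" if "x \<in> F" for x b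
      using that i by (auto simp: V0_def)
    have FiF: "Fi i \<subseteq> F" by (auto simp: Fi_def)
    have U1: "U b x \<subseteq> {y \<in> Fi i. beyond b x y}" if "x \<in> Fi i" for b x
    proof -
      have "ch b (if b then i else Suc i, x) \<subseteq> {y. beyond b x y}"
        using ch[OF V, of x b b] FiF that nbr_E0D[of _ b "(if b then i else Suc i, x)"] unfolding snd_conv by blast
      then show ?thesis by (auto simp: U_def)
    qed
    have U2: "slim n \<theta> L (c + 1) b x (U b x)" if "x \<in> Fi i" for b x
    proof (rule slim_mono)
      show "slim n \<theta> L (c + 1) b x (ch b (if b then i else Suc i, x))"
        using ch[OF V, of x b b] FiF that by auto
      show "finite (ch b (if b then i else Suc i, x))"
        using charging_finite[OF cg V, of x b b] FiF that by auto
    qed (auto simp: U_def \<theta>)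
    have "y \<in> U True x \<or> x \<in> U False y" if "x \<in> Fi i" "y \<in> Fi i" "x \<subset> y" for x y
    proof -
      have "((i, x), (Suc i, y)) \<in> E0" using that i by (auto simp: E0_def V0_def Fi_def)
      from charge[OF this] show ?thesis using that by (auto simp: U_def Fi_def)
    qed
    then show ?thesis unfolding marked_def using U1 U2 by blast
  qed
  ultimately show ?thesis by blast
qed

end

section \<open>Random placements of a tree poset\<close>

abbreviation (input) prob :: "'a pmf \<Rightarrow> 'a set \<Rightarrow> real" where
  "prob p \<equiv> measure_pmf.prob p"

section \<open>Probability bounds for two-stage and independent choices\<close>

lemma measure_bind_pmf_le:
  assumes "\<And>a. a \<in> set_pmf p \<Longrightarrow> prob (f a) X \<le> \<eta>"
  shows "prob (bind_pmf p f) X \<le> \<eta>"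
proof -
  have \<eta>: "0 \<le> \<eta>"
    using assms set_pmf_not_empty[of p] by (meson measure_nonneg order_trans subset_empty subset_iff ex_in_conv)
  have "emeasure (bind_pmf p f) X = (\<integral>\<^sup>+a. emeasure (f a) X \<partial>p)" by simp
  also have "\<dots> \<le> (\<integral>\<^sup>+a. ennreal \<eta> \<partial>p)"
    using assms by (intro nn_integral_mono_AE)
      (auto simp: AE_measure_pmf_iff measure_pmf.emeasure_eq_measure ennreal_leI)
  also have "\<dots> = ennreal \<eta>" by (simp add: measure_pmf.emeasure_space_1)
  finally show ?thesis using \<eta> by (simp add: measure_pmf.emeasure_eq_measure)
qed

lemma measure_bind_pmf_of_set_le:
  assumes Y: "finite Y" "Y \<noteq> {}" and bad: "real (card {y \<in> Y. bad y}) \<le> \<sigma> * real (card Y)"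
    and good: "\<And>y. y \<in> Y \<Longrightarrow> \<not> bad y \<Longrightarrow> prob (f y) X \<le> \<eta>" and \<eta>: "0 \<le> \<eta>"
  shows "prob (bind_pmf (pmf_of_set Y) f) X \<le> \<sigma> + \<eta>"
proof -
  have c: "real (card Y) > 0" using Y by (simp add: card_gt_0_iff)
  have "emeasure (bind_pmf (pmf_of_set Y) f) X = (\<integral>\<^sup>+y. emeasure (f y) X \<partial>pmf_of_set Y)" by simp
  also have "\<dots> = (\<Sum>y\<in>Y. emeasure (f y) X) / card Y"
    using Y by (rule nn_integral_pmf_of_set[rotated])
  also have "\<dots> = ennreal ((\<Sum>y\<in>Y. prob (f y) X) / card Y)"
    using c by (simp add: measure_pmf.emeasure_eq_measure sum_nonneg flip: divide_ennreal ennreal_of_nat_eq_real_of_nat)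
  finally have eq: "prob (bind_pmf (pmf_of_set Y) f) X = (\<Sum>y\<in>Y. prob (f y) X) / card Y"
    by (simp add: measure_pmf.emeasure_eq_measure sum_nonneg)
  have "(\<Sum>y\<in>Y. prob (f y) X) \<le> (\<Sum>y\<in>Y. of_bool (bad y) + \<eta>)"
    using good \<eta> by (intro sum_mono) (auto intro: order_trans[OF measure_pmf.prob_le_1])
  also have "\<dots> = real (card {y \<in> Y. bad y}) + \<eta> * real (card Y)"
    using Y by (simp add: sum.distrib Int_def)
  also have "\<dots> \<le> (\<sigma> + \<eta>) * real (card Y)" using bad by (simp add: algebra_simps)
  finally show ?thesis unfolding eq using c by (simp add: divide_le_eq)
qed

text \<open>The left-hand side is the expected number of \<open>y\<close> in \<open>Y\<close>
  satisfying \<open>B y\<close>, which is bounded for every outcome.\<close>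

lemma sum_measure_pmf_le:
  assumes Y: "finite Y" and c: "\<And>\<phi>. \<phi> \<in> set_pmf p \<Longrightarrow> real (card {y \<in> Y. B y \<phi>}) \<le> c"
  shows "(\<Sum>y\<in>Y. prob p {\<phi>. B y \<phi>}) \<le> c"
proof -
  have "(\<Sum>y\<in>Y. prob p {\<phi>. B y \<phi>}) = (\<Sum>y\<in>Y. measure_pmf.expectation p (indicator {\<phi>. B y \<phi>}))"
    by simp
  also have "\<dots> = measure_pmf.expectation p (\<lambda>\<phi>. \<Sum>y\<in>Y. indicator {\<phi>. B y \<phi>} \<phi>)"
    by (rule Bochner_Integration.integral_sum[symmetric]) 
      (auto intro!: measure_pmf.integrable_const_bound[where B = 1] simp: indicator_def)
  also have "\<dots> = measure_pmf.expectation p (\<lambda>\<phi>. real (card {y \<in> Y. B y \<phi>}))"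
    using Y by (simp add: indicator_def Int_def)
  also have "\<dots> \<le> c"
  proof (rule measure_pmf.integral_le_const)
    show "integrable p (\<lambda>\<phi>. real (card {y \<in> Y. B y \<phi>}))"
      using Y by (intro measure_pmf.integrable_const_bound[where B = "real (card Y)"]) (auto intro: card_mono)
  qed (use c in \<open>auto simp: AE_measure_pmf_iff\<close>)
  finally show ?thesis .
qed

lemma measure_pair_fst: "prob (pair_pmf p q) {(f, g). P f} = prob p {f. P f}"
proof -
  have "prob p {f. P f} = prob (map_pmf fst (pair_pmf p q)) {f. P f}"
    by (simp add: map_fst_pair_pmf)
  also have "\<dots> = prob (pair_pmf p q) (fst -` {f. P f})" by (rule measure_map_pmf)
  also have "fst -` {f. P f} = {(f, g :: 'b). P f}" by auto
  finally show ?thesis by simp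
qed

lemma measure_pair_snd: "prob (pair_pmf p q) {(f, g). P g} = prob q {g. P g}"
proof -
  have "prob q {g. P g} = prob (map_pmf snd (pair_pmf p q)) {g. P g}"
    by (simp add: map_snd_pair_pmf)
  also have "\<dots> = prob (pair_pmf p q) (snd -` {g. P g})" by (rule measure_map_pmf)
  also have "snd -` {g. P g} = {(f :: 'a, g). P g}" by auto
  finally show ?thesis by simp
qed

lemma measure_pair_le1:
  assumes "\<And>f. f \<in> set_pmf p \<Longrightarrow> prob q {g. P f g} \<le> \<eta>"
  shows "prob (pair_pmf p q) {(f, g). P f g} \<le> \<eta>"
proof -
  have "prob (bind_pmf q (\<lambda>g. return_pmf (f, g))) {(f, g). P f g} = prob q {g. P f g}" for f
    by (subst map_pmf_def[symmetric], subst measure_map_pmf) (simp add: vimage_def)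
  then show ?thesis unfolding pair_pmf_def using assms by (subst measure_bind_pmf_le) auto
qed

lemma measure_pair_le2:
  assumes "\<And>g. g \<in> set_pmf q \<Longrightarrow> prob p {f. P f g} \<le> \<eta>"
  shows "prob (pair_pmf p q) {(f, g). P f g} \<le> \<eta>"
proof -
  have "prob (pair_pmf p q) {(f, g). P f g} =
      prob (pair_pmf q p) {(g, f). P f g}"
    by (subst pair_commute_pmf, subst measure_map_pmf) (auto intro!: arg_cong[where f = "prob _"])
  then show ?thesis using measure_pair_le1[of q p "\<lambda>g f. P f g"] assms by simp
qed

section \<open>Placements of branches and their merging at a common root\<close>

context layers
begin

text \<open>The error after \<open>j\<close> moves of the root. The summand 1 keeps
  \<open>err 0\<close> positive, as the averaging in \<open>heavy_slim\<close> requires.\<close>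

abbreviation (input) err :: "nat \<Rightarrow> real" where
  "err j \<equiv> (real j + 1) * \<sigma>"

text \<open>A random placement \<open>\<phi>\<close> of the elements of S around a root, placed at x. \<open>Up b\<close> lists the elements that lie
  beyond the root in direction b. All other elements must escape every prescribed small set Q,
  which makes the placements of different branches generically incomparable.\<close>

definition placement :: "('a \<Rightarrow> 'a \<Rightarrow> bool) \<Rightarrow> nat \<Rightarrow> 'a set \<Rightarrow> (bool \<Rightarrow> 'a set) \<Rightarrow> nat \<Rightarrow> nat set \<Rightarrow> ('a \<Rightarrow> nat set) pmf \<Rightarrow> bool" where
  "placement le T S Up j x p \<longleftrightarrow>
    (\<forall>\<phi>\<in>set_pmf p. (\<forall>s\<in>S. \<phi> s \<in> F \<and> (\<forall>b. card (dif b x (\<phi> s)) \<le> j * L)) \<and>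
       (\<forall>b. \<forall>s\<in>Up b. dif (\<not> b) x (\<phi> s) = {}) \<and> (\<forall>r\<in>S. \<forall>s\<in>S. le r s \<longrightarrow> \<phi> r \<subseteq> \<phi> s)) \<and>
    (\<forall>b. \<forall>s\<in>S - Up b. \<forall>Q. finite Q \<longrightarrow> card Q + j * L \<le> 2 * T * L \<longrightarrow>
       prob p {\<phi>. dif (\<not> b) x (\<phi> s) \<subseteq> Q} \<le> err j) \<and>
    (\<forall>r\<in>S. \<forall>s\<in>S. \<not> le r s \<longrightarrow> prob p {\<phi>. \<phi> r \<subseteq> \<phi> s} \<le> err j)"

definition placeable :: "('a \<Rightarrow> 'a \<Rightarrow> bool) \<Rightarrow> nat \<Rightarrow> (nat \<times> nat set) set \<Rightarrow> 'a set \<Rightarrow> (bool \<Rightarrow> 'a set) \<Rightarrow> nat \<Rightarrow> nat \<Rightarrow> bool" where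
  "placeable le T W S Up i j \<longleftrightarrow> (\<forall>x. (i, x) \<in> W \<longrightarrow> (\<exists>p. placement le T S Up j x p))"

lemma placementD:
  assumes "placement le T S Up j x p"
  shows "\<And>\<phi> s. \<phi> \<in> set_pmf p \<Longrightarrow> s \<in> S \<Longrightarrow> \<phi> s \<in> F"
    "\<And>\<phi> s b. \<phi> \<in> set_pmf p \<Longrightarrow> s \<in> S \<Longrightarrow> card (dif b x (\<phi> s)) \<le> j * L"
    "\<And>\<phi> s b. \<phi> \<in> set_pmf p \<Longrightarrow> s \<in> Up b \<Longrightarrow> dif (\<not> b) x (\<phi> s) = {}"
    "\<And>\<phi> r s. \<phi> \<in> set_pmf p \<Longrightarrow> r \<in> S \<Longrightarrow> s \<in> S \<Longrightarrow> le r s \<Longrightarrow> \<phi> r \<subseteq> \<phi> s"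
    "\<And>b s Q. s \<in> S \<Longrightarrow> s \<notin> Up b \<Longrightarrow> finite Q \<Longrightarrow> card Q + j * L \<le> 2 * T * L \<Longrightarrow>
       prob p {\<phi>. dif (\<not> b) x (\<phi> s) \<subseteq> Q} \<le> err j"
    "\<And>r s. r \<in> S \<Longrightarrow> s \<in> S \<Longrightarrow> \<not> le r s \<Longrightarrow> prob p {\<phi>. \<phi> r \<subseteq> \<phi> s} \<le> err j"
  using assms unfolding placement_def by simp_all

lemma placement_mono:
  assumes p: "placement le T S Up j x p" and "j \<le> j'"
  shows "placement le T S Up j' x p"
proof -
  have a: "j * L \<le> j' * L" using assms(2) by simp
  have b: "err j \<le> err j'" using assms(2) \<sigma> by (intro mult_right_mono) auto
  show ?thesis
    unfolding placement_def
  proof (intro conjI ballI allI impI)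
    show "card (dif b x (\<phi> s)) \<le> j' * L" if "\<phi> \<in> set_pmf p" "s \<in> S" for b \<phi> s
      using placementD(2)[OF p that] a by (rule order_trans)
    show "prob p {\<phi>. dif (\<not> c) x (\<phi> s) \<subseteq> Q} \<le> err j'"
      if "s \<in> S - Up c" "finite Q" "card Q + j' * L \<le> 2 * T * L" for c s Q
      using placementD(5)[OF p, of s c Q] that a b by auto
    show "prob p {\<phi>. \<phi> r \<subseteq> \<phi> s} \<le> err j'"
      if "r \<in> S" "s \<in> S" "\<not> le r s" for r s
      using placementD(6)[OF p that] b by (rule order_trans)
  qed (use placementD[OF p] in blast)+
qed

lemma placement_singleton:
  assumes "x \<in> F" "le q q"
  shows "placement le T {q} (\<lambda>b. {q}) 0 x (return_pmf (\<lambda>_. x))"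
  using assms unfolding placement_def by (auto simp: dif_def)

text \<open>The difference to a set placed by another branch has at most \<open>j * L\<close>
  elements. Together with the \<open>j * L\<close> reserved in \<open>placement\<close> this stays
  within \<open>2 * T * L\<close>, which explains the factor 2.\<close>

lemma placement_escape:
  assumes p: "placement le T S Up j x p" and j: "j \<le> T" and s: "s \<in> S" "s \<notin> Up (\<not> b)"
    and y: "card (dif b x y) \<le> j * L" "x \<in> F" "y \<in> F"
  shows "prob p {\<phi>. dif b x (\<phi> s) \<subseteq> dif b x y} \<le> err j"
proof -
  have "card (dif b x y) + j * L \<le> 2 * T * L" using y(1) mult_le_mono1[OF j, of L] by linarith
  moreover have "finite (dif b x y)" using y F finite_subset[of _ "{..<n}"] by (auto simp: dif_def)
  ultimately show ?thesis using placementD(5)[OF p s, of "dif b x y"] by simp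
qed

text \<open>If \<open>f r \<subseteq> g s\<close>, then \<open>x - g s \<subseteq> x - f r\<close>
  and \<open>f r - x \<subseteq> g s - x\<close>. By hypothesis one of these two left-hand sides
  belongs to an element that has to escape; fix the placement of the other branch and use
  independence.\<close>

lemma placement_cross:
  assumes p1: "placement le T S1 Up1 j x p1" and p2: "placement le T S2 Up2 j x p2" and j: "j \<le> T"
    and r: "r \<in> S1" and s: "s \<in> S2" and n: "r \<notin> Up1 False \<or> s \<notin> Up2 True" and x: "x \<in> F"
  shows "prob (pair_pmf p1 p2) {(f, g). f r \<subseteq> g s} \<le> err j"
proof (cases "s \<in> Up2 True")
  case False
  show ?thesis
  proof (rule measure_pair_le1)
    fix f assume f: "f \<in> set_pmf p1"
    have "prob p2 {g. f r \<subseteq> g s} \<le> prob p2 {\<phi>. dif False x (\<phi> s) \<subseteq> dif False x (f r)}"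
      by (intro measure_pmf.finite_measure_mono) (auto simp: dif_def)
    also have "\<dots> \<le> err j"
      using False placementD(1,2)[OF p1 f r] x by (intro placement_escape[OF p2 j s]) auto
    finally show "prob p2 {g. f r \<subseteq> g s} \<le> err j" .
  qed
next
  case True
  show ?thesis
  proof (rule measure_pair_le2)
    fix g assume g: "g \<in> set_pmf p2"
    have "prob p1 {f. f r \<subseteq> g s} \<le> prob p1 {\<phi>. dif True x (\<phi> r) \<subseteq> dif True x (g s)}"
      by (intro measure_pmf.finite_measure_mono) (auto simp: dif_def)
    also have "\<dots> \<le> err j"
      using True n placementD(1,2)[OF p2 g s] x by (intro placement_escape[OF p1 j r]) auto
    finally show "prob p1 {f. f r \<subseteq> g s} \<le> err j" .
  qed
qed

text \<open>The branches are placed independently around the same \<open>x\<close>. By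
  \<open>o12\<close> and \<open>o21\<close>, a required containment across the branches goes through
  \<open>x\<close> and holds for every outcome; all other pairs fall under
  \<open>placement_cross\<close>. The error does not increase.\<close>

lemma placement_merge:
  assumes p1: "placement le T S1 Up1 j x p1" and p2: "placement le T S2 Up2 j x p2" and j: "j \<le> T"
    and disj: "S1 \<inter> S2 = {}" and U: "\<And>b. Up1 b \<subseteq> S1" "\<And>b. Up2 b \<subseteq> S2" and x: "x \<in> F"
    and o12: "\<And>r s. r \<in> S1 \<Longrightarrow> s \<in> S2 \<Longrightarrow> le r s \<longleftrightarrow> r \<in> Up1 False \<and> s \<in> Up2 True"
    and o21: "\<And>r s. r \<in> S2 \<Longrightarrow> s \<in> S1 \<Longrightarrow> le r s \<longleftrightarrow> r \<in> Up2 False \<and> s \<in> Up1 True"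
  shows "\<exists>p. placement le T (S1 \<union> S2) (\<lambda>b. Up1 b \<union> Up2 b) j x p"
proof -
  define h where "h = (\<lambda>(f, g) s. if s \<in> S1 then f s else g s :: nat set)"
  define p where "p = map_pmf h (pair_pmf p1 p2)"
  have h1: "h (f, g) s = f s" if "s \<in> S1" for f g s using that by (simp add: h_def)
  have h2: "h (f, g) s = g s" if "s \<in> S2" for f g s using that disj by (auto simp: h_def)
  have pr: "prob p {\<phi>. P \<phi>} = prob (pair_pmf p1 p2) {(f, g). P (h (f, g))}" for P
    unfolding p_def measure_map_pmf by (auto simp: vimage_def intro!: arg_cong[where f = "prob _"])
  have a1: "\<forall>s\<in>S1. f s \<in> F \<and> (\<forall>b. card (dif b x (f s)) \<le> j * L)" "\<forall>b. \<forall>s\<in>Up1 b. dif (\<not> b) x (f s) = {}"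
    "\<forall>r\<in>S1. \<forall>s\<in>S1. le r s \<longrightarrow> f r \<subseteq> f s" if "f \<in> set_pmf p1" for f
    using placementD(1-4)[OF p1 that] by blast+
  have a2: "\<forall>s\<in>S2. f s \<in> F \<and> (\<forall>b. card (dif b x (f s)) \<le> j * L)" "\<forall>b. \<forall>s\<in>Up2 b. dif (\<not> b) x (f s) = {}"
    "\<forall>r\<in>S2. \<forall>s\<in>S2. le r s \<longrightarrow> f r \<subseteq> f s" if "f \<in> set_pmf p2" for f
    using placementD(1-4)[OF p2 that] by blast+
  have "placement le T (S1 \<union> S2) (\<lambda>b. Up1 b \<union> Up2 b) j x p"
    unfolding placement_def
  proof (intro conjI ballI allI impI)
    fix \<phi> assume "\<phi> \<in> set_pmf p"
    then obtain f g where fg: "f \<in> set_pmf p1" "g \<in> set_pmf p2" "\<phi> = h (f, g)"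
      by (auto simp: p_def)
    fix s assume s: "s \<in> S1 \<union> S2"
    show "\<phi> s \<in> F" using s fg a1(1)[OF fg(1)] a2(1)[OF fg(2)] by (auto simp: h1 h2)
    show "card (dif b x (\<phi> s)) \<le> j * L" for b
      using s fg a1(1)[OF fg(1)] a2(1)[OF fg(2)] by (auto simp: h1 h2)
  next
    fix \<phi> assume "\<phi> \<in> set_pmf p"
    then obtain f g where fg: "f \<in> set_pmf p1" "g \<in> set_pmf p2" "\<phi> = h (f, g)"
      by (auto simp: p_def)
    fix b s assume s: "s \<in> Up1 b \<union> Up2 b"
    then show "dif (\<not> b) x (\<phi> s) = {}"
      using fg a1(2)[OF fg(1)] a2(2)[OF fg(2)] U by (auto simp: h1 h2 subset_iff)
  next
    fix \<phi> assume "\<phi> \<in> set_pmf p"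
    then obtain f g where fg: "f \<in> set_pmf p1" "g \<in> set_pmf p2" "\<phi> = h (f, g)"
      by (auto simp: p_def)
    fix r s assume rs: "r \<in> S1 \<union> S2" "s \<in> S1 \<union> S2" "le r s"
    have lo1: "f u \<subseteq> x" if "u \<in> Up1 False" for u using a1(2)[OF fg(1)] that by (fastforce simp: dif_def)
    have hi1: "x \<subseteq> f u" if "u \<in> Up1 True" for u using a1(2)[OF fg(1)] that by (fastforce simp: dif_def)
    have lo2: "g u \<subseteq> x" if "u \<in> Up2 False" for u using a2(2)[OF fg(2)] that by (fastforce simp: dif_def)
    have hi2: "x \<subseteq> g u" if "u \<in> Up2 True" for u using a2(2)[OF fg(2)] that by (fastforce simp: dif_def)
    consider "r \<in> S1" "s \<in> S1" | "r \<in> S2" "s \<in> S2" | "r \<in> S1" "s \<in> S2" | "r \<in> S2" "s \<in> S1" using rs by auto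
    then show "\<phi> r \<subseteq> \<phi> s"
    proof cases
      case 1 then show ?thesis using rs a1(3)[OF fg(1)] by (simp add: fg h1)
    next
      case 2 then show ?thesis using rs a2(3)[OF fg(2)] by (simp add: fg h2)
    next
      case 3
      then have "r \<in> Up1 False" "s \<in> Up2 True" using o12 rs by auto
      then show ?thesis using 3 lo1[of r] hi2[of s] by (simp add: fg h1 h2)
    next
      case 4
      then have "r \<in> Up2 False" "s \<in> Up1 True" using o21 rs by auto
      then show ?thesis using 4 lo2[of r] hi1[of s] by (simp add: fg h1 h2)
    qed
  next
    fix b s and Q :: "nat set" assume s: "s \<in> S1 \<union> S2 - (Up1 b \<union> Up2 b)" and Q: "finite Q" "card Q + j * L \<le> 2 * T * L"
    have "prob p1 {\<phi>. dif (\<not> b) x (\<phi> s) \<subseteq> Q} \<le> err j" if "s \<in> S1"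
      using s that by (intro placementD(5)[OF p1 _ _ Q]) auto
    moreover have "prob p2 {\<phi>. dif (\<not> b) x (\<phi> s) \<subseteq> Q} \<le> err j" if "s \<in> S2"
      using s that by (intro placementD(5)[OF p2 _ _ Q]) auto
    ultimately show "prob p {\<phi>. dif (\<not> b) x (\<phi> s) \<subseteq> Q} \<le> err j"
      using s unfolding pr by (auto simp: h1 h2 measure_pair_fst[where P = "\<lambda>f. dif (\<not> b) x (f s) \<subseteq> Q"]
        measure_pair_snd[where P = "\<lambda>f. dif (\<not> b) x (f s) \<subseteq> Q"])
  next
    fix r s assume rs: "r \<in> S1 \<union> S2" "s \<in> S1 \<union> S2" "\<not> le r s"
    consider "r \<in> S1" "s \<in> S1" | "r \<in> S2" "s \<in> S2" | "r \<in> S1" "s \<in> S2" | "r \<in> S2" "s \<in> S1" using rs by auto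
    then show "prob p {\<phi>. \<phi> r \<subseteq> \<phi> s} \<le> err j"
    proof cases
      case 1
      then have "prob p1 {\<phi>. \<phi> r \<subseteq> \<phi> s} \<le> err j"
        using rs by (intro placementD(6)[OF p1]) auto
      then show ?thesis using 1 unfolding pr by (simp add: h1 measure_pair_fst[where P = "\<lambda>f. f r \<subseteq> f s"])
    next
      case 2
      then have "prob p2 {\<phi>. \<phi> r \<subseteq> \<phi> s} \<le> err j"
        using rs by (intro placementD(6)[OF p2]) auto
      then show ?thesis using 2 unfolding pr by (simp add: h2 measure_pair_snd[where P = "\<lambda>f. f r \<subseteq> f s"])
    next
      case 3
      then have "r \<notin> Up1 False \<or> s \<notin> Up2 True" using o12 rs by blast
      from placement_cross[OF p1 p2 j 3 this x] show ?thesis using 3 unfolding pr by (simp add: h1 h2)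
    next
      case 4
      then have "r \<notin> Up2 False \<or> s \<notin> Up1 True" using o21 rs by blast
      from placement_cross[OF p2 p1 j 4 this x]
      have "prob (pair_pmf p1 p2) {(f, g). g r \<subseteq> f s} \<le> err j"
        by (subst pair_commute_pmf, subst measure_map_pmf) (simp add: vimage_def case_prod_beta')
      then show ?thesis using 4 unfolding pr by (simp add: h1 h2)
    qed
  qed
  then show ?thesis by blast
qed

end

section \<open>Moving the root to an adjacent layer\<close>

lemma dif_triangle: "dif b x y \<subseteq> dif b x z \<union> dif b z y"
  by (auto simp: dif_def)

context layers
begin

definition shadow :: "bool \<Rightarrow> 'a set \<Rightarrow> nat set \<Rightarrow> ('a \<Rightarrow> nat set) \<Rightarrow> nat set" where
  "shadow b U z \<phi> = (\<Union>s\<in>U. dif b z (\<phi> s))"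

lemma finite_dif: "x \<in> F \<Longrightarrow> y \<in> F \<Longrightarrow> finite (dif b x y)"
  using F finite_subset[of _ "{..<n}"] by (auto simp: dif_def)

text \<open>Elements of \<open>Up b\<close> are placed at sets comparable with \<open>z\<close>, so
  each contributes at most \<open>L\<close> elements, not \<open>j * L\<close>.\<close>

lemma card_shadow:
  assumes p: "placement le T S Up j z p" and \<phi>: "\<phi> \<in> set_pmf p" and z: "z \<in> F"
    and S: "finite S" "Up b \<subseteq> S" "card S * L \<le> K"
  shows "finite (shadow b (Up b) z \<phi>)" "card (shadow b (Up b) z \<phi>) \<le> K"
proof -
  have fU: "finite (Up b)" using S finite_subset by auto
  have phF: "\<phi> s \<in> F" if "s \<in> Up b" for s using placementD(1)[OF p \<phi>] that S by auto
  show "finite (shadow b (Up b) z \<phi>)"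
    using fU phF z finite_dif by (auto simp: shadow_def)
  have "card (dif b z (\<phi> s)) \<le> L" if s: "s \<in> Up b" for s
  proof (cases "\<phi> s = z")
    case False
    have "dif (\<not> b) z (\<phi> s) = {}" using placementD(3)[OF p \<phi> s] .
    then have "beyond b z (\<phi> s)" using False by (auto simp: beyond_def dif_def split: if_splits)
    from beyond_dif(2)[OF z phF[OF s] this] show ?thesis by simp
  qed (simp add: dif_def)
  note le = this
  have "card (shadow b (Up b) z \<phi>) \<le> (\<Sum>s\<in>Up b. card (dif b z (\<phi> s)))"
    unfolding shadow_def by (rule card_UN_le[OF fU])
  also have "\<dots> \<le> card (Up b) * L"
    using sum_bounded_above[of "Up b" "\<lambda>s. card (dif b z (\<phi> s))" L] le by simp
  also have "\<dots> \<le> card S * L" using S by (intro mult_right_mono card_mono) auto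
  finally show "card (shadow b (Up b) z \<phi>) \<le> K" using S by simp
qed

text \<open>For each fixed outcome the shadow has at most \<open>K\<close> elements, so
  \<open>hit_nbrs\<close> leaves few sets half covered by it. Averaging over outcomes, at most a
  \<open>\<sigma> / err j\<close> share of the density \<open>\<theta> d\<close> can be half covered
  with probability above \<open>err j\<close>, and this share is at most 1.\<close>

lemma heavy_slim:
  assumes p: "placement le T S Up j z p" and z: "z \<in> F"
    and S: "finite S" "Up b \<subseteq> S" "card S * L \<le> K"
    and Y: "\<And>x. x \<in> Y \<Longrightarrow> x \<in> F \<and> beyond b z x \<and>
      prob p {\<phi>. half_in (dif b z x) (shadow b (Up b) z \<phi>)} > err j"
  shows "slim n \<theta> L 1 b z Y"
  unfolding slim_def
proof
  fix d assume d: "d \<in> {1..L}"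
  let ?Y = "{x \<in> Y. card (dif b z x) = d}"
  let ?B = "sphere_size n b z d"
  let ?H = "\<lambda>x \<phi>. half_in (dif b z x) (shadow b (Up b) z \<phi>)"
  have "Y \<subseteq> F" using Y by auto
  then have fY: "finite ?Y" using finF finite_subset[of Y F] by simp
  have "err j * real (card ?Y) = (\<Sum>x\<in>?Y. err j)" by simp
  also have "\<dots> \<le> (\<Sum>x\<in>?Y. prob p {\<phi>. ?H x \<phi>})"
    using Y by (intro sum_mono) force
  also have "\<dots> \<le> \<sigma> * (\<theta> d * ?B)"
  proof (rule sum_measure_pmf_le[OF fY])
    fix \<phi> assume \<phi>: "\<phi> \<in> set_pmf p"
    show "real (card {x \<in> ?Y. ?H x \<phi>}) \<le> \<sigma> * (\<theta> d * ?B)"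
      by (rule hit_nbrs[OF z d card_shadow[OF p \<phi> z S]]) (use Y in auto)
  qed
  finally have "\<sigma> * ((real j + 1) * real (card ?Y)) \<le> \<sigma> * (\<theta> d * ?B)" by (simp add: mult_ac)
  then have "(real j + 1) * real (card ?Y) \<le> \<theta> d * ?B" using \<sigma> by simp
  moreover have "real (card ?Y) \<le> (real j + 1) * real (card ?Y)" by (simp add: algebra_simps)
  ultimately show "real (card ?Y) \<le> 1 * \<theta> d * ?B" by simp
qed

text \<open>The new root \<open>x\<close> lies behind the old root \<open>z\<close>, which is now
  random in a spread set. Elements beyond \<open>z\<close> in direction \<open>b\<close> are beyond
  \<open>x\<close> too. Those on the other side of \<open>z\<close> lose their fixed position: they
  are required to be generic with respect to \<open>x\<close>, and this is where
  \<open>light\<close> enters.\<close>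

lemma placement_extend:
  assumes x: "x \<in> F" and Y: "spread b x Y"
    and YF: "\<And>z. z \<in> Y \<Longrightarrow> z \<in> F \<and> beyond b x z"
    and P: "\<And>z. z \<in> Y \<Longrightarrow> placement le T S Up j z (P z)"
    and light: "\<And>z. z \<in> Y \<Longrightarrow> prob (P z)
      {\<phi>. half_in (dif (\<not> b) z x) (shadow (\<not> b) (Up (\<not> b)) z \<phi>)} \<le> err j"
    and K: "2 * T * L \<le> K" and S: "finite S" "\<And>b. Up b \<subseteq> S"
  shows "placement le T S (\<lambda>b'. if b' = b then Up b else {}) (Suc j) x (bind_pmf (pmf_of_set Y) P)"
proof -
  let ?p = "bind_pmf (pmf_of_set Y) P"
  have Yf: "finite Y" "Y \<noteq> {}" using Y by (auto simp: spread_def)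
  have st: "\<exists>z\<in>Y. \<phi> \<in> set_pmf (P z)" if "\<phi> \<in> set_pmf ?p" for \<phi>
    using that Yf by auto
  have opp: "dif (\<not> b) x z = {}" if "z \<in> Y" for z using beyond_dif(3)[OF x] YF that by auto
  have cD: "card (dif b x z) \<le> L" if "z \<in> Y" for z using beyond_dif(2)[OF x, of z b] YF that by auto
  have dsym: "dif (\<not> b) z x = dif b x z" for z by (simp add: dif_def)
  have e0: "0 \<le> err j" using \<sigma> by simp
  have e1: "err j \<le> err (Suc j)" using \<sigma> by (intro mult_right_mono) auto
  have e2: "\<sigma> + err j = err (Suc j)" by (simp add: algebra_simps)
  have weak: "prob ?p X \<le> err (Suc j)"
    if "\<And>z. z \<in> Y \<Longrightarrow> prob (P z) X \<le> err j" for X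
    using measure_bind_pmf_le[of "pmf_of_set Y" P X "err j"] that Yf e1 by auto
  have split: "prob ?p X \<le> err (Suc j)"
    if Q: "finite Q" "card Q \<le> K" and g: "\<And>z. z \<in> Y \<Longrightarrow> 2 * card (dif b x z \<inter> Q) < card (dif b x z) \<Longrightarrow>
      prob (P z) X \<le> err j" for X Q
    unfolding e2[symmetric]
    by (rule measure_bind_pmf_of_set_le[OF Yf, where bad = "\<lambda>z. half_in (dif b x z) Q"])
      (use Y Q g e0 in \<open>auto simp: spread_def not_le\<close>)
  show ?thesis
    unfolding placement_def
  proof (intro conjI ballI allI impI)
    fix \<phi> s b' assume \<phi>: "\<phi> \<in> set_pmf ?p" and s: "s \<in> S"
    then obtain z where z: "z \<in> Y" "\<phi> \<in> set_pmf (P z)" using st by auto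
    show phF: "\<phi> s \<in> F" using placementD(1)[OF P[OF z(1)] z(2) s] .
    have zF: "z \<in> F" using YF z by auto
    have "card (dif b' x (\<phi> s)) \<le> card (dif b' x z \<union> dif b' z (\<phi> s))"
      using finite_dif x zF phF by (intro card_mono dif_triangle) auto
    also have "\<dots> \<le> card (dif b' x z) + card (dif b' z (\<phi> s))" by (rule card_Un_le)
    also have "\<dots> \<le> L + j * L"
    proof (rule add_mono)
      show "card (dif b' x z) \<le> L" using opp[OF z(1)] cD[OF z(1)] by (cases "b' = b") auto
      show "card (dif b' z (\<phi> s)) \<le> j * L" by (rule placementD(2)[OF P[OF z(1)] z(2) s])
    qed
    finally show "card (dif b' x (\<phi> s)) \<le> Suc j * L" by simp
  next
    fix \<phi> b' s assume \<phi>: "\<phi> \<in> set_pmf ?p" and s: "s \<in> (if b' = b then Up b else {})"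
    then have s: "b' = b" "s \<in> Up b" by (auto split: if_splits)
    obtain z where z: "z \<in> Y" "\<phi> \<in> set_pmf (P z)" using st \<phi> by auto
    have "dif (\<not> b) z (\<phi> s) = {}" using placementD(3)[OF P[OF z(1)] z(2) s(2)] .
    then show "dif (\<not> b') x (\<phi> s) = {}"
      using dif_triangle[of "\<not> b" x "\<phi> s" z] opp[OF z(1)] s by auto
  next
    fix \<phi> r s assume \<phi>: "\<phi> \<in> set_pmf ?p" and rs: "r \<in> S" "s \<in> S" "le r s"
    then obtain z where z: "z \<in> Y" "\<phi> \<in> set_pmf (P z)" using st by auto
    show "\<phi> r \<subseteq> \<phi> s" using placementD(4)[OF P[OF z(1)] z(2) rs] .
  next
    fix b' s and Q :: "nat set"
    assume s: "s \<in> S - (if b' = b then Up b else {})" and Q: "finite Q" "card Q + Suc j * L \<le> 2 * T * L"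
    have QK: "card Q \<le> K" using Q K by simp
    have QjL: "card Q + j * L \<le> 2 * T * L" using Q by simp
    show "prob ?p {\<phi>. dif (\<not> b') x (\<phi> s) \<subseteq> Q} \<le> err (Suc j)"
    proof (cases "b' = b")
      case True
      then have s': "s \<in> S" "s \<notin> Up b" using s by auto
      show ?thesis
      proof (rule weak)
        fix z assume z: "z \<in> Y"
        \<comment> \<open>Seen from \<open>z\<close>, the set to avoid grows by at most
          \<open>L\<close> elements; the term \<open>j * L\<close> in \<open>placement\<close> is
          the reserve for this.\<close>
        let ?Q = "Q \<union> dif b x z"
        have "card ?Q \<le> card Q + L" using card_Un_le[of Q "dif b x z"] cD[OF z] by linarith
        then have "card ?Q + j * L \<le> 2 * T * L" using Q by simp
        moreover have "finite ?Q" using Q finite_dif x YF z by auto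
        ultimately have *: "prob (P z) {\<phi>. dif (\<not> b) z (\<phi> s) \<subseteq> ?Q} \<le> err j"
          by (intro placementD(5)[OF P[OF z] s'])
        have "dif (\<not> b) z y \<subseteq> ?Q" if "dif (\<not> b) x y \<subseteq> Q" for y
          using that dif_triangle[of "\<not> b" z y x] dsym by auto
        then have "prob (P z) {\<phi>. dif (\<not> b') x (\<phi> s) \<subseteq> Q} \<le>
            prob (P z) {\<phi>. dif (\<not> b) z (\<phi> s) \<subseteq> ?Q}"
          using True by (intro measure_pmf.finite_measure_mono) auto
        with * show "prob (P z) {\<phi>. dif (\<not> b') x (\<phi> s) \<subseteq> Q} \<le> err j" by linarith
      qed
    next
      case False
      then have b': "(\<not> b') = b" by auto
      have sS: "s \<in> S" using s by auto
      show ?thesis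
      proof (rule split[OF Q(1) QK])
        fix z assume z: "z \<in> Y" and fresh: "2 * card (dif b x z \<inter> Q) < card (dif b x z)"
        have zF: "z \<in> F" using YF z by auto
        show "prob (P z) {\<phi>. dif (\<not> b') x (\<phi> s) \<subseteq> Q} \<le> err j"
        proof (cases "s \<in> Up (\<not> b)")
          case True
          let ?R = "shadow (\<not> b) (Up (\<not> b)) z"
          let ?H = "{\<phi>. half_in (dif (\<not> b) z x) (?R \<phi>)}"
          \<comment> \<open>If \<open>\<phi> s\<close> failed to escape, \<open>Q\<close> and the
            shadow would together cover \<open>dif b x z\<close>. As \<open>Q\<close> covers less
            than half of it, the shadow covers at least half, which is the event bounded by
            \<open>light\<close>.\<close>
          have "\<phi> \<in> ?H" if "dif b x (\<phi> s) \<subseteq> Q" for \<phi>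
          proof -
            have D: "dif b x z \<subseteq> Q \<union> ?R \<phi>"
            proof -
              have "dif (\<not> b) z (\<phi> s) \<subseteq> ?R \<phi>" using True by (auto simp: shadow_def)
              moreover have "dif b x z \<subseteq> dif b x (\<phi> s) \<union> dif (\<not> b) z (\<phi> s)"
                by (auto simp: dif_def)
              ultimately show ?thesis using that by blast
            qed
            have "dif b x z = dif b x z \<inter> Q \<union> dif b x z \<inter> ?R \<phi>" using D by auto
            then have "card (dif b x z) \<le> card (dif b x z \<inter> Q) + card (dif b x z \<inter> ?R \<phi>)"
              using card_Un_le[of "dif b x z \<inter> Q" "dif b x z \<inter> ?R \<phi>"] by argo
            then show ?thesis using fresh by (simp add: dsym)
          qed
          then have "prob (P z) {\<phi>. dif (\<not> b') x (\<phi> s) \<subseteq> Q} \<le> prob (P z) ?H"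
            unfolding b' by (intro measure_pmf.finite_measure_mono) auto
          also note light[OF z]
          finally show ?thesis .
        next
          case False
          have *: "prob (P z) {\<phi>. dif (\<not> (\<not> b)) z (\<phi> s) \<subseteq> Q} \<le> err j"
            by (rule placementD(5)[OF P[OF z] sS False Q(1) QjL])
          have "dif b z y \<subseteq> dif b x y" for y
            using dif_triangle[of b z y x] opp[OF z] dsym by (auto simp: dif_def split: if_splits)
          then have "prob (P z) {\<phi>. dif (\<not> b') x (\<phi> s) \<subseteq> Q} \<le>
            prob (P z) {\<phi>. dif (\<not> (\<not> b)) z (\<phi> s) \<subseteq> Q}"
            unfolding b' by (intro measure_pmf.finite_measure_mono) auto
          with * show ?thesis by linarith
        qed
      qed
    qed
  next
    fix r s assume "r \<in> S" "s \<in> S" "\<not> le r s"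
    then show "prob ?p {\<phi>. \<phi> r \<subseteq> \<phi> s} \<le> err (Suc j)"
      by (intro weak placementD(6)[OF P])
  qed
qed

text \<open>The deleted neighbours of z are those whose step to z would often be undone by the
  elements that \<open>P z\<close> places behind them.\<close>

lemma placeable_step:
  assumes I: "inv W E c" and pl: "placeable le T W S Up i' j"
    and i: "if b then i' = Suc i else i = Suc i'" "i \<in> {1..k}" "i' \<in> {1..k}"
    and K: "2 * T * L \<le> K" "card S * L \<le> K" and S: "finite S" "\<And>b. Up b \<subseteq> S"
  shows "\<exists>W'\<subseteq>W. \<exists>E'\<subseteq>E. inv W' E' (c + 1) \<and> pruned W' E' \<and>
    placeable le T W' S (\<lambda>b'. if b' = b then Up b else {}) i (Suc j)"
proof -
  from pl obtain P where P: "\<And>z. (i', z) \<in> W \<Longrightarrow> placement le T S Up j z (P z)"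
    unfolding placeable_def by metis
  define Hv where "Hv z = {x \<in> snd ` nbr E0 (\<not> b) (i', z). prob (P z)
      {\<phi>. half_in (dif (\<not> b) z x) (shadow (\<not> b) (Up (\<not> b)) z \<phi>)} > err j}" for z
  from I obtain ch r where cg: "charging W E c ch r" unfolding inv_def by blast
  note W = chargingD(1)[OF cg] and E = chargingD(2)[OF cg]
  \<comment> \<open>The edges between layers \<open>i\<close> and \<open>i'\<close> that end in a
    heavy neighbour are dropped and charged to their end in layer \<open>i'\<close>. By
    \<open>heavy_slim\<close> this costs one unit of \<open>c\<close>.\<close>
  define E1 where "E1 = {(v, u) \<in> E. if b then \<not> (fst u = i' \<and> snd v \<in> Hv (snd u)) else \<not> (fst v = i' \<and> snd u \<in> Hv (snd v))}"
  define ch' where "ch' b' v = (if b' = (\<not> b) \<and> fst v = i' \<and> v \<in> W then ch b' v \<union> Hv (snd v) else ch b' v)" for b' v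
  have Hslim: "slim n \<theta> L 1 (\<not> b) z (Hv z)" if z: "(i', z) \<in> W" for z
  proof (rule heavy_slim[OF P[OF z] _ S(1) S(2) K(2)])
    show "z \<in> F" using W z V0D by force
    fix x assume "x \<in> Hv z"
    then show "x \<in> F \<and> beyond (\<not> b) z x \<and> err j < prob (P z)
        {\<phi>. half_in (dif (\<not> b) z x) (shadow (\<not> b) (Up (\<not> b)) z \<phi>)}"
      using nbr_E0D[of x "\<not> b" "(i', z)"] by (simp add: Hv_def)
  qed
  have "charging W E1 (c + 1) ch' r"
    unfolding charging_def
  proof (intro conjI ballI allI impI)
    show "W \<subseteq> V0" by (rule W)
    show "E1 \<subseteq> E0 \<inter> W \<times> W" using E by (auto simp: E1_def)
    fix v b' assume v: "v \<in> V0"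
    show "ch' b' v \<subseteq> snd ` nbr E0 b' v" using chargingD(3)[OF cg v, of b'] by (cases v) (auto simp: ch'_def Hv_def)
    have 1: "slim n \<theta> L (c + of_bool (v \<notin> W)) b' (snd v) (ch b' v)" by (rule chargingD(4)[OF cg v])
    show "slim n \<theta> L (c + 1 + of_bool (v \<notin> W)) b' (snd v) (ch' b' v)"
    proof (cases "b' = (\<not> b) \<and> fst v = i' \<and> v \<in> W")
      case True
      then have "slim n \<theta> L 1 b' (snd v) (Hv (snd v))" using Hslim[of "snd v"] by (cases v) auto
      from slim_Un[OF 1 this] show ?thesis using True by (simp add: ch'_def)
    next
      case False
      then have "ch' b' v = ch b' v" by (simp only: ch'_def if_False)
      then show ?thesis using slim_mono[OF 1 subset_refl charging_finite[OF cg v], of "c + 1 + of_bool (v \<notin> W)"] \<theta> by auto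
    qed
  next
    fix v assume "v \<in> V0 - W" then show "inner_level (r v) v" using chargingD(5)[OF cg] by simp
  next
    fix v u assume vu: "(v, u) \<in> E0 - E1"
    have sub: "ch b' w \<subseteq> ch' b' w" for b' w by (auto simp: ch'_def)
    show "snd u \<in> ch' True v \<or> snd v \<in> ch' False u \<or> v \<notin> W \<and> \<not> r v \<or> u \<notin> W \<and> r u"
    proof (cases "(v, u) \<in> E")
      case True
      then have "v \<in> W" "u \<in> W" using E by auto
      then show ?thesis using vu True by (cases b) (auto simp: E1_def ch'_def)
    next
      case False
      then have "snd u \<in> ch True v \<or> snd v \<in> ch False u \<or> v \<notin> W \<and> \<not> r v \<or> u \<notin> W \<and> r u"
        using chargingD(6)[OF cg] vu by blast
      then show ?thesis using sub by blast
    qed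
  qed
  then have "inv W E1 (c + 1)" unfolding inv_def by blast
  \<comment> \<open>Pruning again restores spread neighbourhoods, now consisting only of sets
    \<open>z\<close> for which \<open>x\<close> is light.\<close>
  from prune[OF this] obtain W' E' where W': "W' \<subseteq> W" "E' \<subseteq> E1" "inv W' E' (c + 1)" "pruned W' E'"
    by auto
  have WV: "W' \<subseteq> V0" "E' \<subseteq> W' \<times> W'" "E' \<subseteq> E0" using invD[OF W'(3)] by auto
  have "placeable le T W' S (\<lambda>b'. if b' = b then Up b else {}) i (Suc j)"
    unfolding placeable_def
  proof (intro allI impI)
    fix x assume x: "(i, x) \<in> W'"
    have "inner_level b (i, x)" using i by (auto simp: inner_level_def split: if_splits)
    then have "\<exists>Y \<subseteq> snd ` nbr E' b (i, x). spread b (snd (i, x)) Y"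
      by (rule W'(4)[unfolded pruned_def, rule_format, OF x])
    then obtain Y where Y: "Y \<subseteq> snd ` nbr E' b (i, x)" "spread b x Y" by auto
    have xF: "x \<in> F" using x WV V0D by force
    have Yz: "(i', z) \<in> W \<and> z \<in> F \<and> beyond b x z \<and> x \<notin> Hv z \<and> x \<in> snd ` nbr E0 (\<not> b) (i', z)" if z: "z \<in> Y" for z
    proof -
      obtain l where l: "(l, z) \<in> nbr E' b (i, x)" using Y(1) z by force
      then have l0: "(l, z) \<in> nbr E0 b (i, x)" using nbr_mono[OF WV(3)] by blast
      then have li: "l = i'" using i by (auto simp: nbr_E0 split: if_splits)
      have "(l, z) \<in> W'" using l WV(2) by (auto simp: nbr_def split: if_splits)
      moreover have "x \<notin> Hv z" using l W'(2) li unfolding nbr_def E1_def by (cases b) auto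
      moreover have "(i, x) \<in> nbr E0 (\<not> b) (i', z)" using l0 li nbr_sym by blast
      moreover have "z \<in> F \<and> beyond b x z" using nbr_E0D[of z b "(i, x)"] l0 by force
      moreover have "x \<in> snd ` nbr E0 (\<not> b) (i', z)" using calculation by force
      ultimately show ?thesis using li W'(1) by blast
    qed
    have "placement le T S (\<lambda>b'. if b' = b then Up b else {}) (Suc j) x (bind_pmf (pmf_of_set Y) P)"
    proof (rule placement_extend[OF xF Y(2) _ P _ K(1) S])
      fix z assume z: "z \<in> Y"
      show "z \<in> F \<and> beyond b x z" "(i', z) \<in> W" using Yz[OF z] by auto
      show "prob (P z) {\<phi>. card (dif (\<not> b) z x) \<le>
          2 * card (dif (\<not> b) z x \<inter> shadow (\<not> b) (Up (\<not> b)) z \<phi>)} \<le> err j"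
        using Yz[OF z] by (auto simp: Hv_def not_less)
    qed
    then show "\<exists>p. placement le T S (\<lambda>b'. if b' = b then Up b else {}) (Suc j) x p" by blast
  qed
  moreover have "E1 \<subseteq> E" by (auto simp: E1_def)
  ultimately show ?thesis using W' by (meson subset_trans)
qed

section \<open>Placing the whole tree\<close>

lemma inv_mono:
  assumes I: "inv W E c" and c: "c \<le> c'"
  shows "inv W E c'"
proof -
  from I obtain ch r where cg: "charging W E c ch r" unfolding inv_def by blast
  have "slim n \<theta> L (c' + of_bool (v \<notin> W)) b (snd v) (ch b v)" if v: "v \<in> V0" for v b
    by (rule slim_mono[OF chargingD(4)[OF cg v] subset_refl charging_finite[OF cg v]]) (use c \<theta> in auto)
  then have "charging W E c' ch r" using chargingD[OF cg] unfolding charging_def by simp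
  then show ?thesis unfolding inv_def by blast
qed

text \<open>A covering relation may skip layers under \<open>ht\<close>. The root then passes
  through the layers in between, where no element of the poset is put.\<close>

lemma placeable_steps:
  assumes I: "inv W E c" and pl: "placeable le T W S Up i' j"
    and i: "if b then i' = i + Suc m else i = i' + Suc m" "i \<in> {1..k}" "i' \<in> {1..k}"
    and K: "2 * T * L \<le> K" "card S * L \<le> K" and S: "finite S" "\<And>b. Up b \<subseteq> S"
  shows "\<exists>W'\<subseteq>W. \<exists>E'\<subseteq>E. inv W' E' (c + real (Suc m)) \<and> pruned W' E' \<and>
    placeable le T W' S (\<lambda>b'. if b' = b then Up b else {}) i (j + Suc m)"
  using i
proof (induction m arbitrary: i)
  case 0
  then show ?case using placeable_step[OF I pl _ _ _ K S, of b i] by auto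
next
  case (Suc m)
  define l where "l = (if b then Suc i else i - 1)"
  have l: "if b then i' = l + Suc m else l = i' + Suc m" "l \<in> {1..k}" "if b then l = Suc i else i = Suc l"
    using Suc.prems by (auto simp: l_def split: if_splits)
  let ?Up = "\<lambda>b'. if b' = b then Up b else {}"
  from Suc.IH[OF l(1,2) Suc.prems(3)] obtain W1 E1 where 1: "W1 \<subseteq> W" "E1 \<subseteq> E"
    "inv W1 E1 (c + real (Suc m))" "placeable le T W1 S ?Up l (j + Suc m)" by auto
  have "?Up b' \<subseteq> S" for b' using S by simp
  from placeable_step[OF 1(3,4) l(3) Suc.prems(2) l(2) K S(1) this]
  obtain W2 E2 where 2: "W2 \<subseteq> W1" "E2 \<subseteq> E1" "inv W2 E2 (c + real (Suc m) + 1)" "pruned W2 E2"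
    "placeable le T W2 S (\<lambda>b'. if b' = b then ?Up b else {}) i (Suc (j + Suc m))" by auto
  have I2: "inv W2 E2 (c + real (Suc (Suc m)))" using 2(3) by (simp add: algebra_simps)
  have "(\<lambda>b'. if b' = b then ?Up b else {}) = ?Up" by (rule ext) simp
  moreover have "Suc (j + Suc m) = j + Suc (Suc m)" by simp
  ultimately have "placeable le T W2 S ?Up i (j + Suc (Suc m))" using 2(5) by metis
  then show ?case using 1 2 I2 by (intro exI[of _ W2] conjI exI[of _ E2]) auto
qed

text \<open>Cut an edge from \<open>q\<close> to \<open>q'\<close>, place both parts, carry the
  second root from layer \<open>ht q'\<close> to layer \<open>ht q\<close>, and merge. Heights lie
  between 1 and \<open>k\<close>, so an edge costs at most \<open>k\<close> moves, whence
  \<open>k * (card S - 1)\<close> for both the error index and the growth of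
  \<open>c\<close>.\<close>

lemma tree_placeable:
  fixes A :: "'a set"
  assumes po: "finite_poset A le" and ht: "\<And>x. x \<in> A \<Longrightarrow> ht A le x \<in> {1..k}"
    and T: "T = k * card A" and K: "2 * T * L \<le> K" "card A * L \<le> K"
  shows "ptree A le S Es \<Longrightarrow> q \<in> S \<Longrightarrow> inv W E c \<Longrightarrow> pruned W E \<Longrightarrow>
    \<exists>W'\<subseteq>W. \<exists>E'\<subseteq>E. inv W' E' (c + real (k * (card S - 1))) \<and> pruned W' E' \<and>
      placeable le T W' S (\<lambda>b. {s \<in> S. dle le b q s}) (ht A le q) (k * (card S - 1))"
proof (induction "card S" arbitrary: S Es q W E c rule: less_induct)
  case less
  note finA = finite_poset_finite[OF po]
  have SA: "S \<subseteq> A" using less.prems(1) by (simp add: ptree_def)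
  have fS: "finite S" using SA finA by (rule finite_subset)
  have qA: "q \<in> A" using less.prems(2) SA by auto
  have lq: "dle le b q q" for b using le_refl[OF po qA] by (simp add: dle_def)
  show ?case
  proof (cases "S = {q}")
    case True
    have "placeable le T W S (\<lambda>b. {s \<in> S. dle le b q s}) (ht A le q) (k * (card S - 1))"
      unfolding placeable_def
    proof (intro allI impI)
      have U: "(\<lambda>b. {s \<in> S. dle le b q s}) = (\<lambda>b. {q})" using True lq by auto
      fix x assume "(ht A le q, x) \<in> W"
      then have "x \<in> F" using invD(1)[OF less.prems(3)] V0D by fastforce
      from placement_mono[OF placement_singleton[of x le q T, OF this], of "k * (card S - 1)"]
      show "\<exists>p. placement le T S (\<lambda>b. {s \<in> S. dle le b q s}) (k * (card S - 1)) x p"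
        using True le_refl[OF po qA] U by auto
    qed
    moreover have "inv W E (c + real (k * (card S - 1)))" using less.prems(3) by (rule inv_mono) simp
    ultimately show ?thesis using less.prems(4) by blast
  next
    case False
    show ?thesis
    proof (rule ptree_split[OF po less.prems(1,2) False])
      fix b q' S1 S2 Es1 Es2
      assume sp: "S = S1 \<union> S2" "S1 \<inter> S2 = {}" "q \<in> S1" "q' \<in> S2"
        and t1: "ptree A le S1 Es1" and t2: "ptree A le S2 Es2" and qq: "dle le b q q'" "q \<noteq> q'"
        and o12: "\<And>x y. x \<in> S1 \<Longrightarrow> y \<in> S2 \<Longrightarrow> dle le b x y \<longleftrightarrow> dle le b x q \<and> dle le b q' y"
        and o21: "\<And>x y. x \<in> S1 \<Longrightarrow> y \<in> S2 \<Longrightarrow> \<not> dle le b y x"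
      have f12: "finite S1" "finite S2" using fS sp by auto
      have cS: "card S = card S1 + card S2" using sp f12 by (simp add: card_Un_disjoint)
      have c0: "card S1 > 0" "card S2 > 0" using sp f12 by (auto simp: card_gt_0_iff)
      have cA: "card S \<le> card A" using SA finA by (simp add: card_mono)
      have q'A: "q' \<in> A" using sp SA by auto
      let ?U1 = "\<lambda>b. {s \<in> S1. dle le b q s}" and ?U2 = "\<lambda>b. {s \<in> S2. dle le b q' s}"
      have "card S1 < card S" "card S2 < card S" using cS c0 by auto
      from less.hyps[OF this(1) t1 sp(3) less.prems(3,4)]
      obtain W1 E1 where 1: "W1 \<subseteq> W" "E1 \<subseteq> E" "inv W1 E1 (c + real (k * (card S1 - 1)))" "pruned W1 E1"
        "placeable le T W1 S1 ?U1 (ht A le q) (k * (card S1 - 1))" by auto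
      from less.hyps[OF \<open>card S2 < card S\<close> t2 sp(4) 1(3,4)]
      obtain W2 E2 where 2: "W2 \<subseteq> W1" "E2 \<subseteq> E1" "inv W2 E2 (c + real (k * (card S1 - 1)) + real (k * (card S2 - 1)))"
        "placeable le T W2 S2 ?U2 (ht A le q') (k * (card S2 - 1))" by auto
      let ?h = "ht A le"
      define m where "m = (if b then ?h q' - ?h q else ?h q - ?h q') - 1"
      have hk: "?h q \<in> {1..k}" "?h q' \<in> {1..k}" using ht qA q'A by auto
      have hl: "if b then ?h q < ?h q' else ?h q' < ?h q"
        using ht_less[OF po qA q'A] ht_less[OF po q'A qA] qq by (auto simp: dle_def)
      have m: "if b then ?h q' = ?h q + Suc m else ?h q = ?h q' + Suc m" and mk: "Suc m \<le> k"
        using hl hk by (auto simp: m_def split: if_splits)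
      have K2: "card S2 * L \<le> K" 
      proof -
        have "card S2 \<le> card A" using cS cA by linarith
        then show ?thesis using K(2) mult_le_mono1[of "card S2" "card A" L] by linarith
      qed
      have j0: "k * (card S2 - 1) + Suc m + k * (card S1 - 1) \<le> k * (card S - 1)"
      proof -
        have "card S - 1 = (card S1 - 1) + (card S2 - 1) + 1" using cS c0 by simp
        then have "k * (card S - 1) = k * (card S1 - 1) + k * (card S2 - 1) + k" by (simp add: algebra_simps)
        then show ?thesis using mk by simp
      qed
      have U2S: "?U2 b' \<subseteq> S2" for b' by auto
      from placeable_steps[OF 2(3,4) m hk K(1) K2 f12(2) U2S]
      obtain W3 E3 where 3: "W3 \<subseteq> W2" "E3 \<subseteq> E2" "pruned W3 E3"
        "inv W3 E3 (c + real (k * (card S1 - 1)) + real (k * (card S2 - 1)) + real (Suc m))"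
        "placeable le T W3 S2 (\<lambda>b'. if b' = b then ?U2 b else {}) (?h q) (k * (card S2 - 1) + Suc m)"
        by auto
      have "inv W3 E3 (c + real (k * (card S - 1)))"
        by (rule inv_mono[OF 3(4)]) (use j0 in linarith)
      moreover have "placeable le T W3 S (\<lambda>b. {s \<in> S. dle le b q s}) (?h q) (k * (card S - 1))"
        unfolding placeable_def
      proof (intro allI impI)
        fix x assume x: "(?h q, x) \<in> W3"
        let ?j = "k * (card S - 1)"
        let ?U3 = "\<lambda>b'. if b' = b then ?U2 b else {}"
        have "(?h q, x) \<in> W1" using x 3(1) 2(1) by auto
        then obtain p1 where p1: "placement le T S1 ?U1 ?j x p1"
          using 1(5) placement_mono j0 unfolding placeable_def by (meson add_leD2)
        obtain p2 where p2: "placement le T S2 ?U3 ?j x p2"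
          using 3(5) x placement_mono j0 unfolding placeable_def by (meson add_leD1)
        have xF: "x \<in> F" using x invD(1)[OF 3(4)] V0D by fastforce
        have jT: "?j \<le> T" unfolding T using cA by (intro mult_le_mono2) simp
        have "\<exists>p. placement le T (S1 \<union> S2) (\<lambda>b. ?U1 b \<union> ?U3 b) ?j x p"
        proof (rule placement_merge[OF p1 p2 jT sp(2) _ _ xF])
          show "?U1 b' \<subseteq> S1" "?U3 b' \<subseteq> S2" for b' by auto
          show "le r s \<longleftrightarrow> r \<in> ?U1 False \<and> s \<in> ?U3 True" if "r \<in> S1" "s \<in> S2" for r s
            using o12[OF that] o21[OF that] that by (cases b) (auto simp: dle_def)
          show "le r s \<longleftrightarrow> r \<in> ?U3 False \<and> s \<in> ?U1 True" if "r \<in> S2" "s \<in> S1" for r s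
            using o12[OF that(2,1)] o21[OF that(2,1)] that by (cases b) (auto simp: dle_def)
        qed
        \<comment> \<open>An element of the second part is comparable with \<open>q\<close> only
          through \<open>q'\<close>, hence only in direction \<open>b\<close>. This matches the
          lists left by moving the root, which are empty in the opposite direction.\<close>
        moreover have "(\<lambda>b. ?U1 b \<union> ?U3 b) = (\<lambda>b. {s \<in> S. dle le b q s})"
        proof
          fix b'
          have "s \<in> ?U3 b' \<longleftrightarrow> dle le b' q s" if "s \<in> S2" for s
            using o12[OF sp(3) that] o21[OF sp(3) that] that lq by (cases b; cases b') (auto simp: dle_def)
          moreover have "?U3 b' \<subseteq> S2" by auto
          ultimately show "?U1 b' \<union> ?U3 b' = {s \<in> S. dle le b' q s}" using sp(1) by blast
        qed
        ultimately show "\<exists>p. placement le T S (\<lambda>b. {s \<in> S. dle le b q s}) ?j x p" using sp(1) by simp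
      qed
      ultimately show ?thesis using 1 2 3 by (intro exI[of _ W3] conjI exI[of _ E3]) auto
    qed
  qed
qed

text \<open>In a pruned graph a vertex has neighbours in each adjacent layer, so survivors spread
  from any layer to the layer in which the root of the poset belongs.\<close>

lemma pruned_level:
  assumes I: "inv W E c" and P: "pruned W E" and i: "(i, x) \<in> W" and l: "l \<in> {1..k}"
  shows "\<exists>y. (l, y) \<in> W"
proof -
  note W = invD[OF I]
  have nx: "\<exists>y. (if b then Suc i else i - 1, y) \<in> W" if v: "(i, x) \<in> W" "inner_level b (i, x)" for b i x
  proof -
    have "\<exists>Y \<subseteq> snd ` nbr E b (i, x). spread b (snd (i, x)) Y"
      by (rule P[unfolded pruned_def, rule_format, OF v])
    then have "nbr E b (i, x) \<noteq> {}" by (auto simp: spread_def)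
    then obtain u where "u \<in> nbr E b (i, x)" by blast
    then have "u \<in> nbr E0 b (i, x)" "u \<in> W" using W(2) by (auto simp: nbr_def split: if_splits)
    then show ?thesis by (cases u) (auto simp: nbr_E0 split: if_splits)
  qed
  have ik: "i \<in> {1..k}" using i W by (auto simp: V0_def)
  show ?thesis
  proof (cases "i \<le> l")
    case True
    from this l show ?thesis
    proof (induction l rule: dec_induct)
      case base then show ?case using i by blast
    next
      case (step m)
      then obtain y where "(m, y) \<in> W" using ik by auto
      from nx[OF this, of True] show ?case using step.prems by (auto simp: inner_level_def)
    qed
  next
    case False
    then have "l \<le> i" by simp
    from this l show ?thesis
    proof (induction l rule: inc_induct)
      case base then show ?case using i by blast
    next
      case (step m)
      then obtain y where "(Suc m, y) \<in> W" using ik by auto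
      from nx[OF this, of False] show ?case using step.prems by (auto simp: inner_level_def)
    qed
  qed
qed

lemma marked_decomposition:
  fixes A :: "'a set"
  assumes tree: "tree_poset A le" and k: "poset_height A le = k" and free: "induced_free A le F"
    and T: "T = k * card A" and K: "2 * T * L \<le> K" "card A * L \<le> K"
    and small: "(real T + 1) * \<sigma> * real (card A) ^ 2 < 1"
  shows "\<exists>Fi. F = (\<Union>i\<in>{1..<k}. Fi i) \<and> (\<forall>i\<in>{1..<k}. marked n \<theta> L (real T + 1) (Fi i))"
proof -
  have po: "finite_poset A le" and ne: "A \<noteq> {}" using tree by (auto simp: tree_poset_def)
  note finA = finite_poset_finite[OF po]
  obtain q where q: "q \<in> A" using ne by auto
  have ht: "ht A le x \<in> {1..k}" if "x \<in> A" for x using ht_bounds[OF po that] k by simp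
  have k1: "1 \<le> k" using ht[OF q] by simp
  from prune[OF inv_init] obtain W0 Ed where 0: "inv W0 Ed 0" "pruned W0 Ed" by blast
  from tree_placeable[OF po ht T K ptree_whole[OF po tree] q 0]
  obtain W E where W: "inv W E (0 + real (k * (card A - 1)))" "pruned W E"
    and pl: "placeable le T W A (\<lambda>b. {s \<in> A. dle le b q s}) (ht A le q) (k * (card A - 1))" by auto
  have jT: "k * (card A - 1) \<le> T" unfolding T by simp
  show ?thesis
  proof (cases "W = {}")
    case True
    have "0 + real (k * (card A - 1)) \<le> real T" using jT by linarith
    from inv_mono[OF W(1) this] have "inv {} E (real T)" using True by simp
    from inv_empty[OF this k1] show ?thesis .
  next
    case False
    then obtain i x where "(i, x) \<in> W" by auto
    from pruned_level[OF W this ht[OF q]] obtain y where "(ht A le q, y) \<in> W" ..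
    then obtain p where "placement le T A (\<lambda>b. {s \<in> A. dle le b q s}) (k * (card A - 1)) y p"
      using pl unfolding placeable_def by blast
    from placement_mono[OF this jT] have p: "placement le T A (\<lambda>b. {s \<in> A. dle le b q s}) T y p" .
    \<comment> \<open>Union bound over all ordered pairs that must not be contained in one another.
      An outcome avoiding these events is automatically injective: equal images would be contained
      in each other both ways.\<close>
    let ?I = "{(r, s) \<in> A \<times> A. \<not> le r s}"
    have fI: "finite ?I" using finA by (intro finite_subset[of ?I "A \<times> A"]) auto
    have cI: "card ?I \<le> card A ^ 2"
      using card_mono[of "A \<times> A" ?I] finA by (simp add: card_cartesian_product power2_eq_square) auto
    let ?X = "\<lambda>(r, s). {\<phi>. \<phi> r \<subseteq> \<phi> s}"
    have "prob p (\<Union>e\<in>?I. ?X e) \<le> (\<Sum>e\<in>?I. prob p (?X e))"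
      by (rule measure_pmf.finite_measure_subadditive_finite[OF fI]) auto
    also have "\<dots> \<le> (\<Sum>e\<in>?I. (real T + 1) * \<sigma>)"
      using placementD(6)[OF p] by (intro sum_mono) auto
    also have "\<dots> = (real T + 1) * \<sigma> * real (card ?I)" by simp
    also have "\<dots> \<le> (real T + 1) * \<sigma> * real (card A) ^ 2"
      using cI \<sigma> by (intro mult_left_mono) (auto simp flip: of_nat_power)
    also note small
    finally have lt: "prob p (\<Union>e\<in>?I. ?X e) < 1" .
    have "\<not> set_pmf p \<subseteq> (\<Union>e\<in>?I. ?X e)"
    proof
      assume "set_pmf p \<subseteq> (\<Union>e\<in>?I. ?X e)"
      then have "prob p (\<Union>e\<in>?I. ?X e) = 1"
        by (subst measure_pmf.prob_eq_1) (simp, unfold AE_measure_pmf_iff, blast)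
      with lt show False by simp
    qed
    then obtain \<phi> where \<phi>: "\<phi> \<in> set_pmf p" "\<phi> \<notin> (\<Union>e\<in>?I. ?X e)" by blast
    have iff: "\<phi> r \<subseteq> \<phi> s \<longleftrightarrow> le r s" if "r \<in> A" "s \<in> A" for r s
      using \<phi>(2) that placementD(4)[OF p \<phi>(1) that] by auto
    have inj: "inj_on \<phi> A"
    proof (rule inj_onI)
      fix r s assume rs: "r \<in> A" "s \<in> A" "\<phi> r = \<phi> s"
      then have "le r s" "le s r" using iff[of r s] iff[of s r] by auto
      then show "r = s" using le_antisym[OF po] rs by blast
    qed
    have "\<phi> ` A \<subseteq> F" using placementD(1)[OF p \<phi>(1)] by auto
    moreover have "\<phi> r \<subset> \<phi> s \<longleftrightarrow> pless le r s" if "r \<in> A" "s \<in> A" for r s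
      using iff[OF that] inj that by (auto simp: psubset_eq pless_def inj_on_def)
    ultimately have "has_induced_copy A le F"
      unfolding has_induced_copy_def using inj by (intro exI[of _ \<phi>]) simp
    then show ?thesis using free by (simp add: induced_free_def)
  qed
qed

end

section \<open>Containers for families with few comparabilities\<close>

lemma card_dif_level: "beyond b x y \<Longrightarrow> finite x \<Longrightarrow> finite y \<Longrightarrow>
  card (dif b x y) = (if b then card y - card x else card x - card y)"
  by (auto simp: beyond_def dif_def card_Diff_subset finite_subset)

text \<open>\<open>cwt\<close> is the reciprocal of the number of sets at the given distance, so the
  weights at distance \<open>d\<close> add up to at most the density.\<close>

lemma slim_weight:
  assumes sl: "slim n \<theta> L c b x Y" and Y: "finite Y" "\<And>y. y \<in> Y \<Longrightarrow> card (dif b x y) \<in> {1..L}"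
    and c: "c \<ge> 0" "\<And>d. \<theta> d \<ge> 0"
  shows "(\<Sum>y\<in>Y. cwt n b x (card (dif b x y))) \<le> (\<Sum>d=1..L. c * \<theta> d)"
proof -
  have "(\<Sum>y\<in>Y. cwt n b x (card (dif b x y))) =
      (\<Sum>d=1..L. \<Sum>y\<in>(at_dist b x d Y). cwt n b x (card (dif b x y)))"
    using Y by (intro sum.group[symmetric]) auto
  also have "\<dots> \<le> (\<Sum>d=1..L. c * \<theta> d)"
  proof (rule sum_mono)
    fix d assume d: "d \<in> {1..L}"
    let ?C = "sphere_size n b x d"
    have "(\<Sum>y\<in>(at_dist b x d Y). cwt n b x (card (dif b x y))) =
        real (card (at_dist b x d Y)) / ?C" by (simp add: cwt_def)
    also have "\<dots> \<le> (c * \<theta> d * ?C) / ?C"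
      using sl d by (intro divide_right_mono) (auto simp: slim_def)
    also have "\<dots> \<le> c * \<theta> d" using c by simp
    finally show "(\<Sum>y\<in>(at_dist b x d Y). cwt n b x (card (dif b x y))) \<le> c * \<theta> d" .
  qed
  finally show ?thesis .
qed

definition narrow :: "nat \<Rightarrow> nat \<Rightarrow> nat set set \<Rightarrow> bool" where
  "narrow n L G \<longleftrightarrow> G \<subseteq> Pow {..<n} \<and> (\<forall>x\<in>G. \<forall>y\<in>G. x \<subset> y \<longrightarrow> card (y - x) \<le> L)"

lemma narrow_mono: "narrow n L G \<Longrightarrow> G' \<subseteq> G \<Longrightarrow> narrow n L G'"
  unfolding narrow_def by (meson subsetD subset_trans)

lemma narrow_finite: "narrow n L G \<Longrightarrow> finite G"
  unfolding narrow_def by (auto intro: finite_subset)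

lemma narrow_dif:
  assumes "narrow n L G" "x \<in> G" "y \<in> G" "beyond b x y"
  shows "card (dif b x y) \<in> {1..L}" "finite x" "finite y" "x \<subseteq> {..<n}" "y \<subseteq> {..<n}"
proof -
  show *: "x \<subseteq> {..<n}" "y \<subseteq> {..<n}" using assms by (auto simp: narrow_def)
  then show "finite x" "finite y" by (auto intro: finite_subset)
  have "card (dif b x y) \<le> L" using assms by (auto simp: narrow_def beyond_def dif_def split: if_splits)
  then show "card (dif b x y) \<in> {1..L}" using dif_beyond(3)[OF assms(4) *] by simp
qed

text \<open>Take the marked sets as partners. Of two members of \<open>G\<close> on one chain, one
  holds a mark for the other, so at most one is lonely; the marks weigh at most 1/4 in each
  direction.\<close>

lemma marked_weight:
  assumes G: "narrow n L G" and m: "marked n \<theta> L c G" and c: "c \<ge> 0" "\<And>d. \<theta> d \<ge> 0"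
    and small: "(\<Sum>d=1..L. c * \<theta> d) \<le> 1 / 4"
  shows "(\<Sum>x\<in>G. wt n x) \<le> 2"
proof -
  from m obtain U where
    U0: "\<forall>x\<in>G. \<forall>b. U b x \<subseteq> {y \<in> G. beyond b x y} \<and> slim n \<theta> L c b x (U b x)"
    and mk0: "\<forall>x\<in>G. \<forall>y\<in>G. x \<subset> y \<longrightarrow> y \<in> U True x \<or> x \<in> U False y"
    unfolding marked_def by (elim exE conjE)
  have U: "U b x \<subseteq> {y \<in> G. beyond b x y} \<and> slim n \<theta> L c b x (U b x)" if "x \<in> G" for x b
    using U0 that by simp
  have mk: "y \<in> U True x \<or> x \<in> U False y" if "x \<in> G" "y \<in> G" "x \<subset> y" for x y
    using mk0 that by simp
  note finG = narrow_finite[OF G]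
  have "(1 - 1/2) * (\<Sum>x\<in>G. wt n x) \<le> real 1"
  proof (rule chain_partner_bound)
    show "G \<subseteq> Pow {..<n}" using G by (simp add: narrow_def)
    show "y \<in> G \<and> beyond b x y" if "x \<in> G" "y \<in> U b x" for b x y using U that by blast
    show "(\<Sum>b\<in>UNIV. \<Sum>y\<in>U b x. cwt n b x (card (dif b x y))) \<le> 1/2" if x: "x \<in> G" for x
    proof -
      have "(\<Sum>y\<in>U b x. cwt n b x (card (dif b x y))) \<le> 1 / 4" for b
      proof -
        have "(\<Sum>y\<in>U b x. cwt n b x (card (dif b x y))) \<le> (\<Sum>d=1..L. c * \<theta> d)"
        proof (rule slim_weight[OF _ _ _ c])
          show "slim n \<theta> L c b x (U b x)" using U x by blast
          show "finite (U b x)" using U[OF x, of b] finG finite_subset[of "U b x" G] by blast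
          show "card (dif b x y) \<in> {1..L}" if "y \<in> U b x" for y
            using narrow_dif(1)[OF G x, of y b] U[OF x, of b] that by blast
        qed
        with small show ?thesis by linarith
      qed
      from this[of True] this[of False] show ?thesis by (simp add: UNIV_bool)
    qed
    fix C assume C: "C \<subseteq> G" "\<And>x y. x \<in> C \<Longrightarrow> y \<in> C \<Longrightarrow> x \<subseteq> y \<or> y \<subseteq> x"
    have "finite {x \<in> C. \<forall>b. U b x \<inter> C = {}}" using C finG finite_subset[of C G] by simp
    moreover have "x = y" if "x \<in> C" "y \<in> C" "\<forall>b. U b x \<inter> C = {}" "\<forall>b. U b y \<inter> C = {}" for x y
    proof (rule ccontr)
      assume "x \<noteq> y"
      then have "x \<subset> y \<or> y \<subset> x" using C(2)[OF that(1,2)] by auto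
      then show False using mk[of x y] mk[of y x] that C(1) by blast
    qed
    ultimately show "card {x \<in> C. \<forall>b. U b x \<inter> C = {}} \<le> 1"
      by (auto simp: card_le_Suc0_iff_eq)
  qed
  then show ?thesis by simp
qed

text \<open>In contrast to \<open>marked\<close>, this bounds all neighbours of \<open>x\<close>
  inside \<open>G\<close> and passes to subfamilies, as the container algorithm needs.\<close>

definition thin :: "nat \<Rightarrow> (nat \<Rightarrow> real) \<Rightarrow> nat \<Rightarrow> nat set set \<Rightarrow> bool" where
  "thin n \<beta> L G \<longleftrightarrow> (\<forall>x\<in>G. \<forall>b. slim n \<beta> L 1 b x {y \<in> G. beyond b x y})"

lemma thin_mono:
  assumes "thin n \<beta> L G" "G' \<subseteq> G" "finite G" "\<And>d. \<beta> d \<ge> 0"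
  shows "thin n \<beta> L G'"
  unfolding thin_def
proof (intro ballI allI)
  fix x b assume "x \<in> G'"
  then have "slim n \<beta> L 1 b x {y \<in> G. beyond b x y}" using assms by (auto simp: thin_def)
  then show "slim n \<beta> L 1 b x {y \<in> G'. beyond b x y}"
    by (rule slim_mono) (use assms in auto)
qed

lemma wt_ge: "1 / central n \<le> wt n x" if "x \<subseteq> {..<n}"
proof -
  have "card x \<le> n" using that by (metis card_lessThan card_mono finite_lessThan)
  then have "0 < n choose card x" by simp
  then show ?thesis unfolding wt_def using binomial_maximum[of n "card x"]
    by (intro divide_left_mono) (auto simp: of_nat_le_iff)
qed

text \<open>A mark of y towards x is controlled only on average over x; the elements x that receive
  too many marks are few and are discarded.\<close>

lemma marked_thin:
  assumes G: "narrow n L G" and m: "marked n \<theta> L c G" and c: "c \<ge> 0" "\<And>d. \<theta> d \<ge> 0"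
    and small: "(\<Sum>d=1..L. c * \<theta> d) \<le> 1 / 4" and \<beta>: "\<And>d. \<beta> d > 0" "\<And>d. 2 * c * \<theta> d \<le> \<beta> d"
  shows "\<exists>B\<subseteq>G. real (card B) \<le> (\<Sum>d=1..L. 8 * c * \<theta> d / \<beta> d) * central n \<and> thin n \<beta> L (G - B)"
proof -
  let ?N = "central n"
  have N: "?N > 0" by simp
  from m obtain U where
    U0: "\<forall>x\<in>G. \<forall>b. U b x \<subseteq> {y \<in> G. beyond b x y} \<and> slim n \<theta> L c b x (U b x)"
    and mk0: "\<forall>x\<in>G. \<forall>y\<in>G. x \<subset> y \<longrightarrow> y \<in> U True x \<or> x \<in> U False y"
    unfolding marked_def by (elim exE conjE)
  have U: "U b x \<subseteq> {y \<in> G. beyond b x y} \<and> slim n \<theta> L c b x (U b x)" if "x \<in> G" for x b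
    using U0 that by simp
  have mk: "y \<in> U True x \<or> x \<in> U False y" if "x \<in> G" "y \<in> G" "x \<subset> y" for x y
    using mk0 that by simp
  note finG = narrow_finite[OF G]
  \<comment> \<open>These are the marks received by \<open>x\<close>, the ones that
    \<open>marked\<close> does not bound.\<close>
  define V where "V b d x = {y \<in> G. x \<in> U (\<not> b) y \<and> card (dif b x y) = d}" for b d x
  define Bd where "Bd b d = {x \<in> G. real (card (V b d x)) > \<beta> d / 2 * sphere_size n b x d}" for b d
  define B where "B = (\<Union>b\<in>UNIV. \<Union>d\<in>{1..L}. Bd b d)"
  have Vb: "y \<in> G \<and> beyond b x y \<and> dif (\<not> b) y x = dif b x y" if "x \<in> G" "y \<in> V b d x" for b d x y
  proof -
    have y: "y \<in> G" "x \<in> U (\<not> b) y" using that by (auto simp: V_def)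
    then have "beyond (\<not> b) y x" using U[of y "\<not> b"] by auto
    then show ?thesis using y by (auto simp: beyond_def dif_def split: if_splits)
  qed
  \<comment> \<open>Weighted double counting: \<open>wt_cwt_sym\<close> turns marks received into
    marks held, which have density at most \<open>c * \<theta> d\<close>. The 4 combines the
    threshold \<open>\<beta> d / 2\<close> with the total weight 2; summing over both directions
    later gives 8.\<close>
  have cardB: "real (card (Bd b d)) \<le> 4 * c * \<theta> d / \<beta> d * ?N" if d: "d \<in> {1..L}" for b d
  proof -
    have "\<beta> d / 2 * (\<Sum>x\<in>Bd b d. wt n x) = (\<Sum>x\<in>Bd b d. wt n x * (\<beta> d / 2))"
      by (simp add: sum_distrib_left mult_ac)
    also have "\<dots> \<le> (\<Sum>x\<in>Bd b d. wt n x * (\<Sum>y\<in>V b d x. cwt n b x d))"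
    proof (intro sum_mono mult_left_mono)
      fix x assume x: "x \<in> Bd b d"
      let ?C = "sphere_size n b x d"
      have xG: "x \<in> G" and big: "real (card (V b d x)) > \<beta> d / 2 * ?C" using x by (auto simp: Bd_def)
      have "0 \<le> \<beta> d / 2 * ?C" using \<beta>(1)[of d] by simp
      then have "card (V b d x) > 0" using big by linarith
      then obtain y where yV: "y \<in> V b d x" by (metis card.empty ex_in_conv less_irrefl)
      then have y: "y \<in> G" "beyond b x y" "card (dif b x y) = d" using Vb[OF xG yV] by (auto simp: V_def)
      have "dif b x y \<subseteq> pool n b x" using dif_beyond(2)[OF y(2) narrow_dif(4,5)[OF G xG y(1,2)]] .
      moreover have "finite (pool n b x)"
        using narrow_dif(2)[OF G xG y(1,2)] by (simp add: pool_def)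
      ultimately have "d \<le> card (pool n b x)" using y(3) by (metis card_mono)
      then have C: "?C > 0" by simp
      have "\<beta> d / 2 = \<beta> d / 2 * ?C / ?C" using C by simp
      also have "\<dots> \<le> real (card (V b d x)) / ?C" using big C by (intro divide_right_mono) auto
      also have "\<dots> = (\<Sum>y\<in>V b d x. cwt n b x d)" by (simp add: cwt_def)
      finally show "\<beta> d / 2 \<le> (\<Sum>y\<in>V b d x. cwt n b x d)" .
    qed (simp add: wt_def)
    also have "\<dots> \<le> (\<Sum>x\<in>G. wt n x * (\<Sum>y\<in>V b d x. cwt n b x d))"
      using finG by (intro sum_mono2) (auto simp: Bd_def wt_def cwt_def)
    also have "\<dots> = (\<Sum>x\<in>G. \<Sum>y\<in>V b d x. wt n y * cwt n (\<not> b) y d)"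
      unfolding sum_distrib_left
    proof (intro sum.cong refl)
      fix x y assume x: "x \<in> G" and y: "y \<in> V b d x"
      have "y \<in> G" "beyond b x y" "card (dif b x y) = d" using Vb[OF x y] y by (auto simp: V_def)
      then show "wt n x * cwt n b x d = wt n y * cwt n (\<not> b) y d"
        using wt_cwt_sym[of b x y n] narrow_dif(4,5)[OF G x, of y b] by auto
    qed
    also have "\<dots> = (\<Sum>(x, y)\<in>(SIGMA x:G. V b d x). wt n y * cwt n (\<not> b) y d)"
      using finG by (subst sum.Sigma) (auto simp: V_def)
    also have "\<dots> = (\<Sum>(y, x)\<in>(SIGMA y:G. {x \<in> U (\<not> b) y. card (dif (\<not> b) y x) = d}). wt n y * cwt n (\<not> b) y d)"
    proof (rule sum.reindex_bij_witness[where i = "\<lambda>(y, x). (x, y)" and j = "\<lambda>(x, y). (y, x)"], goal_cases)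
      case (2 a)
      then obtain x y where a: "a = (x, y)" "x \<in> G" "y \<in> V b d x" by auto
      then show ?case using Vb[OF a(2,3)] by (auto simp: V_def)
    next
      case (4 a)
      then obtain y x where a: "a = (y, x)" "y \<in> G" "x \<in> U (\<not> b) y" "card (dif (\<not> b) y x) = d" by auto
      moreover have "x \<in> G" "beyond (\<not> b) y x" using U[OF a(2), of "\<not> b"] a(3) by auto
      moreover have "dif (\<not> b) y x = dif b x y" by (simp add: dif_def)
      ultimately show ?case by (auto simp: V_def)
    qed auto
    also have "\<dots> = (\<Sum>y\<in>G. \<Sum>x\<in>{x \<in> U (\<not> b) y. card (dif (\<not> b) y x) = d}. wt n y * cwt n (\<not> b) y d)"
    proof (rule sum.Sigma[symmetric])
      show "\<forall>y\<in>G. finite {x \<in> U (\<not> b) y. card (dif (\<not> b) y x) = d}"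
      proof
        fix y assume "y \<in> G"
        then have "U (\<not> b) y \<subseteq> G" using U[of y "\<not> b"] by auto
        then show "finite {x \<in> U (\<not> b) y. card (dif (\<not> b) y x) = d}" using finG finite_subset[of "U (\<not> b) y" G] by simp
      qed
    qed (rule finG)
    also have "\<dots> \<le> (\<Sum>y\<in>G. wt n y * (c * \<theta> d))"
    proof (rule sum_mono)
      fix y assume y: "y \<in> G"
      let ?C = "sphere_size n (\<not> b) y d"
      let ?X = "{x \<in> U (\<not> b) y. card (dif (\<not> b) y x) = d}"
      have "slim n \<theta> L c (\<not> b) y (U (\<not> b) y)" using U[OF y] by blast
      then have "real (card ?X) / ?C \<le> c * \<theta> d * ?C / ?C"
        using d by (intro divide_right_mono) (auto simp: slim_def)
      also have "\<dots> \<le> c * \<theta> d" using c by simp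
      finally have "wt n y * (real (card ?X) / ?C) \<le> wt n y * (c * \<theta> d)"
        by (intro mult_left_mono) (auto simp: wt_def)
      then show "(\<Sum>x\<in>?X. wt n y * cwt n (\<not> b) y d) \<le> wt n y * (c * \<theta> d)"
        by (simp add: cwt_def mult.commute)
    qed
    also have "\<dots> = (c * \<theta> d) * (\<Sum>y\<in>G. wt n y)" by (simp add: sum_distrib_left mult_ac)
    also have "\<dots> \<le> (c * \<theta> d) * 2"
      using marked_weight[OF G m c small] c by (intro mult_left_mono) auto
    finally have 1: "\<beta> d / 2 * (\<Sum>x\<in>Bd b d. wt n x) \<le> c * \<theta> d * 2" .
    have "real (card (Bd b d)) / ?N = (\<Sum>x\<in>Bd b d. 1 / ?N)" by simp
    also have "\<dots> \<le> (\<Sum>x\<in>Bd b d. wt n x)"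
      using G by (intro sum_mono wt_ge) (auto simp: Bd_def narrow_def)
    finally have "\<beta> d / 2 * (real (card (Bd b d)) / ?N) \<le> \<beta> d / 2 * (\<Sum>x\<in>Bd b d. wt n x)"
      using \<beta>(1)[of d] by (intro mult_left_mono) auto
    with 1 have "\<beta> d / 2 * (real (card (Bd b d)) / ?N) \<le> c * \<theta> d * 2" by linarith
    then show ?thesis using \<beta>(1)[of d] N by (simp add: field_simps)
  qed
  have "card B \<le> (\<Sum>b\<in>UNIV. card (\<Union>d\<in>{1..L}. Bd b d))" unfolding B_def by (rule card_UN_le) simp
  also have "\<dots> \<le> (\<Sum>b\<in>UNIV. \<Sum>d=1..L. card (Bd b d))" by (intro sum_mono card_UN_le) simp
  finally have "real (card B) \<le> real (\<Sum>b\<in>(UNIV :: bool set). \<Sum>d=1..L. card (Bd b d))" by (rule of_nat_mono)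
  also have "\<dots> = (\<Sum>b\<in>(UNIV :: bool set). \<Sum>d=1..L. real (card (Bd b d)))" by simp
  also have "\<dots> \<le> (\<Sum>b\<in>(UNIV :: bool set). \<Sum>d=1..L. 4 * c * \<theta> d / \<beta> d * ?N)"
    by (intro sum_mono cardB)
  also have "\<dots> = (\<Sum>d=1..L. 8 * c * \<theta> d / \<beta> d) * ?N"
    by (simp add: UNIV_bool sum_distrib_right sum_distrib_left mult.assoc flip: sum.distrib)
  finally have cB: "real (card B) \<le> (\<Sum>d=1..L. 8 * c * \<theta> d / \<beta> d) * ?N" .
  have "thin n \<beta> L (G - B)"
    unfolding thin_def slim_def
  proof (intro ballI allI)
    fix x b d assume x: "x \<in> G - B" and d: "d \<in> {1..L}"
    let ?C = "sphere_size n b x d"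
    let ?Y = "{y \<in> {y \<in> G - B. beyond b x y}. card (dif b x y) = d}"
    have sub: "?Y \<subseteq> {y \<in> U b x. card (dif b x y) = d} \<union> V b d x"
    proof
      fix y assume y: "y \<in> ?Y"
      then have "y \<in> U b x \<or> x \<in> U (\<not> b) y"
        using mk[of x y] mk[of y x] x by (cases b) (auto simp: beyond_def)
      then show "y \<in> {y \<in> U b x. card (dif b x y) = d} \<union> V b d x" using y by (auto simp: V_def)
    qed
    have fin: "finite ({y \<in> U b x. card (dif b x y) = d} \<union> V b d x)"
    proof (rule finite_subset[OF _ finG])
      have "U b x \<subseteq> G" using U[of x b] x by auto
      then show "{y \<in> U b x. card (dif b x y) = d} \<union> V b d x \<subseteq> G" by (auto simp: V_def)
    qed
    have "card ?Y \<le> card {y \<in> U b x. card (dif b x y) = d} + card (V b d x)"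
      using card_mono[OF fin sub] card_Un_le[of "{y \<in> U b x. card (dif b x y) = d}" "V b d x"] by linarith
    then have "real (card ?Y) \<le> real (card {y \<in> U b x. card (dif b x y) = d}) + real (card (V b d x))"
      by linarith
    also have "\<dots> \<le> c * \<theta> d * ?C + \<beta> d / 2 * ?C"
    proof (rule add_mono)
      show "real (card {y \<in> U b x. card (dif b x y) = d}) \<le> c * \<theta> d * ?C"
        using U[of x b] x d by (auto simp: slim_def)
      show "real (card (V b d x)) \<le> \<beta> d / 2 * ?C" using x d by (auto simp: B_def Bd_def not_less)
    qed
    also have "\<dots> = (c * \<theta> d + \<beta> d / 2) * ?C" by (simp add: algebra_simps)
    also have "\<dots> \<le> 1 * \<beta> d * ?C" using \<beta>(2)[of d] by (intro mult_right_mono) auto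
    finally show "real (card ?Y) \<le> 1 * \<beta> d * ?C" .
  qed
  moreover have "B \<subseteq> G" by (auto simp: B_def Bd_def)
  ultimately show ?thesis using cB by blast
qed

text \<open>Otherwise the pairs farther than \<open>d1\<close> apart are so few that
  \<open>chain_partner_bound\<close> applies to them. If some point of a chain has no partner at
  that range, the chain stays within \<open>d1\<close> levels of it, which leaves at most
  \<open>2 * d1 + 1\<close> points. Excluding short distances is thus paid for by a larger
  \<open>A\<close>.\<close>

lemma supersaturation:
  assumes A: "narrow n L A" and \<alpha>: "\<And>d. \<alpha> d \<ge> 0" and e: "(\<Sum>d=Suc d1..L. 2 * \<alpha> d) \<le> e" "e < 1"
    and big: "real (card A) * (1 - e) > real (2 * d1 + 1) * central n"
  shows "\<exists>x\<in>A. \<exists>b. \<exists>d\<in>{Suc d1..L}.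
    real (card (nbrs_at b x d A)) > \<alpha> d * sphere_size n b x d"
proof (rule ccontr)
  assume no: "\<not> ?thesis"
  let ?N = "central n"
  have N: "?N > 0" by simp
  define \<alpha>' where "\<alpha>' d = (if d \<le> d1 then 0 else \<alpha> d)" for d
  define Z where "Z b x = {y \<in> A. beyond b x y \<and> d1 < card (dif b x y)}" for b x
  note finA = narrow_finite[OF A]
  have ZL: "card (dif b x y) \<in> {1..L}" if "x \<in> A" "y \<in> Z b x" for b x y
    using narrow_dif(1)[OF A that(1), of y b] that by (auto simp: Z_def)
  have sl: "slim n \<alpha>' L 1 b x (Z b x)" if x: "x \<in> A" for b x
    unfolding slim_def
  proof
    fix d assume d: "d \<in> {1..L}"
    show "real (card {y \<in> Z b x. card (dif b x y) = d}) \<le> 1 * \<alpha>' d * sphere_size n b x d"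
    proof (cases "d \<le> d1")
      case True
      then have "{y \<in> Z b x. card (dif b x y) = d} = {}" by (auto simp: Z_def)
      then have "card {y \<in> Z b x. card (dif b x y) = d} = 0" by (simp only: card.empty)
      then show ?thesis using True by (simp add: \<alpha>'_def)
    next
      case False
      then have "{y \<in> Z b x. card (dif b x y) = d} = (nbrs_at b x d A)"
        by (auto simp: Z_def)
      then show ?thesis using no x d False by (auto simp: \<alpha>'_def not_less)
    qed
  qed
  have \<alpha>': "\<alpha>' d \<ge> 0" for d using \<alpha> by (simp add: \<alpha>'_def)
  have s\<alpha>: "(\<Sum>d=1..L. 2 * \<alpha>' d) \<le> e"
  proof -
    have "(\<Sum>d=1..L. 2 * \<alpha>' d) = (\<Sum>d\<in>{Suc d1..L}. 2 * \<alpha>' d)"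
      by (rule sum.mono_neutral_right) (auto simp: \<alpha>'_def)
    also have "\<dots> = (\<Sum>d=Suc d1..L. 2 * \<alpha> d)" by (intro sum.cong) (auto simp: \<alpha>'_def)
    finally show ?thesis using e by simp
  qed
  have "(1 - e) * (\<Sum>x\<in>A. wt n x) \<le> real (2 * d1 + 1)"
  proof (rule chain_partner_bound)
    show "A \<subseteq> Pow {..<n}" using A by (simp add: narrow_def)
    show "y \<in> A \<and> beyond b x y" if "x \<in> A" "y \<in> Z b x" for b x y using that by (simp add: Z_def)
    show "(\<Sum>b\<in>UNIV. \<Sum>y\<in>Z b x. cwt n b x (card (dif b x y))) \<le> e" if x: "x \<in> A" for x
    proof -
      have "(\<Sum>y\<in>Z b x. cwt n b x (card (dif b x y))) \<le> (\<Sum>d=1..L. 1 * \<alpha>' d)" for b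
        by (rule slim_weight[OF sl[OF x]]) (use ZL[OF x] finA \<alpha>' in \<open>auto simp: Z_def\<close>)
      from this[of True] this[of False] s\<alpha> show ?thesis
        by (simp add: UNIV_bool flip: sum_distrib_left)
    qed
    fix C assume C: "C \<subseteq> A" "\<And>x y. x \<in> C \<Longrightarrow> y \<in> C \<Longrightarrow> x \<subseteq> y \<or> y \<subseteq> x"
    have finC: "finite C" using C finA finite_subset[of C A] by simp
    have finx: "finite x" if "x \<in> C" for x
    proof -
      have "x \<subseteq> {..<n}" using that C A by (auto simp: narrow_def)
      then show ?thesis by (rule finite_subset) simp
    qed
    show "card {x \<in> C. \<forall>b. Z b x \<inter> C = {}} \<le> 2 * d1 + 1"
    proof (cases "{x \<in> C. \<forall>b. Z b x \<inter> C = {}} = {}")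
      case False
      then obtain x where x: "x \<in> C" "\<forall>b. Z b x \<inter> C = {}" by auto
      have inj: "inj_on card C"
        using C(2) finx by (intro inj_onI) (metis card_subset_eq)
      have "card ` C \<subseteq> {card x - d1..card x + d1}"
      proof
        fix l assume "l \<in> card ` C"
        then obtain y where y: "y \<in> C" "l = card y" by auto
        show "l \<in> {card x - d1..card x + d1}"
        proof (cases "y = x")
          case False
          then have "beyond True x y \<or> beyond False x y" using C(2)[OF x(1) y(1)] by (auto simp: beyond_def)
          then obtain b where b: "beyond b x y" by blast
          then have "\<not> d1 < card (dif b x y)" using x(2) y C by (auto simp: Z_def)
          moreover have "if b then card x \<le> card y else card y \<le> card x"
            using b finx[OF x(1)] finx[OF y(1)] by (auto simp: beyond_def intro: card_mono)
          ultimately show ?thesis using card_dif_level[OF b] finx x y by (auto split: if_splits)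
        qed (use y in auto)
      qed
      then have "card (card ` C) \<le> card {card x - d1..card x + d1}" by (intro card_mono) auto
      then have "card C \<le> 2 * d1 + 1" using inj by (simp add: card_image)
      moreover have "card {x \<in> C. \<forall>b. Z b x \<inter> C = {}} \<le> card C" using finC by (intro card_mono) auto
      ultimately show ?thesis by linarith
    qed (simp only: card.empty zero_le)
  qed
  moreover have "(\<Sum>x\<in>A. wt n x) \<ge> (\<Sum>x\<in>A. 1 / ?N)"
    using A by (intro sum_mono wt_ge) (auto simp: narrow_def)
  ultimately have "(1 - e) * (real (card A) / ?N) \<le> real (2 * d1 + 1)"
    using e mult_left_mono[of "\<Sum>x\<in>A. 1 / ?N" "\<Sum>x\<in>A. wt n x" "1 - e"] by (simp add: algebra_simps)
  then show False using big N by (simp add: field_simps)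
qed

text \<open>The graph container algorithm: only S determines the container \<open>f S\<close>, while the
  few neighbours of S inside G are recorded in T.\<close>

lemma container:
  fixes M :: "nat set set" and X g C0 t1 t2 :: real
  assumes fin: "finite M" and nn: "g > 0" "t1 \<ge> 0" "t2 \<ge> 0" "C0 \<ge> 0" "\<And>d. \<beta> d \<ge> 0"
    and sup: "\<And>A. A \<subseteq> M \<Longrightarrow> real (card A) > X \<Longrightarrow> \<exists>x\<in>A. \<exists>b. \<exists>d\<in>{1..L}.
      g \<le> real (card (nbrs_at b x d A)) \<and>
      \<beta> d * sphere_size n b x d \<le>
        (if real (card A) \<le> C0 then t2 else t1) * real (card (nbrs_at b x d A))"
  shows "A \<subseteq> M \<Longrightarrow> \<exists>f. (\<forall>S. f S \<subseteq> A \<and> real (card (f S)) \<le> max X 0) \<and>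
    (\<forall>G\<subseteq>A. thin n \<beta> L G \<longrightarrow> (\<exists>S\<subseteq>G. \<exists>T\<subseteq>G. g * real (card S) \<le> real (card A) \<and>
       real (card T) \<le> t1 * real (card A) + t2 * min (real (card A)) C0 \<and> G \<subseteq> f S \<union> S \<union> T))"
proof (induction "card A" arbitrary: A rule: less_induct)
  case less
  have finA: "finite A" using less.prems fin finite_subset by auto
  have pot_nn: "0 \<le> t1 * real (card A) + t2 * min (real (card A)) C0" using nn by simp
  show ?case
  proof (cases "real (card A) > X")
    case False
    have "\<exists>S\<subseteq>G. \<exists>T\<subseteq>G. g * real (card S) \<le> real (card A) \<and>
       real (card T) \<le> t1 * real (card A) + t2 * min (real (card A)) C0 \<and> G \<subseteq> A \<union> S \<union> T" if "G \<subseteq> A" for G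
      using that pot_nn by (intro exI[of _ "{}"]) auto
    then show ?thesis using False by (intro exI[of _ "\<lambda>_. A"]) auto
  next
    case True
    from sup[OF less.prems this] obtain x b d where x: "x \<in> A" and d: "d \<in> {1..L}"
      and Dg: "g \<le> real (card (nbrs_at b x d A))"
      and D\<tau>: "\<beta> d * sphere_size n b x d \<le>
        (if real (card A) \<le> C0 then t2 else t1) * real (card (nbrs_at b x d A))"
      by blast
    define D where "D = (nbrs_at b x d A)"
    have D: "D \<subseteq> A" "x \<notin> D" by (auto simp: D_def beyond_def)
    have finD: "finite D" using D finA finite_subset by auto
    define A1 A2 where "A1 = A - {x}" and "A2 = A - {x} - D"
    have lt1: "card A1 < card A" using x finA unfolding A1_def by (metis card_Diff1_less)
    have cA2: "card A2 + card D + 1 = card A"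
    proof -
      have "A = insert x (A2 \<union> D)" using x D by (auto simp: A2_def)
      moreover have "x \<notin> A2 \<union> D" "A2 \<inter> D = {}" "finite A2" using D finA by (auto simp: A2_def)
      ultimately show ?thesis using finD by (simp add: card_Un_disjoint)
    qed
    have lt2: "card A2 < card A" using cA2 by simp
    have sub: "A1 \<subseteq> M" "A2 \<subseteq> M" using less.prems by (auto simp: A1_def A2_def)
    from less.hyps[OF lt1 sub(1)] obtain f1 where f1: "\<And>S. f1 S \<subseteq> A1 \<and> real (card (f1 S)) \<le> max X 0"
      and g1: "\<And>G. G \<subseteq> A1 \<Longrightarrow> thin n \<beta> L G \<Longrightarrow> \<exists>S\<subseteq>G. \<exists>T\<subseteq>G. g * real (card S) \<le> real (card A1) \<and>
       real (card T) \<le> t1 * real (card A1) + t2 * min (real (card A1)) C0 \<and> G \<subseteq> f1 S \<union> S \<union> T" by blast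
    from less.hyps[OF lt2 sub(2)] obtain f2 where f2: "\<And>S. f2 S \<subseteq> A2 \<and> real (card (f2 S)) \<le> max X 0"
      and g2: "\<And>G. G \<subseteq> A2 \<Longrightarrow> thin n \<beta> L G \<Longrightarrow> \<exists>S\<subseteq>G. \<exists>T\<subseteq>G. g * real (card S) \<le> real (card A2) \<and>
       real (card T) \<le> t1 * real (card A2) + t2 * min (real (card A2)) C0 \<and> G \<subseteq> f2 S \<union> S \<union> T" by blast
    \<comment> \<open>Whether \<open>x\<close> lies in \<open>S\<close> tells which way the
      algorithm went, so the container can be reconstructed from \<open>S\<close> alone.\<close>
    define f where "f S = (if x \<in> S then f2 (S - {x}) else f1 S)" for S
    \<comment> \<open>The bound on \<open>T\<close> is a potential: removing sets releases credit at
      rate at least \<open>t1\<close> while more than \<open>C0\<close> sets remain, and at rate at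
      least \<open>t2\<close> below \<open>C0\<close>, enough to record the members of
      \<open>G\<close> among the deleted neighbours.\<close>
    have pot_mono: "t1 * real p + t2 * min (real p) C0 \<le> t1 * real q + t2 * min (real q) C0" if "p \<le> q" for p q
      using that nn by (intro add_mono mult_left_mono) auto
    have "\<exists>S\<subseteq>G. \<exists>T\<subseteq>G. g * real (card S) \<le> real (card A) \<and>
       real (card T) \<le> t1 * real (card A) + t2 * min (real (card A)) C0 \<and> G \<subseteq> f S \<union> S \<union> T"
      if G: "G \<subseteq> A" "thin n \<beta> L G" for G
    proof (cases "x \<in> G")
      case False
      then have "G \<subseteq> A1" using G by (auto simp: A1_def)
      from g1[OF this G(2)] obtain S T where ST: "S \<subseteq> G" "T \<subseteq> G" "g * real (card S) \<le> real (card A1)"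
        "real (card T) \<le> t1 * real (card A1) + t2 * min (real (card A1)) C0" "G \<subseteq> f1 S \<union> S \<union> T" by blast
      have "f S = f1 S" using False ST by (auto simp: f_def)
      moreover have "real (card T) \<le> t1 * real (card A) + t2 * min (real (card A)) C0"
        using ST(4) pot_mono[OF less_imp_le[OF lt1]] by linarith
      moreover have "g * real (card S) \<le> real (card A)" using ST(3) lt1 by linarith
      ultimately show ?thesis using ST(1,2,5) by (intro exI[of _ S] conjI exI[of _ T]) simp_all
    next
      case True
      have finG: "finite G" using G finA finite_subset by auto
      define G2 where "G2 = G - {x} - D"
      have "G2 \<subseteq> A2" "thin n \<beta> L G2" using G thin_mono[OF G(2) _ finG nn(5), of G2] by (auto simp: G2_def A2_def)
      from g2[OF this] obtain S T where ST: "S \<subseteq> G2" "T \<subseteq> G2" "g * real (card S) \<le> real (card A2)"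
        "real (card T) \<le> t1 * real (card A2) + t2 * min (real (card A2)) C0" "G2 \<subseteq> f2 S \<union> S \<union> T" by blast
      have xS: "x \<notin> S" using ST by (auto simp: G2_def)
      have finS: "finite S" by (rule finite_subset[OF _ finG]) (use ST in \<open>auto simp: G2_def\<close>)
      have "f (insert x S) = f2 S" using xS by (simp add: f_def)
      then have cov: "G \<subseteq> f (insert x S) \<union> insert x S \<union> (T \<union> G \<inter> D)" using ST(5) by (auto simp: G2_def)
      have "g * real (card (insert x S)) = g * real (card S) + g" using xS finS by (simp add: algebra_simps)
      also have "\<dots> \<le> real (card A2) + real (card D)" using ST(3) Dg by (simp add: D_def)
      also have "\<dots> \<le> real (card A)" using cA2 by linarith
      finally have cS: "g * real (card (insert x S)) \<le> real (card A)" .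
      have GD: "real (card (G \<inter> D)) \<le> (if real (card A) \<le> C0 then t2 else t1) * real (card D)"
      proof -
        have eq: "G \<inter> D = {y \<in> {y \<in> G. beyond b x y}. card (dif b x y) = d}" using G by (auto simp: D_def)
        have sl: "slim n \<beta> L 1 b x {y \<in> G. beyond b x y}" using G(2) True by (simp add: thin_def)
        have "real (card (G \<inter> D)) \<le> 1 * \<beta> d * sphere_size n b x d"
          unfolding eq by (rule sl[unfolded slim_def, rule_format, OF d])
        then show ?thesis using D\<tau> unfolding D_def by linarith
      qed
      have "real (card (T \<union> G \<inter> D)) \<le> real (card T) + real (card (G \<inter> D))"
        using card_Un_le[of T "G \<inter> D"] by linarith
      also have "\<dots> \<le> t1 * real (card A) + t2 * min (real (card A)) C0"
      proof (cases "real (card A) \<le> C0")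
        case True
        have "t1 * real (card A2) + t2 * real (card A2) + t2 * real (card D) \<le> t1 * real (card A) + t2 * real (card A)"
        proof -
          have "t2 * (real (card A2) + real (card D)) \<le> t2 * real (card A)"
            using nn cA2 by (intro mult_left_mono) linarith+
          moreover have "t1 * real (card A2) \<le> t1 * real (card A)" using nn lt2 by (intro mult_left_mono) auto
          ultimately show ?thesis by (simp add: algebra_simps)
        qed
        then show ?thesis using True ST(4) GD lt2 by simp
      next
        case False
        have "t1 * (real (card A2) + real (card D)) \<le> t1 * real (card A)"
          using nn cA2 by (intro mult_left_mono) linarith+
        moreover have "t2 * min (real (card A2)) C0 \<le> t2 * min (real (card A)) C0"
          using nn lt2 by (intro mult_left_mono) auto
        ultimately show ?thesis using False ST(4) GD by (simp add: algebra_simps)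
      qed
      finally have cT: "real (card (T \<union> G \<inter> D)) \<le> t1 * real (card A) + t2 * min (real (card A)) C0" .
      have "insert x S \<subseteq> G" "T \<union> G \<inter> D \<subseteq> G" using True ST by (auto simp: G2_def)
      then show ?thesis using cS cT cov by blast
    qed
    moreover have "f S \<subseteq> A \<and> real (card (f S)) \<le> max X 0" for S
      using f1[of S] f2[of "S - {x}"] by (auto simp: f_def A1_def A2_def)
    ultimately show ?thesis by (intro exI[of _ f]) blast
  qed
qed

section \<open>Counting\<close>

lemma sum_Pow_power:
  fixes q :: real
  assumes "finite U"
  shows "(\<Sum>S\<in>Pow U. q ^ card S) = (1 + q) ^ card U"
proof -
  have "(\<Prod>x\<in>U. q + 1) = (\<Sum>S\<in>Pow U. (\<Prod>x\<in>S. q) * (\<Prod>x\<in>U - S. 1))"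
    using assms by (rule prod_add)
  then show ?thesis by (simp add: add.commute)
qed

abbreviation (input) small_subsets :: "nat \<Rightarrow> 'b set \<Rightarrow> 'b set set" where
  "small_subsets m U \<equiv> {S. S \<subseteq> U \<and> card S \<le> m}"

text \<open>Give each subset the weight \<open>q ^ card S\<close>: small subsets weigh at least
  \<open>q ^ m\<close>, while all subsets together weigh \<open>(1 + q) ^ card U\<close>.\<close>

lemma card_small_subsets:
  fixes q :: real
  assumes U: "finite U" and q: "0 < q" "q \<le> 1"
  shows "real (card (small_subsets m U)) \<le> exp (q * real (card U)) * (1 / q) ^ m"
proof -
  let ?S = "(small_subsets m U)"
  have "real (card ?S) * q ^ m = (\<Sum>S\<in>?S. q ^ m)" by simp
  also have "\<dots> \<le> (\<Sum>S\<in>?S. q ^ card S)" using q by (intro sum_mono power_decreasing) auto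
  also have "\<dots> \<le> (\<Sum>S\<in>Pow U. q ^ card S)" using U q by (intro sum_mono2) auto
  also have "\<dots> = (1 + q) ^ card U" using U by (rule sum_Pow_power)
  also have "\<dots> \<le> exp q ^ card U" using q by (intro power_mono exp_ge_add_one_self) auto
  also have "\<dots> = exp (q * real (card U))" by (metis exp_of_nat_mult mult.commute)
  finally show ?thesis using q by (simp add: field_simps)
qed

section \<open>The middle layers and the tails outside them\<close>

lemma cosh_bound:
  fixes t :: real
  assumes "0 \<le> t" "t \<le> 1"
  shows "exp t + exp (- t) \<le> 2 * exp (t\<^sup>2)"
proof -
  have "exp t \<le> 1 + t + t\<^sup>2" using assms by (rule exp_bound)
  moreover have "exp (- t) \<le> 1 - t + t\<^sup>2"
  proof -
    have "1 \<le> (1 - t + t\<^sup>2) * (1 + t)" using assms by (simp add: algebra_simps power2_eq_square)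
    also have "\<dots> \<le> (1 - t + t\<^sup>2) * exp t"
      using assms exp_ge_add_one_self[of t] by (intro mult_left_mono) auto
    finally show ?thesis by (simp add: exp_minus field_simps)
  qed
  moreover have "1 + t\<^sup>2 \<le> exp (t\<^sup>2)" by (rule exp_ge_add_one_self)
  ultimately show ?thesis by linarith
qed

text \<open>Sizes within \<open>L / 2\<close> of \<open>n / 2\<close>, so that the full width of the
  window, and hence the distance of comparable members, is at most \<open>L\<close>.\<close>

definition middle :: "nat \<Rightarrow> nat \<Rightarrow> nat set set" where
  "middle n L = {x. x \<subseteq> {..<n} \<and> n \<le> 2 * card x + L \<and> 2 * card x \<le> n + L}"

text \<open>A Chernoff bound with free parameter \<open>t\<close>; the sign \<open>s\<close> in the
  proof selects the upper or the lower tail.\<close>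

lemma card_tail:
  fixes t :: real
  assumes t: "0 \<le> t" "t \<le> 1"
  shows "real (card (Pow {..<n} - middle n L)) \<le> 2 * (2 ^ n * exp (real n * t\<^sup>2 - t * real L))"
proof -
  have half: "real (card {x \<in> Pow {..<n}. s * (2 * real (card x) - real n) \<ge> real L}) \<le> 2 ^ n * exp (real n * t\<^sup>2 - t * real L)"
    if s: "s = 1 \<or> s = -1" for s :: real
  proof -
    let ?T = "{x \<in> Pow {..<n}. s * (2 * real (card x) - real n) \<ge> real L}"
    have "real (card ?T) = (\<Sum>x\<in>?T. 1)" by simp
    also have "\<dots> \<le> (\<Sum>x\<in>?T. exp (t * (s * (2 * real (card x) - real n) - real L)))"
      using t by (intro sum_mono) auto
    also have "\<dots> \<le> (\<Sum>x\<in>Pow {..<n}. exp (t * (s * (2 * real (card x) - real n) - real L)))"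
      by (intro sum_mono2) auto
    also have "\<dots> = (\<Sum>x\<in>Pow {..<n}. exp (- t * s * real n - t * real L) * exp (2 * t * s) ^ card x)"
      by (intro sum.cong refl) (simp add: algebra_simps flip: exp_of_nat_mult exp_add)
    also have "\<dots> = exp (- t * s * real n - t * real L) * (1 + exp (2 * t * s)) ^ n"
      by (simp add: sum_Pow_power flip: sum_distrib_left)
    also have "exp (- t * s * real n - t * real L) = exp (- t * real L) * exp (- t * s) ^ n"
      by (simp add: exp_of_nat_mult[symmetric] exp_add[symmetric] algebra_simps)
    also have "\<dots> * (1 + exp (2 * t * s)) ^ n = exp (- t * real L) * (exp (- t * s) * (1 + exp (2 * t * s))) ^ n"
      by (simp only: power_mult_distrib mult.assoc)
    also have "exp (- t * s) * (1 + exp (2 * t * s)) = exp t + exp (- t)"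
      using s by (auto simp: algebra_simps simp flip: exp_add)
    also have "exp (- t * real L) * (exp t + exp (- t)) ^ n \<le> exp (- t * real L) * (2 * exp (t\<^sup>2)) ^ n"
      using cosh_bound[OF t] by (intro mult_left_mono power_mono) (auto intro: add_nonneg_nonneg)
    also have "\<dots> = 2 ^ n * exp (real n * t\<^sup>2 - t * real L)"
      by (simp add: power_mult_distrib exp_diff exp_minus field_simps flip: exp_of_nat_mult)
    finally show ?thesis .
  qed
  have "Pow {..<n} - middle n L \<subseteq> {x \<in> Pow {..<n}. 1 * (2 * real (card x) - real n) \<ge> real L} \<union>
      {x \<in> Pow {..<n}. -1 * (2 * real (card x) - real n) \<ge> real L}"
    by (auto simp: middle_def)
  then have "card (Pow {..<n} - middle n L) \<le> card ({x \<in> Pow {..<n}. 1 * (2 * real (card x) - real n) \<ge> real L} \<union>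
      {x \<in> Pow {..<n}. -1 * (2 * real (card x) - real n) \<ge> real L})"
    by (intro card_mono) auto
  also have "\<dots> \<le> card {x \<in> Pow {..<n}. 1 * (2 * real (card x) - real n) \<ge> real L} +
      card {x \<in> Pow {..<n}. -1 * (2 * real (card x) - real n) \<ge> real L}" by (rule card_Un_le)
  finally show ?thesis using half[of 1] half[of "-1"] by linarith
qed

lemma narrow_middle: "narrow n L (middle n L)"
  unfolding narrow_def
proof (intro conjI ballI impI)
  fix x y assume xy: "x \<in> middle n L" "y \<in> middle n L" "x \<subset> y"
  then have "finite x" by (auto simp: middle_def intro: finite_subset)
  then have "card (y - x) = card y - card x" using xy by (intro card_Diff_subset) auto
  then show "card (y - x) \<le> L" using xy by (auto simp: middle_def)
qed (auto simp: middle_def)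

lemma card_pool_middle:
  assumes "x \<in> middle n L"
  shows "n \<le> 2 * card (pool n b x) + L"
proof -
  have x: "x \<subseteq> {..<n}" using assms by (simp add: middle_def)
  then have "card ({..<n} - x) = n - card x" by (subst card_Diff_subset) (auto intro: finite_subset)
  moreover have "card x \<le> n" using x by (metis card_lessThan card_mono finite_lessThan)
  ultimately show ?thesis using assms by (auto simp: middle_def pool_def)
qed

lemma card_middle: "real (card (middle n L)) \<le> (real L + 1) * central n"
proof -
  let ?N = "central n"
  have fin: "finite (middle n L)" using narrow_middle by (rule narrow_finite)
  have sub: "card ` middle n L \<subseteq> {(n - L + 1) div 2..(n + L) div 2}"
    by (auto simp: middle_def)
  have "card (middle n L) = (\<Sum>l\<in>card ` middle n L. card {x \<in> middle n L. card x = l})"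
    using fin sum.group[of "middle n L" "card ` middle n L" card "\<lambda>_. 1 :: nat"] by simp
  also have "\<dots> \<le> (\<Sum>l\<in>card ` middle n L. n choose (n div 2))"
  proof (rule sum_mono)
    fix l
    have "card {x \<in> middle n L. card x = l} \<le> card {x. x \<subseteq> {..<n} \<and> card x = l}"
      by (intro card_mono) (auto simp: middle_def)
    also have "\<dots> = n choose l" by (simp add: n_subsets)
    also have "\<dots> \<le> n choose (n div 2)" by (rule binomial_maximum)
    finally show "card {x \<in> middle n L. card x = l} \<le> n choose (n div 2)" .
  qed
  also have "\<dots> = card (card ` middle n L) * (n choose (n div 2))" by simp
  also have "\<dots> \<le> (L + 1) * (n choose (n div 2))"
  proof (rule mult_right_mono)
    have "card (card ` middle n L) \<le> card {(n - L + 1) div 2..(n + L) div 2}" by (intro card_mono sub) simp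
    also have "\<dots> \<le> L + 1" by simp
    finally show "card (card ` middle n L) \<le> L + 1" .
  qed simp
  finally have "real (card (middle n L)) \<le> real ((L + 1) * (n choose (n div 2)))" by (rule of_nat_mono)
  then show ?thesis by (simp add: algebra_simps)
qed

lemma two_power_le: "2 ^ n \<le> (real n + 1) * central n"
proof -
  have "(2 :: nat) ^ n = (\<Sum>k\<le>n. n choose k)" by (simp add: choose_row_sum)
  also have "\<dots> \<le> (\<Sum>k\<le>n. n choose (n div 2))" by (intro sum_mono binomial_maximum)
  finally have "real (2 ^ n) \<le> real ((n + 1) * (n choose (n div 2)))" by (intro of_nat_mono) simp
  then show ?thesis by (simp add: algebra_simps)
qed

text \<open>\<open>G\<close> is recovered from the triple \<open>S\<close>,
  \<open>G \<inter> f S\<close>, \<open>Y\<close>. Two coordinates are small families, hence the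
  square, and the third is a subset of a container.\<close>

lemma count_coverable:
  fixes \<F> :: "'b set set" and f :: "'b set \<Rightarrow> 'b set"
  assumes U: "finite U" and X: "0 \<le> X" "\<And>S. f S \<subseteq> U \<and> real (card (f S)) \<le> X"
    and cover: "\<And>G. G \<in> \<F> \<Longrightarrow> \<exists>S Y. S \<subseteq> U \<and> card S \<le> m \<and> Y \<subseteq> G \<and> Y \<subseteq> U \<and> card Y \<le> m \<and> G \<subseteq> f S \<union> Y"
  shows "real (card \<F>) \<le> (real (card (small_subsets m U)))\<^sup>2 * 2 powr X"
proof -
  let ?Sm = "(small_subsets m U)"
  let ?D = "SIGMA S:?Sm. Pow (f S) \<times> ?Sm"
  have finSm: "finite ?Sm" using U by auto
  have finf: "finite (f S)" for S using X(2)[of S] U finite_subset[of "f S" U] by simp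
  have finD: "finite ?D" using finSm finf by (intro finite_SigmaI) simp_all
  have "\<F> \<subseteq> (\<lambda>(S, H, Y). H \<union> Y) ` ?D"
  proof
    fix G assume "G \<in> \<F>"
    from cover[OF this] obtain S Y where SY: "S \<subseteq> U" "card S \<le> m" "Y \<subseteq> G" "Y \<subseteq> U" "card Y \<le> m" "G \<subseteq> f S \<union> Y"
      by blast
    then have "G = G \<inter> f S \<union> Y" by blast
    moreover have "(S, G \<inter> f S, Y) \<in> ?D" using SY by auto
    ultimately show "G \<in> (\<lambda>(S, H, Y). H \<union> Y) ` ?D"
      by (intro image_eqI[of _ _ "(S, G \<inter> f S, Y)"]) simp_all
  qed
  then have "card \<F> \<le> card ((\<lambda>(S, H, Y). H \<union> Y) ` ?D)"
    using finD by (intro card_mono finite_imageI)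
  also have "\<dots> \<le> card ?D" using finD by (rule card_image_le)
  also have "\<dots> = (\<Sum>S\<in>?Sm. 2 ^ card (f S) * card ?Sm)"
    using finSm finf by (simp add: card_SigmaI card_cartesian_product card_Pow)
  finally have "real (card \<F>) \<le> real (\<Sum>S\<in>?Sm. 2 ^ card (f S) * card ?Sm)" by (rule of_nat_mono)
  also have "\<dots> = (\<Sum>S\<in>?Sm. 2 ^ card (f S) * real (card ?Sm))" by simp
  also have "\<dots> \<le> (\<Sum>S\<in>?Sm. 2 powr X * real (card ?Sm))"
  proof (intro sum_mono mult_right_mono)
    fix S
    have "(2 :: real) ^ card (f S) = 2 powr real (card (f S))" by (simp add: powr_realpow)
    also have "\<dots> \<le> 2 powr X" using X(2) by (intro powr_mono) auto
    finally show "2 ^ card (f S) \<le> 2 powr X" .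
  qed simp
  finally show ?thesis by (simp add: power2_eq_square mult_ac)
qed

lemma count_decomposable:
  fixes \<F> :: "'b set set" and \<M> :: "'b set set"
  assumes U: "finite U" and M: "M \<subseteq> U" and fin: "finite \<M>"
    and \<F>: "\<And>F. F \<in> \<F> \<Longrightarrow> F \<subseteq> U \<and> (\<exists>Fi. F \<inter> M = (\<Union>i\<in>I. Fi i) \<and> (\<forall>i\<in>I. Fi i \<in> \<M>))" and I: "finite I"
  shows "real (card \<F>) \<le> 2 ^ card (U - M) * real (card \<M>) ^ card I"
proof -
  let ?D = "Pow (U - M) \<times> (I \<rightarrow>\<^sub>E \<M>)"
  have finD: "finite ?D" using U fin I by (auto intro: finite_PiE)
  have "\<F> \<subseteq> (\<lambda>(R, g). R \<union> (\<Union>i\<in>I. g i)) ` ?D"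
  proof
    fix F assume "F \<in> \<F>"
    from \<F>[OF this] obtain Fi where F: "F \<subseteq> U" "F \<inter> M = (\<Union>i\<in>I. Fi i)" "\<forall>i\<in>I. Fi i \<in> \<M>" by blast
    have "(\<Union>i\<in>I. restrict Fi I i) = (\<Union>i\<in>I. Fi i)" by (intro SUP_cong) auto
    then have "F = (F - M) \<union> (\<Union>i\<in>I. restrict Fi I i)" using F(2) by (metis Int_Diff_Un Un_commute)
    moreover have "(F - M, restrict Fi I) \<in> ?D" using F by auto
    ultimately show "F \<in> (\<lambda>(R, g). R \<union> (\<Union>i\<in>I. g i)) ` ?D" 
      by (intro image_eqI[of _ _ "(F - M, restrict Fi I)"]) (simp_all only: prod.case)
  qed
  then have "card \<F> \<le> card ?D" using finD by (rule surj_card_le[rotated])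
  also have "\<dots> = 2 ^ card (U - M) * card \<M> ^ card I"
    using U I by (simp add: card_cartesian_product card_Pow card_PiE)
  finally have "real (card \<F>) \<le> real (2 ^ card (U - M) * card \<M> ^ card I)" by (rule of_nat_mono)
  then show ?thesis by simp
qed

text \<open>For distances above 19 the bound \<open>card_heavy_subsets\<close> has exponent at least 10, which leaves room to sum over
  all distances; the shorter distances are too few for their larger thresholds to matter.\<close>

definition two_scale :: "real \<Rightarrow> real \<Rightarrow> nat \<Rightarrow> real" where
  "two_scale s l d = (if d \<le> 19 then s else l)"

lemma sum_two_scale:
  assumes "0 \<le> s" "0 \<le> l"
  shows "(\<Sum>d=1..L. two_scale s l d) \<le> 19 * s + real L * l"
proof -
  have "(\<Sum>d=1..L. two_scale s l d) \<le> (\<Sum>d=1..L. (if d \<in> {1..19} then s else 0) + l)"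
    using assms by (intro sum_mono) (auto simp: two_scale_def)
  also have "\<dots> = (\<Sum>d\<in>{1..L} \<inter> {1..19}. s) + real L * l"
    by (simp only: sum.distrib sum.inter_restrict[OF finite_atLeastAtMost]) simp
  also have "(\<Sum>d\<in>{1..L} \<inter> {1..19}. s) \<le> (\<Sum>d\<in>{1..19::nat}. s)"
    using assms by (intro sum_mono2) auto
  finally show ?thesis by simp
qed

text \<open>Near the middle there are at least \<open>n / 3\<close> elements available in either
  direction, so the ratio 4K / card of the pool in \<open>card_heavy_subsets\<close> becomes 12K /
  n. Rounding d/2 up gives an exponent of at least 1 always and at least 10 from distance 20
  on.\<close>

lemma middle_hit:
  assumes L: "3 * L \<le> n" and K: "12 * K \<le> n" and \<sigma>: "0 \<le> \<sigma>"
    and s: "12 * real K / real n \<le> \<sigma> * s" and l: "(12 * real K / real n) ^ 10 \<le> \<sigma> * l"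
    and x: "x \<in> middle n L" and d: "d \<in> {1..L}" and Q: "finite Q" "card Q \<le> K"
    and D: "\<And>D. D \<in> \<D> \<Longrightarrow> D \<subseteq> pool n b x \<and> card D = d \<and> d \<le> 2 * card (D \<inter> Q)"
  shows "real (card \<D>) \<le> \<sigma> * (two_scale s l d * sphere_size n b x d)"
proof -
  let ?p = "card (pool n b x)"
  let ?\<kappa> = "12 * real K / real n"
  define i where "i = (d + 1) div 2"
  have n: "n > 0" using d L by (cases n) auto
  have p: "n \<le> 3 * ?p" using card_pool_middle[OF x, of b] L by linarith
  have fin: "finite (pool n b x)"
    using x by (auto simp: pool_def middle_def intro: finite_subset)
  have \<kappa>: "0 \<le> ?\<kappa>" "?\<kappa> \<le> 1" using K n by (auto simp: field_simps)
  have "real (card \<D>) \<le> (4 * real K / real ?p) ^ i * real (?p choose d)"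
  proof (rule card_heavy_subsets[OF fin Q])
    show "4 * K \<le> ?p" using K p by linarith
    show "d \<le> 2 * i" "i \<le> d" using d by (auto simp: i_def)
    show "D \<subseteq> pool n b x \<and> card D = d \<and> i \<le> card (D \<inter> Q)" if "D \<in> \<D>" for D
      using D[OF that] by (auto simp: i_def)
  qed
  also have "\<dots> \<le> ?\<kappa> ^ i * real (?p choose d)"
  proof (intro mult_right_mono power_mono)
    have "real n \<le> 3 * real ?p" using p by linarith
    then show "4 * real K / real ?p \<le> ?\<kappa>"
      using n p mult_left_mono[of "real n" "3 * real ?p" "real K"] by (simp add: field_simps)
  qed auto
  also have "\<dots> \<le> (\<sigma> * two_scale s l d) * real (?p choose d)"
  proof (rule mult_right_mono)
    show "?\<kappa> ^ i \<le> \<sigma> * two_scale s l d"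
    proof (cases "d \<le> 19")
      case True
      have "?\<kappa> ^ i \<le> ?\<kappa> ^ 1" using \<kappa> d by (intro power_decreasing) (auto simp: i_def)
      then show ?thesis using True s by (simp add: two_scale_def)
    next
      case False
      have "?\<kappa> ^ i \<le> ?\<kappa> ^ 10" using \<kappa> False by (intro power_decreasing) (auto simp: i_def)
      then show ?thesis using False l by (simp add: two_scale_def)
    qed
  qed simp
  finally show ?thesis by (simp add: mult.assoc)
qed

text \<open>The density \<open>e / 80\<close> at the 19 short distances and
  \<open>e / (4 * L)\<close> at the others sum to at most \<open>e / 2\<close>. The first times
  \<open>n / 3\<close>, and the second times a lower bound for choosing two elements, both give
  \<open>e * n / 240\<close>. The better ratio \<open>t1\<close> is available only at long
  distances.\<close>

lemma middle_supersaturation: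
  fixes e s l t1 t2 X :: real
  assumes L: "1 \<le> L" "6 * L \<le> n" and n: "6 \<le> n" and e: "0 < e" "e \<le> 1 / 2"
    and s: "s \<le> t2 * (e / 80)" and l: "l \<le> t1 * (e / (4 * real L))" and \<tau>: "0 \<le> t1" "t1 \<le> t2"
    and X: "central n < X * (1 - e)"
    and A: "A \<subseteq> middle n L" "real (card A) > X"
  shows "\<exists>x\<in>A. \<exists>b. \<exists>d\<in>{1..L}.
      e * real n / 240 \<le> real (card (nbrs_at b x d A)) \<and>
      two_scale s l d * sphere_size n b x d \<le>
        (if real (card A) \<le> 80 * central n then t2 else t1) *
        real (card (nbrs_at b x d A))"
proof -
  let ?N = "central n"
  have N: "?N > 0" by simp
  have nA: "narrow n L A" using narrow_mono[OF narrow_middle A(1)] .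
  define \<alpha> where "\<alpha> = two_scale (e / 80) (e / (4 * real L))"
  have \<alpha>0: "0 \<le> \<alpha> d" for d using e by (simp add: \<alpha>_def two_scale_def)
  have "(\<Sum>d=1..L. \<alpha> d) \<le> 19 * (e / 80) + real L * (e / (4 * real L))"
    unfolding \<alpha>_def using e by (intro sum_two_scale) auto
  also have "\<dots> \<le> e / 2" using e L by (simp add: field_simps)
  finally have \<alpha>1: "(\<Sum>d=Suc 0..L. 2 * \<alpha> d) \<le> e" by (simp flip: sum_distrib_left)
  have "(\<Sum>d=Suc 19..L. 2 * \<alpha> d) \<le> (\<Sum>d=Suc 0..L. 2 * \<alpha> d)"
    using \<alpha>0 by (intro sum_mono2) auto
  then have \<alpha>2: "(\<Sum>d=Suc 19..L. 2 * \<alpha> d) \<le> 1 / 2" using \<alpha>1 e by linarith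
  have "\<exists>x\<in>A. \<exists>b. \<exists>d\<in>{1..L}. (real (card A) \<le> 80 * ?N \<or> 19 < d) \<and>
    real (card (nbrs_at b x d A)) > \<alpha> d * sphere_size n b x d"
  proof (cases "real (card A) \<le> 80 * ?N")
    case True
    have "real (2 * 0 + 1) * ?N < real (card A) * (1 - e)"
    proof -
      have "X * (1 - e) \<le> real (card A) * (1 - e)" using A(2) e by (intro mult_right_mono) auto
      then show ?thesis using X by simp
    qed
    from supersaturation[OF nA \<alpha>0 \<alpha>1 _ this] show ?thesis using e True by auto
  next
    case False
    \<comment> \<open>Above \<open>80 * ?N\<close> sets one can insist on distances over 19: with
      \<open>e\<close> replaced by 1/2, more than \<open>78 * ?N\<close> sets are enough.\<close>
    have "real (2 * 19 + 1) * ?N < real (card A) * (1 - 1 / 2)" using False N by simp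
    from supersaturation[OF nA \<alpha>0 \<alpha>2 _ this] obtain x b d where "x \<in> A" "d \<in> {Suc 19..L}"
      "real (card (nbrs_at b x d A)) > \<alpha> d * sphere_size n b x d"
      by auto
    moreover have "d \<in> {1..L}" "19 < d" using calculation(2) by auto
    ultimately show ?thesis by blast
  qed
  then obtain x b d where x: "x \<in> A" and d: "d \<in> {1..L}" and big: "real (card A) \<le> 80 * ?N \<or> 19 < d"
    and D: "real (card (nbrs_at b x d A)) > \<alpha> d * sphere_size n b x d"
    by blast
  let ?D = "real (card (nbrs_at b x d A))"
  let ?p = "card (pool n b x)"
  have p: "n \<le> 3 * ?p" "2 * L \<le> ?p" using card_pool_middle[of x n L b] x A(1) L by auto
  have p': "real n / 3 \<le> real ?p" using p(1) by linarith
  have d2: "2 * d \<le> ?p" using d p by auto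
  have "e * real n / 240 \<le> \<alpha> d * real (?p choose d)"
  proof (cases "d \<le> 19")
    case True
    have "?p choose 1 \<le> ?p choose d" using d d2 by (intro binomial_mono) auto
    then have "real n / 3 \<le> real (?p choose d)" using p' by simp
    then have "e / 80 * (real n / 3) \<le> e / 80 * real (?p choose d)" using e by (intro mult_left_mono) auto
    then show ?thesis using True by (simp add: \<alpha>_def two_scale_def)
  next
    case False
    have "?p choose 2 \<le> ?p choose d" using False d2 by (intro binomial_mono) auto
    then have c2: "real (?p choose 2) \<le> real (?p choose d)" by (rule of_nat_mono)
    have "real (?p choose 2) = real ?p * (real ?p - 1) / 2"
    proof -
      have "even (?p * (?p - 1))" by (cases ?p) auto
      then have "2 * (?p choose 2) = ?p * (?p - 1)" by (simp add: choose_two)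
      then have "2 * real (?p choose 2) = real ?p * real (?p - 1)" by (metis of_nat_mult of_nat_numeral)
      moreover have "1 \<le> ?p" using d2 d by auto
      ultimately show ?thesis by (simp add: of_nat_diff)
    qed
    moreover have "real n / 3 * (real L / 10) \<le> real ?p * (real ?p - 1)"
    proof (rule mult_mono)
      have "real ?p \<ge> 2 * real L" using p(2) by linarith
      then show "real L / 10 \<le> real ?p - 1" using L by linarith
    qed (use p' in auto)
    ultimately have "real n / 3 * (real L / 10) / 2 \<le> real (?p choose d)" using c2 by linarith
    then have "e / (4 * real L) * (real n / 3 * (real L / 10) / 2) \<le> e / (4 * real L) * real (?p choose d)"
      using e by (intro mult_left_mono) auto
    then show ?thesis using False L by (simp add: \<alpha>_def two_scale_def)
  qed
  then have g: "e * real n / 240 \<le> ?D" using D by linarith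
  have "two_scale s l d * real (?p choose d) \<le> (if real (card A) \<le> 80 * ?N then t2 else t1) * (\<alpha> d * real (?p choose d))"
  proof -
    have "l \<le> t2 * (e / (4 * real L))"
    proof -
      have "0 \<le> e / (4 * real L)" using e by simp
      from mult_right_mono[OF \<tau>(2) this] l show ?thesis by linarith
    qed
    then have "two_scale s l d \<le> (if real (card A) \<le> 80 * ?N then t2 else t1) * \<alpha> d"
      using s l big by (auto simp: two_scale_def \<alpha>_def)
    then have "two_scale s l d * real (?p choose d) \<le> (if real (card A) \<le> 80 * ?N then t2 else t1) * \<alpha> d * real (?p choose d)"
      by (intro mult_right_mono) auto
    then show ?thesis by (simp add: mult.assoc)
  qed
  also have "\<dots> \<le> (if real (card A) \<le> 80 * ?N then t2 else t1) * ?D"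
    using D \<tau> by (intro mult_left_mono) auto
  finally show ?thesis using g x d by blast
qed

text \<open>Each \<open>G\<close> is covered by a container of size at most \<open>X\<close> and an
  exceptional part of at most \<open>m\<close> sets. In the bound by \<open>\<delta>\<close>, the
  first two terms pay for the sets discarded to make \<open>G\<close> thin, the third for the
  fingerprint \<open>S\<close>, and the last two for the recorded neighbours
  \<open>T\<close>.\<close>

lemma marked_count:
  fixes e c \<theta>s \<theta>l \<beta>s \<beta>l t1 t2 X \<delta> :: real
  assumes L: "1 \<le> L" "6 * L \<le> n" and n: "6 \<le> n" and e: "0 < e" "e \<le> 1 / 2" and c: "0 \<le> c"
    and pos: "0 < \<theta>s" "0 < \<theta>l" "0 < \<beta>s" "0 < \<beta>l"
    and \<theta>: "19 * (c * \<theta>s) + real L * (c * \<theta>l) \<le> 1 / 4"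
    and \<theta>\<beta>: "2 * c * \<theta>s \<le> \<beta>s" "2 * c * \<theta>l \<le> \<beta>l"
    and \<beta>: "\<beta>s \<le> t2 * (e / 80)" "\<beta>l \<le> t1 * (e / (4 * real L))" and \<tau>: "0 \<le> t1" "t1 \<le> t2"
    and X: "central n < X * (1 - e)"
    and \<delta>: "19 * (8 * c * \<theta>s / \<beta>s) + real L * (8 * c * \<theta>l / \<beta>l) + (real L + 1) * 240 / (e * real n)
      + t1 * (real L + 1) + 80 * t2 \<le> \<delta>"
    and m: "m = nat \<lfloor>\<delta> * central n\<rfloor>"
  shows "real (card {G. G \<subseteq> middle n L \<and> marked n (two_scale \<theta>s \<theta>l) L c G}) \<le>
    (real (card (small_subsets m (Pow {..<n}))))\<^sup>2 * 2 powr X"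
proof -
  let ?N = "central n" and ?M = "middle n L"
  let ?\<theta> = "two_scale \<theta>s \<theta>l" and ?\<beta> = "two_scale \<beta>s \<beta>l" and ?g = "e * real n / 240"
  have N: "?N > 0" by simp
  have "0 \<le> X"
  proof (rule ccontr)
    assume "\<not> 0 \<le> X"
    then have "X * (1 - e) \<le> 0" using e by (intro mult_nonpos_nonneg) auto
    then show False using X N by linarith
  qed
  have g: "?g > 0" using e n by simp
  have finM: "finite ?M" using narrow_middle by (rule narrow_finite)
  have \<beta>0: "0 < ?\<beta> d" and \<theta>0: "0 \<le> ?\<theta> d" for d using pos by (auto simp: two_scale_def)
  have \<theta>\<beta>': "2 * c * ?\<theta> d \<le> ?\<beta> d" for d using \<theta>\<beta> by (simp add: two_scale_def)
  have \<theta>sum: "(\<Sum>d=1..L. c * ?\<theta> d) \<le> 1 / 4"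
  proof -
    have "(\<Sum>d=1..L. c * ?\<theta> d) = (\<Sum>d=1..L. two_scale (c * \<theta>s) (c * \<theta>l) d)"
      by (intro sum.cong) (auto simp: two_scale_def)
    also have "\<dots> \<le> 19 * (c * \<theta>s) + real L * (c * \<theta>l)" using c pos by (intro sum_two_scale) auto
    finally show ?thesis using \<theta> by linarith
  qed
  have \<theta>\<beta>sum: "(\<Sum>d=1..L. 8 * c * ?\<theta> d / ?\<beta> d) \<le> 19 * (8 * c * \<theta>s / \<beta>s) + real L * (8 * c * \<theta>l / \<beta>l)"
  proof -
    have "(\<Sum>d=1..L. 8 * c * ?\<theta> d / ?\<beta> d) = (\<Sum>d=1..L. two_scale (8 * c * \<theta>s / \<beta>s) (8 * c * \<theta>l / \<beta>l) d)"
      by (intro sum.cong) (auto simp: two_scale_def)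
    also have "\<dots> \<le> 19 * (8 * c * \<theta>s / \<beta>s) + real L * (8 * c * \<theta>l / \<beta>l)" using c pos by (intro sum_two_scale) auto
    finally show ?thesis .
  qed
  have "\<exists>f. (\<forall>S. f S \<subseteq> ?M \<and> real (card (f S)) \<le> max X 0) \<and>
    (\<forall>G\<subseteq>?M. thin n ?\<beta> L G \<longrightarrow> (\<exists>S\<subseteq>G. \<exists>T\<subseteq>G. ?g * real (card S) \<le> real (card ?M) \<and>
       real (card T) \<le> t1 * real (card ?M) + t2 * min (real (card ?M)) (80 * ?N) \<and> G \<subseteq> f S \<union> S \<union> T))"
  proof (rule container[OF finM g])
    show "\<exists>x\<in>A. \<exists>b. \<exists>d\<in>{1..L}. ?g \<le> real (card (nbrs_at b x d A)) \<and>
      ?\<beta> d * sphere_size n b x d \<le> (if real (card A) \<le> 80 * ?N then t2 else t1) *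
        real (card (nbrs_at b x d A))"
      if "A \<subseteq> ?M" "X < real (card A)" for A
      by (rule middle_supersaturation[OF L n e \<beta> \<tau> X that])
  qed (use \<tau> \<beta>0 in \<open>auto intro: less_imp_le\<close>)
  then obtain f where f: "\<And>S. f S \<subseteq> ?M \<and> real (card (f S)) \<le> max X 0"
    and cov: "\<And>G. G \<subseteq> ?M \<Longrightarrow> thin n ?\<beta> L G \<Longrightarrow> \<exists>S\<subseteq>G. \<exists>T\<subseteq>G. ?g * real (card S) \<le> real (card ?M) \<and>
       real (card T) \<le> t1 * real (card ?M) + t2 * min (real (card ?M)) (80 * ?N) \<and> G \<subseteq> f S \<union> S \<union> T"
    by auto
  show ?thesis
  proof (rule count_coverable[where f = f])
    show "f S \<subseteq> Pow {..<n} \<and> real (card (f S)) \<le> X" for S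
      using f[of S] \<open>0 \<le> X\<close> by (auto simp: middle_def)
    fix G assume "G \<in> {G. G \<subseteq> ?M \<and> marked n ?\<theta> L c G}"
    then have GM: "G \<subseteq> ?M" and mk: "marked n ?\<theta> L c G" by auto
    have nG: "narrow n L G" using narrow_mono[OF narrow_middle GM] .
    from marked_thin[OF nG mk c \<theta>0 \<theta>sum \<beta>0 \<theta>\<beta>'] obtain B where B: "B \<subseteq> G"
      "real (card B) \<le> (\<Sum>d=1..L. 8 * c * ?\<theta> d / ?\<beta> d) * ?N" "thin n ?\<beta> L (G - B)" by auto
    have "G - B \<subseteq> ?M" using GM by auto
    from cov[OF this B(3)] obtain S T where ST: "S \<subseteq> G - B" "T \<subseteq> G - B" "?g * real (card S) \<le> real (card ?M)"
      "real (card T) \<le> t1 * real (card ?M) + t2 * min (real (card ?M)) (80 * ?N)" "G - B \<subseteq> f S \<union> S \<union> T"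
      by auto
    have cM: "real (card ?M) \<le> (real L + 1) * ?N" by (rule card_middle)
    let ?Y = "B \<union> S \<union> T"
    have "real (card ?Y) \<le> real (card B) + real (card S) + real (card T)"
      using card_Un_le[of "B \<union> S" T] card_Un_le[of B S] by linarith
    also have "real (card B) \<le> (19 * (8 * c * \<theta>s / \<beta>s) + real L * (8 * c * \<theta>l / \<beta>l)) * ?N"
      using B(2) mult_right_mono[OF \<theta>\<beta>sum, of ?N] by linarith
    also have "real (card S) \<le> (real L + 1) * 240 / (e * real n) * ?N"
    proof -
      have "?g * real (card S) \<le> (real L + 1) * ?N" using ST(3) cM by linarith
      then have "real (card S) \<le> (real L + 1) * ?N / ?g" using g by (simp add: field_simps)
      also have "\<dots> = (real L + 1) * 240 / (e * real n) * ?N" by simp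
      finally show ?thesis .
    qed
    also have "real (card T) \<le> t1 * ((real L + 1) * ?N) + t2 * (80 * ?N)"
    proof -
      have "t1 * real (card ?M) \<le> t1 * ((real L + 1) * ?N)" using cM \<tau> by (intro mult_left_mono) auto
      moreover have "t2 * min (real (card ?M)) (80 * ?N) \<le> t2 * (80 * ?N)" using \<tau> by (intro mult_left_mono) auto
      ultimately show ?thesis using ST(4) by linarith
    qed
    finally have "real (card ?Y) \<le> (19 * (8 * c * \<theta>s / \<beta>s) + real L * (8 * c * \<theta>l / \<beta>l) + (real L + 1) * 240 / (e * real n)
      + t1 * (real L + 1) + 80 * t2) * ?N"
      by (simp add: algebra_simps)
    also have "\<dots> \<le> \<delta> * ?N" using \<delta> by (intro mult_right_mono) auto
    finally have cY: "card ?Y \<le> m" unfolding m by (simp add: le_nat_floor)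
    have YG: "?Y \<subseteq> G" using B ST by auto
    have finG: "finite G" using nG by (rule narrow_finite)
    have "card S \<le> card ?Y" using finite_subset[OF YG finG] by (intro card_mono) auto
    then have "card S \<le> m" using cY by linarith
    moreover have "G \<subseteq> f S \<union> ?Y" using ST(5) by auto
    moreover have "G \<subseteq> Pow {..<n}" using GM by (auto simp: middle_def)
    ultimately show "\<exists>S Y. S \<subseteq> Pow {..<n} \<and> card S \<le> m \<and> Y \<subseteq> G \<and> Y \<subseteq> Pow {..<n} \<and> card Y \<le> m \<and> G \<subseteq> f S \<union> Y"
      using cY YG by (intro exI[of _ S] exI[of _ ?Y]) auto
  qed (use \<open>0 \<le> X\<close> in auto)
qed

section \<open>Assembling the count of induced free families\<close>

lemma free_mono: "induced_free A le F \<Longrightarrow> F' \<subseteq> F \<Longrightarrow> induced_free A le F'"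
  unfolding induced_free_def has_induced_copy_def by (meson subset_trans)

text \<open>The part of \<open>F\<close> outside the window is arbitrary and the part inside splits
  into \<open>k - 1\<close> marked families. \<open>K\<close> is large enough for both the sets to
  be avoided, \<open>2 * T * L\<close>, and the shadows, \<open>card A * L\<close>.\<close>

lemma free_count:
  fixes A :: "'a set" and \<theta>s \<theta>l \<sigma> c Y :: real
  assumes tree: "tree_poset A le" and k: "poset_height A le = k" and T: "T = k * card A"
    and c: "c = real T + 1" and K: "K = (2 * T + card A) * L"
    and \<sigma>0: "0 < \<sigma>" and \<sigma>1: "(real T + 1) * \<sigma> * real (card A) ^ 2 < 1"
    and n: "6 * L \<le> n" "12 * K \<le> n"
    and hit: "12 * real K / real n \<le> \<sigma> * \<theta>s" "(12 * real K / real n) ^ 10 \<le> \<sigma> * \<theta>l"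
    and pos: "0 < \<theta>s" "0 < \<theta>l"
    and count: "real (card {G. G \<subseteq> middle n L \<and> marked n (two_scale \<theta>s \<theta>l) L c G}) \<le> Y"
  shows "real (card {F. F \<subseteq> Pow {..<n} \<and> induced_free A le F}) \<le>
    2 ^ card (Pow {..<n} - middle n L) * Y ^ (k - 1)"
proof -
  let ?\<theta> = "two_scale \<theta>s \<theta>l" and ?M = "middle n L"
  let ?\<M> = "{G. G \<subseteq> ?M \<and> marked n ?\<theta> L c G}"
  have finM: "finite ?M" using narrow_middle by (rule narrow_finite)
  have "real (card {F. F \<subseteq> Pow {..<n} \<and> induced_free A le F}) \<le>
      2 ^ card (Pow {..<n} - ?M) * real (card ?\<M>) ^ card {1..<k}"
  proof (rule count_decomposable)
    show "?M \<subseteq> Pow {..<n}" by (auto simp: middle_def)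
    show "finite ?\<M>" using finM by simp
    fix F assume "F \<in> {F. F \<subseteq> Pow {..<n} \<and> induced_free A le F}"
    then have FU: "F \<subseteq> Pow {..<n}" and free: "induced_free A le F" by auto
    have sub: "F \<inter> ?M \<subseteq> ?M" by simp
    have nar: "narrow n L (F \<inter> ?M)" by (rule narrow_mono[OF narrow_middle sub])
    interpret layers n "F \<inter> ?M" k ?\<theta> \<sigma> K L
    proof
      show "F \<inter> ?M \<subseteq> Pow {..<n}" using FU by auto
      show "card (y - x) \<le> L" if "x \<in> F \<inter> ?M" "y \<in> F \<inter> ?M" "x \<subset> y" for x y
        using nar that unfolding narrow_def by blast
      show "0 \<le> ?\<theta> d" for d using pos by (simp add: two_scale_def)
      show "real (card \<D>) \<le> \<sigma> * (?\<theta> d * sphere_size n b x d)"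
        if "x \<in> F \<inter> ?M" "d \<in> {1..L}" "finite Q" "card Q \<le> K"
          "\<And>D. D \<in> \<D> \<Longrightarrow> D \<subseteq> pool n b x \<and> card D = d \<and> d \<le> 2 * card (D \<inter> Q)" for x d Q \<D> b
        using that n \<sigma>0 by (intro middle_hit[OF _ n(2) _ hit]) auto
    qed (rule \<sigma>0)
    have K': "2 * T * L \<le> K" "card A * L \<le> K" unfolding K by (simp_all add: algebra_simps)
    from marked_decomposition[OF tree k free_mono[OF free] T K' \<sigma>1]
    obtain Fi where Fi: "F \<inter> ?M = (\<Union>i\<in>{1..<k}. Fi i)" "\<forall>i\<in>{1..<k}. marked n ?\<theta> L (real T + 1) (Fi i)"
      by auto
    then have "\<forall>i\<in>{1..<k}. Fi i \<in> ?\<M>" using c by auto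
    then show "F \<subseteq> Pow {..<n} \<and> (\<exists>Fi. F \<inter> ?M = (\<Union>i\<in>{1..<k}. Fi i) \<and> (\<forall>i\<in>{1..<k}. Fi i \<in> ?\<M>))"
      using FU Fi(1) by blast
  qed auto
  also have "\<dots> \<le> 2 ^ card (Pow {..<n} - ?M) * Y ^ card {1..<k}"
    using count by (intro mult_left_mono power_mono) auto
  finally show ?thesis by simp
qed

text \<open>Take \<open>q\<close> to be 1 / n^2 in \<open>card_small_subsets\<close>: the factor
  from all subsets becomes negligible because 2^n is at most n + 1 times the central coefficient,
  and each of the \<open>m\<close> members costs only 2 ln n.\<close>

lemma small_families_bound:
  fixes \<delta> :: real
  assumes n: "1 \<le> n" and \<delta>: "0 \<le> \<delta>" and m: "m = nat \<lfloor>\<delta> * central n\<rfloor>"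
  shows "real (card (small_subsets m (Pow {..<n}))) \<le>
    2 powr (((real n + 1) / (real n)\<^sup>2 + 2 * \<delta> * ln (real n)) / ln 2 * central n)"
proof -
  let ?N = "central n"
  have "real (card (small_subsets m (Pow {..<n}))) \<le>
      exp (1 / (real n)\<^sup>2 * real (card (Pow {..<n}))) * (1 / (1 / (real n)\<^sup>2)) ^ m"
    using n by (intro card_small_subsets) auto
  also have "(1 / (1 / (real n)\<^sup>2)) ^ m = exp (real m * (2 * ln (real n)))"
    using n by (simp add: exp_of_nat_mult exp_double flip: power_mult)
  also have "exp (1 / (real n)\<^sup>2 * real (card (Pow {..<n}))) * \<dots> =
      exp (2 ^ n / (real n)\<^sup>2 + real m * (2 * ln (real n)))"
    by (simp add: exp_add card_Pow)
  also have "\<dots> \<le> exp (((real n + 1) / (real n)\<^sup>2 + 2 * \<delta> * ln (real n)) * ?N)"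
  proof -
    have "2 ^ n / (real n)\<^sup>2 \<le> (real n + 1) * ?N / (real n)\<^sup>2"
      using two_power_le by (intro divide_right_mono) auto
    moreover have "real m \<le> \<delta> * ?N" using \<delta> by (simp add: m)
    then have "real m * (2 * ln (real n)) \<le> \<delta> * ?N * (2 * ln (real n))"
      using n by (intro mult_right_mono) auto
    ultimately show ?thesis by (simp add: algebra_simps)
  qed
  also have "\<dots> = 2 powr (((real n + 1) / (real n)\<^sup>2 + 2 * \<delta> * ln (real n)) / ln 2 * ?N)"
    by (simp add: powr_def)
  finally show ?thesis .
qed

theorem theorem1p5:
  fixes A :: "'a set" and le :: "'a \<Rightarrow> 'a \<Rightarrow> bool" and k :: nat
  assumes "tree_poset A le"
    and "poset_height A le = k"
  shows "\<forall>\<epsilon>::real. \<epsilon> > 0 \<longrightarrow> (\<exists>n0::nat. \<forall>n\<ge>n0.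
           real (card {F. F \<subseteq> Pow {..<n} \<and> induced_free A le F})
             \<le> 2 powr ((real k - 1 + \<epsilon>) * real (n choose (n div 2))))"
proof (intro allI impI)
  fix \<epsilon> :: real assume \<epsilon>: "\<epsilon> > 0"
  have po: "finite_poset A le" and ne: "A \<noteq> {}" using assms(1) by (auto simp: tree_poset_def)
  obtain q where q: "q \<in> A" using ne by auto
  have k1: "1 \<le> k" using ht_bounds[OF po q] assms(2) by linarith
  define T where "T = k * card A"
  define c where "c = real T + 1"
  define \<sigma> where "\<sigma> = 1 / (2 * c * (real (card A) ^ 2 + 1))"
  define D where "D = real (2 * T + card A)"
  define \<epsilon>1 where "\<epsilon>1 = \<epsilon> / (2 * real k)"
  \<comment> \<open>Chosen so that (1 + \<epsilon>1)(1 - e) = 1 + \<epsilon>1 / 2, which exceeds 1: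
    containers of size 1 + \<epsilon>1 times the central coefficient can then be reached by
    supersaturation.\<close>
  define e where "e = \<epsilon>1 / (2 * (1 + \<epsilon>1))"
  define r where "r = real k"
  have c: "c \<ge> 1" by (simp add: c_def)
  have \<sigma>: "\<sigma> > 0" using c by (simp add: \<sigma>_def add_nonneg_pos)
  have D: "D \<ge> 0" by (simp add: D_def)
  have \<epsilon>1: "\<epsilon>1 > 0" using \<epsilon> k1 by (simp add: \<epsilon>1_def)
  have e: "0 < e" "e \<le> 1 / 2" using \<epsilon>1 by (simp_all add: e_def field_simps)
  have r: "r \<ge> 1" using k1 by (simp add: r_def)
  have \<sigma>1: "(real T + 1) * \<sigma> * real (card A) ^ 2 < 1"
  proof -
    have "(real T + 1) * \<sigma> * real (card A) ^ 2 = real (card A) ^ 2 / (2 * (real (card A) ^ 2 + 1))"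
      using c by (simp add: \<sigma>_def flip: c_def)
    also have "\<dots> < 1" by (simp add: divide_less_eq add_nonneg_pos)
    finally show ?thesis .
  qed
  \<comment> \<open>The exponent must exceed 1/2 for the tails to vanish and be below 1 for
    \<open>K / n\<close> to vanish. With 0.6, \<open>12 * K / n\<close> is of order -0.4 and its
    tenth power of order -4. This leaves room for the short and long thresholds -0.2, -3 of
    \<open>marked\<close>, -0.1, -2 of \<open>thin\<close>, the rates -0.05, -1 of
    \<open>container\<close>, and the total -0.02, which still vanishes after multiplication by ln
    n.\<close>
  define u where "u n = real n powr 0.6" for n :: nat
  have ev: "eventually (\<lambda>n. 6 \<le> n) sequentially" by (rule eventually_ge_at_top)
  have e1: "eventually (\<lambda>n::nat. 1 \<le> u n) sequentially" unfolding u_def by real_asymp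
  have e2: "eventually (\<lambda>n::nat. 6 * u n \<le> real n) sequentially" unfolding u_def by real_asymp
  have e3: "eventually (\<lambda>n::nat. 12 * (D * u n) \<le> real n) sequentially"
    unfolding u_def using D by (cases "D = 0") (simp, real_asymp)
  have e4: "eventually (\<lambda>n::nat. 12 * (D * u n) / real n \<le> \<sigma> * real n powr -0.2) sequentially"
    unfolding u_def using D \<sigma> by (cases "D = 0") (simp, real_asymp)
  have e5: "eventually (\<lambda>n::nat. (12 * (D * u n) / real n) ^ 10 \<le> \<sigma> * real n powr -3) sequentially"
    unfolding u_def using D \<sigma> by (cases "D = 0") (simp, real_asymp)
  have e6: "eventually (\<lambda>n::nat. 19 * (c * real n powr -0.2) + u n * (c * real n powr -3) \<le> 1 / 4) sequentially"
    unfolding u_def using c by real_asymp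
  have e7: "eventually (\<lambda>n::nat. 2 * c * real n powr -0.2 \<le> real n powr -0.1) sequentially"
    using c by real_asymp
  have e8: "eventually (\<lambda>n::nat. 2 * c * real n powr -3 \<le> real n powr -2) sequentially"
    using c by real_asymp
  have e9: "eventually (\<lambda>n::nat. real n powr -0.1 \<le> real n powr -0.05 * (e / 80)) sequentially"
    using e by real_asymp
  have e10: "eventually (\<lambda>n::nat. real n powr -2 \<le> real n powr -1 * (e / (4 * u n))) sequentially"
    unfolding u_def using e by real_asymp
  have e11: "eventually (\<lambda>n::nat. real n powr -1 \<le> real n powr -0.05) sequentially"
    by real_asymp
  have e12: "eventually (\<lambda>n::nat. 19 * (8 * c * real n powr -0.2 / real n powr -0.1) +
      u n * (8 * c * real n powr -3 / real n powr -2) + (u n + 1) * 240 / (e * real n)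
      + real n powr -1 * (u n + 1) + 80 * real n powr -0.05 \<le> real n powr -0.02) sequentially"
    unfolding u_def using c e by real_asymp
  have e13: "eventually (\<lambda>n::nat. 2 * ((real n + 1) * exp (1 - (u n - 1) / sqrt (real n))) +
      r * (2 * (((real n + 1) / (real n)\<^sup>2 + 2 * real n powr -0.02 * ln (real n)) / ln 2)) \<le> \<epsilon> / 2) sequentially"
    unfolding u_def using r \<epsilon> by real_asymp
  have "eventually (\<lambda>n. real (card {F. F \<subseteq> Pow {..<n} \<and> induced_free A le F})
             \<le> 2 powr ((real k - 1 + \<epsilon>) * central n)) sequentially"
    using ev e1 e2 e3 e4 e5 e6 e7 e8 e9 e10 e11 e12 e13
  proof eventually_elim
    case (elim n)
    let ?N = "central n"
    have N: "?N > 0" by simp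
    define L where "L = nat \<lfloor>u n\<rfloor>"
    define K where "K = (2 * T + card A) * L"
    define X where "X = (1 + \<epsilon>1) * ?N"
    define \<delta> where "\<delta> = real n powr -0.02"
    define m where "m = nat \<lfloor>\<delta> * ?N\<rfloor>"
    have Lu: "real L \<le> u n" "u n - 1 \<le> real L" using elim(2) by (auto simp: L_def)
    have L1: "1 \<le> L" using elim(2) by (simp add: L_def le_nat_floor)
    have n0: "real n > 0" using elim(1) by simp
    have KD: "real K \<le> D * u n"
      using mult_left_mono[OF Lu(1) D] by (simp add: K_def D_def)
    have n6: "6 * L \<le> n" using elim(3) Lu(1) by linarith
    have "real (card {G. G \<subseteq> middle n L \<and> marked n (two_scale (real n powr -0.2) (real n powr -3)) L c G}) \<le>
      (real (card (small_subsets m (Pow {..<n}))))\<^sup>2 * 2 powr X"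
    proof (rule marked_count[OF L1 n6 elim(1) e _ _ _ _ _ _ elim(8,9,10) _ _ elim(12) _ _ m_def])
      have "real L * (c * real n powr -3) \<le> u n * (c * real n powr -3)"
        using Lu c by (intro mult_right_mono) auto
      then show "19 * (c * real n powr -0.2) + real L * (c * real n powr -3) \<le> 1 / 4" using elim(7) by linarith
      have "e / (4 * u n) \<le> e / (4 * real L)"
        using Lu L1 e by (intro divide_left_mono) auto
      then have "real n powr -1 * (e / (4 * u n)) \<le> real n powr -1 * (e / (4 * real L))"
        by (intro mult_left_mono) auto
      then show "real n powr -2 \<le> real n powr -1 * (e / (4 * real L))" using elim(11) by linarith
      have "X * (1 - e) = (1 + \<epsilon>1 / 2) * ?N" using \<epsilon>1 by (simp add: X_def e_def field_simps)
      then show "?N < X * (1 - e)" using \<epsilon>1 N by simp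
      have "real L * (8 * c * real n powr -3 / real n powr -2) \<le> u n * (8 * c * real n powr -3 / real n powr -2)"
        using Lu c by (intro mult_right_mono) auto
      moreover have "(real L + 1) * 240 / (e * real n) \<le> (u n + 1) * 240 / (e * real n)"
        using Lu e n0 by (intro divide_right_mono mult_right_mono) auto
      moreover have "real n powr -1 * (real L + 1) \<le> real n powr -1 * (u n + 1)"
        using Lu by (intro mult_left_mono) auto
      ultimately show "19 * (8 * c * real n powr -0.2 / real n powr -0.1) +
        real L * (8 * c * real n powr -3 / real n powr -2) + (real L + 1) * 240 / (e * real n)
        + real n powr -1 * (real L + 1) + 80 * real n powr -0.05 \<le> \<delta>"
        using elim(13) unfolding \<delta>_def by linarith
    qed (use n0 c in auto)
    then have main: "real (card {F. F \<subseteq> Pow {..<n} \<and> induced_free A le F}) \<le>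
      2 ^ card (Pow {..<n} - middle n L) *
      ((real (card (small_subsets m (Pow {..<n}))))\<^sup>2 * 2 powr X) ^ (k - 1)"
    proof (rule free_count[OF assms T_def c_def K_def \<sigma> \<sigma>1 n6, rotated 5])
      show "12 * K \<le> n" using elim(4) KD by linarith
      have q: "12 * real K / real n \<le> 12 * (D * u n) / real n"
        using KD n0 by (intro divide_right_mono) auto
      then show "12 * real K / real n \<le> \<sigma> * real n powr -0.2" using elim(5) by linarith
      have "(12 * real K / real n) ^ 10 \<le> (12 * (D * u n) / real n) ^ 10"
        using q by (intro power_mono) auto
      then show "(12 * real K / real n) ^ 10 \<le> \<sigma> * real n powr -3" using elim(6) by linarith
    qed (use n0 in auto)
    define tl where "tl = 2 * ((real n + 1) * exp (1 - (u n - 1) / sqrt (real n)))"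
    define s where "s = ((real n + 1) / (real n)\<^sup>2 + 2 * \<delta> * ln (real n)) / ln 2"
    have tail: "real (card (Pow {..<n} - middle n L)) \<le> tl * ?N"
    proof -
      \<comment> \<open>This makes \<open>n * ?t^2\<close> equal to 1, while \<open>?t * L\<close>
        grows like n powr 0.1 and beats the factor n + 1 lost in
        \<open>two_power_le\<close>.\<close>
      let ?t = "1 / sqrt (real n)"
      have "real (card (Pow {..<n} - middle n L)) \<le> 2 * (2 ^ n * exp (real n * ?t\<^sup>2 - ?t * real L))"
        using elim(1) by (intro card_tail) (auto simp: field_simps)
      also have "real n * ?t\<^sup>2 = 1" using n0 by (simp add: power_divide)
      also have "2 * (2 ^ n * exp (1 - ?t * real L)) \<le>
          2 * (((real n + 1) * ?N) * exp (1 - (u n - 1) / sqrt (real n)))"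
      proof (intro mult_left_mono mult_mono two_power_le)
        have "(u n - 1) / sqrt (real n) \<le> real L / sqrt (real n)"
          using Lu by (intro divide_right_mono) auto
        then show "exp (1 - ?t * real L) \<le> exp (1 - (u n - 1) / sqrt (real n))" by simp
      qed auto
      finally show ?thesis by (simp add: tl_def mult_ac)
    qed
    have small: "real (card (small_subsets m (Pow {..<n}))) \<le> 2 powr (s * ?N)"
      unfolding s_def using elim(1) by (intro small_families_bound m_def) (auto simp: \<delta>_def)
    have "2 ^ card (Pow {..<n} - middle n L) *
        ((real (card (small_subsets m (Pow {..<n}))))\<^sup>2 * 2 powr X) ^ (k - 1)
      \<le> 2 powr (tl * ?N) * ((2 powr (s * ?N))\<^sup>2 * 2 powr X) ^ (k - 1)"
    proof (intro mult_mono power_mono small mult_right_mono)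
      have "(2 :: real) ^ card (Pow {..<n} - middle n L) = 2 powr real (card (Pow {..<n} - middle n L))"
        by (simp add: powr_realpow)
      also have "\<dots> \<le> 2 powr (tl * ?N)" using tail by (intro powr_mono) auto
      finally show "(2 :: real) ^ card (Pow {..<n} - middle n L) \<le> 2 powr (tl * ?N)" .
    qed auto
    also have "\<dots> = 2 powr (tl * ?N + real (k - 1) * (2 * s * ?N + X))"
      by (simp add: powr_add powr_realpow[symmetric] powr_powr algebra_simps power_mult_distrib powr_power)
    \<comment> \<open>Half of \<epsilon> pays for the tails and the small families, the other half
      for the excess \<epsilon>1 of the containers over the central coefficient in
      \<open>k - 1\<close> families.\<close>
    also have "\<dots> \<le> 2 powr ((real k - 1 + \<epsilon>) * ?N)"
    proof (rule powr_mono)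
      have s0: "0 \<le> s" using elim(1) by (simp add: s_def \<delta>_def)
      have kk: "real (k - 1) = r - 1" using k1 by (simp add: r_def)
      have "(r - 1) * (2 * s) \<le> r * (2 * s)" using s0 by (intro mult_right_mono) auto
      then have "tl + (r - 1) * (2 * s) \<le> \<epsilon> / 2" using elim(14) unfolding tl_def s_def \<delta>_def by linarith
      moreover have "(r - 1) * (1 + \<epsilon>1) \<le> r - 1 + \<epsilon> / 2"
      proof -
        have "r * \<epsilon>1 = \<epsilon> / 2" using k1 by (simp add: r_def \<epsilon>1_def)
        then show ?thesis using \<epsilon>1 by (simp add: algebra_simps)
      qed
      ultimately have "tl + (r - 1) * (2 * s) + (r - 1) * (1 + \<epsilon>1) \<le> r - 1 + \<epsilon>" by linarith
      from mult_right_mono[OF this, of ?N]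
      show "tl * ?N + real (k - 1) * (2 * s * ?N + X) \<le> (real k - 1 + \<epsilon>) * ?N"
        unfolding kk X_def by (simp add: r_def algebra_simps)
    qed simp
    finally show ?case using main by linarith
  qed
  then show "\<exists>n0::nat. \<forall>n\<ge>n0. real (card {F. F \<subseteq> Pow {..<n} \<and> induced_free A le F})
             \<le> 2 powr ((real k - 1 + \<epsilon>) * central n)"
    by (simp add: eventually_sequentially)
qed

end
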